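(* Let $\tilde J$ be the infinite anti-diagonal matrix with all anti-diagonal entries equal to $1$, and let $Q=Q(\mathbf t_B)$ be the infinite skew-symmetric matrix with rows (from top to bottom) and columns (from left to right) labelled by $\dots,3,2,1,0$, whose entry in row $a$ and column $b$ is $-Q_{a,b}(\mathbf t_B)$ for $a>b$, is $Q_{b,a}(\mathbf t_B)$ for $a<b$, and is $0$ for $a=b$. Then the $\tau$-functions $\tau_{\mathrm{BKP}}(\mathbf t_B)$ of the BKP hierarchy in the big Schubert cell, normalized by $\tau_{\mathrm{BKP}}(\mathbf 0)=1$, are exactly the formal power series of the form $$\tau_{\mathrm{BKP}}(\mathbf t_B)=\mathrm{Pf}\begin{pmatrix} Q & \tilde J\\ -\tilde J^{T} & R\end{pmatrix}=\sum_{\lambda\in \mathrm{DP}}\mathrm{Pf}(R_\lambda)\,Q_\lambda(\mathbf t_B),$$ where $R=(r_{i,j})_{i,j\ge 0}$, $r_{i,j}=-r_{j,i}\in\mathbb C$, is an arbitrary skew-symmetric matrix (rows and columns labelled $0,1,2,\dots$). In particular the second equality holds for every such $R$.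
   Context: Schur-$Q$ functions. $\mathbf t_B=(t_1,t_3,t_5,\dots)$. Polynomials $q_i(\mathbf t_B)$ are defined by $\exp(\sum_{k\ge1\text{ odd}}t_kz^k)=\sum_{i\ge0}q_i(\mathbf t_B)z^i$. For integers $a>b\ge1$ put $Q_{a,b}=\frac12q_aq_b+\sum_{k=1}^{b}(-1)^kq_{a+k}q_{b-k}$; for $a\ge1$ put $Q_{a,0}=\frac1{\sqrt2}q_a$; and $Q_{b,a}=-Q_{a,b}$, $Q_{a,a}=0$. $\mathrm{DP}$ is the set of strict partitions $\lambda=(\lambda_1>\dots>\lambda_m>0)$, including the empty one. If $m$ is odd, $\lambda$ is augmented to $(\lambda_1,\dots,\lambda_m,0)$. With $\lambda=(\lambda_1,\dots,\lambda_{2\ell})$ augmented if necessary, $Q_\lambda=\mathrm{Pf}(Q_{\lambda_i,\lambda_j})_{1\le i,j\le2\ell}$ and $R_\lambda=(r_{\lambda_i,\lambda_j})_{1\le i,j\le2\ell}$; $Q_\emptyset=1$ and $\mathrm{Pf}(R_\emptyset)=1$. Infinite Pfaffian. The Pfaffian of the infinite matrix is the limit as $n\to\infty$, in $\mathbb C[[t_1,t_3,\dots]]$ with the topology of the grading $\deg t_k=k$, of the Pfaffians of its $(2n+2)\times(2n+2)$ truncations, in which $Q$ is restricted to the labels $n,n-1,\dots,0$, $R$ to the labels $0,1,\dots,n$, and $\tilde J$ is the $(n+1)\times(n+1)$ anti-diagonal matrix of ones. BKP $\tau$-functions and the big cell. Let $A$ be the ordered index set $(\dots,-2,-1,-0,+0,1,2,\dots)$,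 where $-0$ and $+0$ are distinct and negation exchanges them. Let $\hat V$ be the space of formal vectors $x=\sum_{\alpha\in A}x_\alpha e_\alpha$ with $x_\alpha=0$ for all sufficiently negative $\alpha$, with quadratic form $\tilde Q(x)=\sum_{k\ge0}(-1)^kx_{+k}x_{-k}$. Let $\mathcal N_-$ be the group of lower unitriangular $A\times A$ complex matrices preserving $\tilde Q$ and fixing $e_{-0}-e_{+0}$; it acts on $\hat V$. The big Schubert cell is the set of subspaces $U=N\cdot\mathrm{span}\{e_{-0},e_{-1},e_{-2},\dots\}$, $N\in\mathcal N_-$. Define operators $X_\alpha$ ($\alpha\in\mathbb Z$) on $\mathbb C[[t_1,t_3,\dots]]$ (the neutral-fermion realization of the spin representation, i.e. the type $B$ boson-fermion correspondence) by $$\sum_{\alpha\in\mathbb Z}X_\alpha z^\alpha=\tfrac1{\sqrt2}\exp\Big(\sum_{k\text{ odd}}t_kz^k\Big)\exp\Big(-2\sum_{k\text{ odd}}\tfrac{z^{-k}}{k}\tfrac{\partial}{\partial t_k}\Big).$$ For $x\in\hat V$ with $x_{-0}=x_{+0}$ let $X(x)=\sqrt2\,x_{-0}X_0+\sum_{\alpha\ne\pm0}x_\alpha X_\alpha$. The BKP $\tau$-function attached to $U$ is the element $\tau_U\in\mathbb C[[t_1,t_3,\dots]]$, nonzero and unique up to a nonzero constant, with $X(x)\tau_U=0$ for all $x\in U$ with $x_{-0}=x_{+0}$. The BKP $\tau$-functions in the big Schubert cell are these $\tau_U$ for $U$ in the big Schubert cell. *)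

theory Defs
  imports
    "HOL-Analysis.Infinite_Sum"
    "HOL-Library.Poly_Mapping"
    "HOL-Computational_Algebra.Formal_Power_Series"
    "HOL-Combinatorics.Permutations"
begin

unbundle fps_syntax

section \<open>The ring \<open>\<complex>[[t\<^sub>1, t\<^sub>3, t\<^sub>5, \<dots>]]\<close>\<close>

text \<open>
  An exponent vector \<open>m :: nat \<Rightarrow>\<^sub>0 nat\<close> stands for the monomial
  \<open>\<Prod>i. t\<^bsub>2i+1\<^esub> ^ (lookup m i)\<close>, that is, the variable \<open>t\<^bsub>2i+1\<^esub>\<close> has number \<open>i\<close>.
\<close>

type_synonym monomial = "nat \<Rightarrow>\<^sub>0 nat"

typedef tseries = "UNIV :: (monomial \<Rightarrow> complex) set"
  morphisms coeff Abs_tseries ..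

lemma coeff_Abs [simp]: "coeff (Abs_tseries f) = f"
  by (simp add: Abs_tseries_inverse)

lemma tseries_eqI: "(\<And>m. coeff f m = coeff g m) \<Longrightarrow> f = g"
  by (metis coeff_inject ext)

definition splits :: "monomial \<Rightarrow> (monomial \<times> monomial) set" where
  "splits m = {(a, b). a + b = m}"

lemma finite_monomial_le: "finite {a :: monomial. \<exists>b. a + b = m}"
proof -
  let ?F = "{f. \<forall>i. (i \<in> Poly_Mapping.keys m \<longrightarrow> f i \<in> {..Max (Poly_Mapping.lookup m ` Poly_Mapping.keys m)}) \<and>
                 (i \<notin> Poly_Mapping.keys m \<longrightarrow> f i = (0 :: nat))}"
  have "Poly_Mapping.lookup ` {a :: monomial. \<exists>b. a + b = m} \<subseteq> ?F"
  proof clarify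
    fix a b i
    assume m: "m = a + b"
    show "(i \<in> Poly_Mapping.keys (a + b) \<longrightarrow> Poly_Mapping.lookup a i \<in> {..Max (Poly_Mapping.lookup (a + b) ` Poly_Mapping.keys (a + b))}) \<and>
          (i \<notin> Poly_Mapping.keys (a + b) \<longrightarrow> Poly_Mapping.lookup a i = 0)"
    proof (intro conjI impI)
      assume "i \<in> Poly_Mapping.keys (a + b)"
      then have "Poly_Mapping.lookup (a + b) i \<le> Max (Poly_Mapping.lookup (a + b) ` Poly_Mapping.keys (a + b))"
        by (intro Max_ge) auto
      then show "Poly_Mapping.lookup a i \<in> {..Max (Poly_Mapping.lookup (a + b) ` Poly_Mapping.keys (a + b))}"
        by (simp add: lookup_add)
    qed (simp add: in_keys_iff lookup_add)
  qed
  moreover have "finite ?F"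
    by (rule finite_set_of_finite_funs) auto
  ultimately have "finite (Poly_Mapping.lookup ` {a :: monomial. \<exists>b. a + b = m})"
    by (rule finite_subset)
  then show ?thesis
    by (rule finite_imageD) (simp add: inj_on_def poly_mapping_eqI)
qed

lemma finite_splits [simp]: "finite (splits m)"
proof (rule finite_subset)
  show "splits m \<subseteq> {a. \<exists>b. a + b = m} \<times> {a. \<exists>b. a + b = m}"
    by (auto simp: splits_def) (metis add.commute)
qed (simp add: finite_monomial_le)

instantiation tseries :: comm_ring_1
begin

definition "0 = Abs_tseries (\<lambda>_. 0)"
definition "1 = Abs_tseries (\<lambda>m. if m = 0 then 1 else 0)"
definition "f + g = Abs_tseries (\<lambda>m. coeff f m + coeff g m)"
definition "f - g = Abs_tseries (\<lambda>m. coeff f m - coeff g m)"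
definition "- f = Abs_tseries (\<lambda>m. - coeff f m)"
definition "f * g = Abs_tseries (\<lambda>m. \<Sum>(a, b)\<in>splits m. coeff f a * coeff g b)"

instance
proof
  fix f g h :: tseries
  show "f * g * h = f * (g * h)"
  proof (rule tseries_eqI)
    fix m
    have "coeff (f * g * h) m =
        (\<Sum>(p, c)\<in>splits m. \<Sum>(a, b)\<in>splits p. coeff f a * coeff g b * coeff h c)"
      by (simp add: times_tseries_def sum_distrib_right case_prod_beta)
    also have "\<dots> = (\<Sum>(x, y)\<in>Sigma (splits m) (\<lambda>x. splits (fst x)).
        coeff f (fst y) * coeff g (snd y) * coeff h (snd x))"
      by (simp add: sum.Sigma case_prod_beta)
    also have "\<dots> = (\<Sum>(x, y)\<in>Sigma (splits m) (\<lambda>x. splits (snd x)).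
        coeff f (fst x) * (coeff g (fst y) * coeff h (snd y)))"
      by (rule sum.reindex_bij_witness
            [where j = "\<lambda>(x, y). ((fst y, snd y + snd x), (snd y, snd x))"
               and i = "\<lambda>(x, y). ((fst x + fst y, snd y), (fst x, fst y))"])
         (auto simp: splits_def algebra_simps)
    also have "\<dots> = (\<Sum>(a, p)\<in>splits m. \<Sum>(b, c)\<in>splits p. coeff f a * (coeff g b * coeff h c))"
      by (simp add: sum.Sigma case_prod_beta)
    also have "\<dots> = coeff (f * (g * h)) m"
      by (simp add: times_tseries_def sum_distrib_left case_prod_beta)
    finally show "coeff (f * g * h) m = coeff (f * (g * h)) m" .
  qed
  show "f * g = g * f"
    unfolding times_tseries_def
    by (intro arg_cong[where f = Abs_tseries] ext
              sum.reindex_bij_witness[where i = "\<lambda>(a, b). (b, a)" and j = "\<lambda>(a, b). (b, a)"])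
       (auto simp: splits_def algebra_simps)
  show "1 * f = f"
  proof (rule tseries_eqI)
    fix m
    have "coeff (1 * f) m = (\<Sum>x\<in>splits m. if fst x = 0 then coeff f (snd x) else 0)"
      by (auto simp: times_tseries_def one_tseries_def intro!: sum.cong)
    also have "\<dots> = (\<Sum>x\<in>{(0 :: monomial, m)}. coeff f (snd x))"
    proof (rule sum.mono_neutral_cong_right[OF finite_splits])
      show "{(0, m)} \<subseteq> splits m" by (simp add: splits_def)
      show "\<forall>x\<in>splits m - {(0, m)}. (if fst x = 0 then coeff f (snd x) else 0) = 0"
      proof
        fix x assume x: "x \<in> splits m - {(0, m)}"
        obtain a b where [simp]: "x = (a, b)" by (cases x)
        have "a \<noteq> 0" using x by (auto simp: splits_def)
        then show "(if fst x = 0 then coeff f (snd x) else 0) = 0" by simp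
      qed
    qed simp
    finally show "coeff (1 * f) m = coeff f m" by simp
  qed
  show "(f + g) * h = f * h + g * h"
    by (simp add: times_tseries_def plus_tseries_def distrib_right case_prod_beta sum.distrib)
  show "(0 :: tseries) \<noteq> 1"
  proof
    assume "(0 :: tseries) = 1"
    then have "coeff 0 0 = coeff 1 0" by simp
    then show False by (simp add: zero_tseries_def one_tseries_def)
  qed
qed (rule tseries_eqI,
     simp add: zero_tseries_def plus_tseries_def minus_tseries_def uminus_tseries_def)+

end

definition weight :: "monomial \<Rightarrow> nat" where
  "weight m = (\<Sum>i\<in>Poly_Mapping.keys m. (2 * i + 1) * Poly_Mapping.lookup m i)"

text \<open>
  The topology of the grading \<open>deg t\<^sub>k = k\<close>: the series without terms of degree less than \<open>n\<close>,
  for \<open>n = 0, 1, 2, \<dots>\<close>, form a neighbourhood base of \<open>0\<close>.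
\<close>

definition agree_below :: "nat \<Rightarrow> tseries \<Rightarrow> tseries \<Rightarrow> bool" where
  "agree_below n f g \<longleftrightarrow> (\<forall>m. weight m < n \<longrightarrow> coeff f m = coeff g m)"

lemma agree_below_mono: "agree_below n f g \<Longrightarrow> k \<le> n \<Longrightarrow> agree_below k f g"
  by (simp add: agree_below_def)

instantiation tseries :: t2_space
begin

definition open_tseries :: "tseries set \<Rightarrow> bool" where
  "open_tseries S \<longleftrightarrow> (\<forall>f\<in>S. \<exists>n. \<forall>g. agree_below n f g \<longrightarrow> g \<in> S)"

instance
proof
  fix S T :: "tseries set"
  show "open (S \<inter> T)" if "open S" "open T"
    unfolding open_tseries_def
  proof
    fix f assume "f \<in> S \<inter> T"
    then obtain k l where "\<forall>g. agree_below k f g \<longrightarrow> g \<in> S" "\<forall>g. agree_below l f g \<longrightarrow> g \<in> T"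
      using \<open>open S\<close> \<open>open T\<close> unfolding open_tseries_def by blast
    then show "\<exists>n. \<forall>g. agree_below n f g \<longrightarrow> g \<in> S \<inter> T"
      by (intro exI[of _ "max k l"]) (meson IntI agree_below_mono max.cobounded1 max.cobounded2)
  qed
next
  fix f g :: tseries
  assume "f \<noteq> g"
  then obtain m where m: "coeff f m \<noteq> coeff g m" using tseries_eqI by blast
  let ?B = "\<lambda>f. {h. agree_below (Suc (weight m)) f h}"
  have "open (?B h)" for h
    by (auto simp: open_tseries_def agree_below_def)
  moreover have "f \<in> ?B f" "g \<in> ?B g" "?B f \<inter> ?B g = {}"
    using m by (auto simp: agree_below_def)
  ultimately show "\<exists>U V. open U \<and> open V \<and> f \<in> U \<and> g \<in> V \<and> U \<inter> V = {}" by blast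
next
  show "open (UNIV :: tseries set)" by (simp add: open_tseries_def)
next
  fix K :: "tseries set set"
  assume K: "\<forall>S\<in>K. open S"
  show "open (\<Union>K)"
    unfolding open_tseries_def
  proof
    fix f assume "f \<in> \<Union>K"
    then obtain S where S: "S \<in> K" "f \<in> S" by blast
    with K obtain n where "\<forall>g. agree_below n f g \<longrightarrow> g \<in> S" unfolding open_tseries_def by blast
    then show "\<exists>n. \<forall>g. agree_below n f g \<longrightarrow> g \<in> \<Union>K" using S(1) by blast
  qed
qed

end

lemma tendsto_tseries_iff:
  "(F \<longlongrightarrow> f) net \<longleftrightarrow> (\<forall>n. eventually (\<lambda>x. agree_below n f (F x)) net)"
proof
  assume F: "(F \<longlongrightarrow> f) net"
  show "\<forall>n. eventually (\<lambda>x. agree_below n f (F x)) net"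
  proof
    fix n
    have "open {g. agree_below n f g}" by (auto simp: open_tseries_def agree_below_def)
    from topological_tendstoD[OF F this] show "eventually (\<lambda>x. agree_below n f (F x)) net"
      by (simp add: agree_below_def)
  qed
next
  assume ev: "\<forall>n. eventually (\<lambda>x. agree_below n f (F x)) net"
  show "(F \<longlongrightarrow> f) net"
  proof (rule topological_tendstoI)
    fix S assume "open S" "f \<in> S"
    then obtain n where n: "\<forall>g. agree_below n f g \<longrightarrow> g \<in> S" by (auto simp: open_tseries_def)
    from ev have "eventually (\<lambda>x. agree_below n f (F x)) net" ..
    then show "eventually (\<lambda>x. F x \<in> S) net" by eventually_elim (simp add: n)
  qed
qed

definition tconst :: "complex \<Rightarrow> tseries" where
  "tconst c = Abs_tseries (\<lambda>m. if m = 0 then c else 0)"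

text \<open>\<open>tvar k\<close> is \<open>t\<^sub>k\<close> and \<open>tderiv k\<close> is \<open>\<partial>/\<partial>t\<^sub>k\<close>; both are only used for odd \<open>k\<close>.\<close>

definition tvar :: "nat \<Rightarrow> tseries" where
  "tvar k = Abs_tseries (\<lambda>m. if m = Poly_Mapping.single (k div 2) 1 then 1 else 0)"

definition tderiv :: "nat \<Rightarrow> tseries \<Rightarrow> tseries" where
  "tderiv k f = Abs_tseries (\<lambda>m.
     of_nat (Poly_Mapping.lookup m (k div 2) + 1) * coeff f (m + Poly_Mapping.single (k div 2) 1))"


section \<open>Pfaffians\<close>

text \<open>
  The Pfaffian of the skew-symmetric \<open>2n \<times> 2n\<close> matrix with entries \<open>A i j\<close>, \<open>i, j < 2n\<close>.
  The permutations below are the perfect matchings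
  \<open>{p 0, p 1}, {p 2, p 3}, \<dots>, {p (2n-2), p (2n-1)}\<close>, each listed once.
\<close>

definition pfaffian :: "nat \<Rightarrow> (nat \<Rightarrow> nat \<Rightarrow> 'a) \<Rightarrow> 'a :: comm_ring_1" where
  "pfaffian n A =
    (\<Sum>p | p permutes {..<2 * n} \<and> (\<forall>i<n. p (2 * i) < p (2 * i + 1)) \<and>
          (\<forall>i j. i < j \<and> j < n \<longrightarrow> p (2 * i) < p (2 * j)).
       of_int (sign p) * (\<Prod>i<n. A (p (2 * i)) (p (2 * i + 1))))"


section \<open>Schur \<open>Q\<close>-functions\<close>

definition q_poly :: "nat \<Rightarrow> tseries" where
  "q_poly i = (Abs_fps (\<lambda>n. tconst (1 / fact n)) oo
          Abs_fps (\<lambda>k. if odd k then tvar k else 0)) $ i"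

definition Q_gt :: "nat \<Rightarrow> nat \<Rightarrow> tseries" where
  "Q_gt a b =
    (if b = 0 then tconst (1 / complex_of_real (sqrt 2)) * q_poly a
     else tconst (1 / 2) * q_poly a * q_poly b + (\<Sum>k = 1..b. (-1) ^ k * q_poly (a + k) * q_poly (b - k)))"

definition Q2 :: "nat \<Rightarrow> nat \<Rightarrow> tseries" where
  "Q2 a b = (if a > b then Q_gt a b else if a < b then - Q_gt b a else 0)"

definition DP :: "nat list set" where
  "DP = {\<nu>. sorted_wrt (>) \<nu> \<and> 0 \<notin> set \<nu>}"

definition augment :: "nat list \<Rightarrow> nat list" where
  "augment \<nu> = (if odd (length \<nu>) then \<nu> @ [0] else \<nu>)"

definition pf_at :: "(nat \<Rightarrow> nat \<Rightarrow> 'a) \<Rightarrow> nat list \<Rightarrow> 'a :: comm_ring_1" where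
  "pf_at A \<nu> = (let \<mu> = augment \<nu> in pfaffian (length \<mu> div 2) (\<lambda>i j. A (\<mu> ! i) (\<mu> ! j)))"

definition schur_Q :: "nat list \<Rightarrow> tseries" where
  "schur_Q \<nu> = pf_at Q2 \<nu>"


section \<open>The infinite Pfaffian\<close>

definition skew :: "(nat \<Rightarrow> nat \<Rightarrow> complex) \<Rightarrow> bool" where
  "skew r \<longleftrightarrow> (\<forall>i j. r i j = - r j i)"

text \<open>The entry of the matrix \<open>Q\<close> in the row labelled \<open>a\<close> and the column labelled \<open>b\<close>.\<close>

definition Q_entry :: "nat \<Rightarrow> nat \<Rightarrow> tseries" where
  "Q_entry a b = (if a > b then - Q2 a b else if a < b then Q2 b a else 0)"

definition anti_diag :: "nat \<Rightarrow> nat \<Rightarrow> nat \<Rightarrow> tseries" where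
  "anti_diag n i j = (if i + j = n then 1 else 0)"

text \<open>
  The \<open>(2n+2) \<times> (2n+2)\<close> truncation, its rows and columns numbered \<open>0, \<dots>, 2n+1\<close>: the number
  \<open>i \<le> n\<close> carries the label \<open>n - i\<close> of \<open>Q\<close>, and the number \<open>n + 1 + i\<close> the label \<open>i\<close> of \<open>R\<close>.
\<close>

definition block_matrix :: "(nat \<Rightarrow> nat \<Rightarrow> complex) \<Rightarrow> nat \<Rightarrow> nat \<Rightarrow> nat \<Rightarrow> tseries" where
  "block_matrix r n i j =
    (if i \<le> n then
       (if j \<le> n then Q_entry (n - i) (n - j) else anti_diag n i (j - (n + 1)))
     else
       (if j \<le> n then - anti_diag n j (i - (n + 1)) else tconst (r (i - (n + 1)) (j - (n + 1)))))"

definition truncated_pf :: "(nat \<Rightarrow> nat \<Rightarrow> complex) \<Rightarrow> nat \<Rightarrow> tseries" where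
  "truncated_pf r n = pfaffian (n + 1) (block_matrix r n)"

definition infinite_pf :: "(nat \<Rightarrow> nat \<Rightarrow> complex) \<Rightarrow> tseries" where
  "infinite_pf r = lim (truncated_pf r)"


section \<open>The big Schubert cell\<close>

text \<open>\<open>Neg k\<close> is \<open>-k\<close> and \<open>Pos k\<close> is \<open>+k\<close>, with \<open>Neg 0 \<noteq> Pos 0\<close>. The index set \<open>A = (\<dots>, -2, -1, -0, +0, 1, 2, \<dots>)\<close>, in this order.\<close>

datatype Aindex = Neg nat | Pos nat

instantiation Aindex :: linorder
begin

fun less_eq_Aindex :: "Aindex \<Rightarrow> Aindex \<Rightarrow> bool" where
  "Neg a \<le> Neg b \<longleftrightarrow> b \<le> a"
| "Neg a \<le> Pos b \<longleftrightarrow> True"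
| "Pos a \<le> Neg b \<longleftrightarrow> False"
| "Pos a \<le> Pos b \<longleftrightarrow> a \<le> b"

definition less_Aindex :: "Aindex \<Rightarrow> Aindex \<Rightarrow> bool" where
  "\<alpha> < \<beta> \<longleftrightarrow> \<alpha> \<le> \<beta> \<and> \<not> \<beta> \<le> (\<alpha> :: Aindex)"

instance
proof
  fix \<alpha> \<beta> \<gamma> :: Aindex
  show "\<alpha> < \<beta> \<longleftrightarrow> \<alpha> \<le> \<beta> \<and> \<not> \<beta> \<le> \<alpha>" by (rule less_Aindex_def)
  show "\<alpha> \<le> \<alpha>" by (cases \<alpha>) auto
  show "\<alpha> \<le> \<beta> \<Longrightarrow> \<beta> \<le> \<gamma> \<Longrightarrow> \<alpha> \<le> \<gamma>" by (cases \<alpha>; cases \<beta>; cases \<gamma>) auto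
  show "\<alpha> \<le> \<beta> \<Longrightarrow> \<beta> \<le> \<alpha> \<Longrightarrow> \<alpha> = \<beta>" by (cases \<alpha>; cases \<beta>) auto
  show "\<alpha> \<le> \<beta> \<or> \<beta> \<le> \<alpha>" by (cases \<alpha>; cases \<beta>) auto
qed

end

type_synonym vec = "Aindex \<Rightarrow> complex"

definition Vhat :: "vec set" where
  "Vhat = {x. \<exists>\<alpha>. \<forall>\<beta><\<alpha>. x \<beta> = 0}"

definition basis_vec :: "Aindex \<Rightarrow> vec" where
  "basis_vec \<alpha> = (\<lambda>\<beta>. if \<beta> = \<alpha> then 1 else 0)"

text \<open>
  \<open>Sum_any\<close> adds up the nonzero terms. There are only finitely many of them for \<open>x \<in> Vhat\<close>
  and, in \<open>mat_act\<close>, lower triangular \<open>N\<close>.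
\<close>

definition quad_form :: "vec \<Rightarrow> complex" where
  "quad_form x = Sum_any (\<lambda>k :: nat. (-1) ^ k * x (Pos k) * x (Neg k))"

definition mat_act :: "(Aindex \<Rightarrow> Aindex \<Rightarrow> complex) \<Rightarrow> vec \<Rightarrow> vec" where
  "mat_act N x = (\<lambda>\<alpha>. Sum_any (\<lambda>\<beta>. N \<alpha> \<beta> * x \<beta>))"

definition lower_unitriangular :: "(Aindex \<Rightarrow> Aindex \<Rightarrow> complex) \<Rightarrow> bool" where
  "lower_unitriangular N \<longleftrightarrow> (\<forall>\<alpha>. N \<alpha> \<alpha> = 1) \<and> (\<forall>\<alpha> \<beta>. \<alpha> < \<beta> \<longrightarrow> N \<alpha> \<beta> = 0)"

definition N_minus :: "(Aindex \<Rightarrow> Aindex \<Rightarrow> complex) set" where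
  "N_minus = {N. lower_unitriangular N \<and>
     (\<forall>x\<in>Vhat. quad_form (mat_act N x) = quad_form x) \<and>
     (let v = (\<lambda>\<alpha>. basis_vec (Neg 0) \<alpha> - basis_vec (Pos 0) \<alpha>) in mat_act N v = v)}"

definition span_nonpos :: "vec set" where
  "span_nonpos = {\<lambda>\<alpha>. \<Sum>k<n. c k * basis_vec (Neg k) \<alpha> | (c :: nat \<Rightarrow> complex) n. True}"

definition big_cell :: "vec set set" where
  "big_cell = {mat_act N ` span_nonpos | N. N \<in> N_minus}"


section \<open>Neutral fermions and \<open>\<tau>\<close>-functions\<close>

text \<open>
  Write \<open>w = z\<^sup>-\<^sup>1\<close>. The operator \<open>-2 \<Sum>\<^sub>k w^k/k \<partial>/\<partial>t\<^sub>k\<close> (sum over odd \<open>k\<close>) acts on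
  \<open>\<complex>[[t\<^sub>1, t\<^sub>3, \<dots>]][[w]]\<close> and raises the order in \<open>w\<close>. Hence only its powers up to the \<open>j\<close>-th
  contribute to the coefficient \<open>exp_deriv j\<close> of \<open>w^j\<close> in its exponential.
\<close>

definition deriv_op :: "tseries fps \<Rightarrow> tseries fps" where
  "deriv_op F = Abs_fps (\<lambda>j. \<Sum>k | k \<le> j \<and> odd k. tconst (-2 / of_nat k) * tderiv k (F $ (j - k)))"

definition exp_deriv :: "nat \<Rightarrow> tseries \<Rightarrow> tseries" where
  "exp_deriv j f = (\<Sum>n\<le>j. tconst (1 / fact n) * ((deriv_op ^^ n) (fps_const f) $ j))"

text \<open>
  \<open>fermion \<alpha>\<close> is the operator \<open>X\<^sub>\<alpha>\<close> and \<open>fermion_vec x\<close> is \<open>X(x)\<close>. The infinite sums converge in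
  the topology of the grading (for \<open>x \<in> Vhat\<close>), since \<open>q_poly i\<close> is homogeneous of degree \<open>i\<close> and
  \<open>fermion \<alpha> f\<close> has no terms of degree less than \<open>\<alpha>\<close>.
\<close>

definition fermion :: "int \<Rightarrow> tseries \<Rightarrow> tseries" where
  "fermion \<alpha> f = tconst (1 / complex_of_real (sqrt 2)) *
     (\<Sum>\<^sub>\<infinity>j\<in>{j. \<alpha> + int j \<ge> 0}. q_poly (nat (\<alpha> + int j)) * exp_deriv j f)"

text \<open>\<open>index_of\<close> is only applied to nonzero integers.\<close>

definition index_of :: "int \<Rightarrow> Aindex" where
  "index_of \<alpha> = (if \<alpha> > 0 then Pos (nat \<alpha>) else Neg (nat (- \<alpha>)))"

definition fermion_vec :: "vec \<Rightarrow> tseries \<Rightarrow> tseries" where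
  "fermion_vec x f = tconst (complex_of_real (sqrt 2) * x (Neg 0)) * fermion 0 f +
     (\<Sum>\<^sub>\<infinity>\<alpha>\<in>- {0}. tconst (x (index_of \<alpha>)) * fermion \<alpha> f)"

text \<open>The \<open>\<tau>\<close>-function of \<open>U\<close> is only determined up to a nonzero constant factor.\<close>

definition is_tau :: "vec set \<Rightarrow> tseries \<Rightarrow> bool" where
  "is_tau U \<tau> \<longleftrightarrow> \<tau> \<noteq> 0 \<and> (\<forall>x\<in>U. x (Neg 0) = x (Pos 0) \<longrightarrow> fermion_vec x \<tau> = 0)"

definition BKP_big_cell :: "tseries set" where
  "BKP_big_cell = {\<tau>. \<exists>U\<in>big_cell. is_tau U \<tau>}"

end

theory Submission
  imports Defs
begin

text \<open>
  Write \<open>X\<^sub>a\<close> for the fermion modes. They satisfy \<open>X\<^sub>a X\<^sub>b + X\<^sub>b X\<^sub>a = (-1)\<^sup>a \<delta>\<^bsub>a+b,0\<^esub>\<close>,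
  and \<open>X\<^sub>-\<^sub>k\<close> kills the constant \<open>1\<close> for \<open>k > 0\<close>. Since \<open>X\<^sub>a\<close> is a combination of the \<open>X\<^sub>-\<^sub>k\<close>, \<open>k \<ge> 0\<close>,
  with the coefficients \<open>\<Sum>\<^sub>i (-1)\<^sup>i q\<^bsub>a+k-i\<^esub> q\<^sub>i\<close>, induction over strict partitions gives
  \<open>Q\<^sub>\<lambda> = X\<^bsub>\<lambda>\<^sub>1\<^esub> \<dots> X\<^bsub>\<lambda>\<^sub>m\<^esub> 1\<close>: both sides obey the row expansion of an augmented Pfaffian. So every
  \<open>X\<^sub>a\<close> acts on the \<open>Q\<^sub>\<lambda>\<close> by adding, removing or counting parts.

  The block Pfaffian expands into \<open>\<Sum>\<^sub>\<lambda> Pf(R\<^sub>\<lambda>) Q\<^sub>\<lambda>\<close> because the symmetric pairs picked from the anti-diagonal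
  cross the other pairs an even number of times. The row expansion of \<open>Pf(R\<^sub>\<lambda>)\<close> then says that this series is
  killed by \<open>X\<^sub>-\<^sub>k + \<surd>2 c\<^bsub>k,0\<^esub> X\<^sub>0 + \<Sum>\<^sub>j c\<^bsub>k,j\<^esub> X\<^sub>j\<close> with \<open>c\<^bsub>k,0\<^esub> = -(-1)\<^sup>k r\<^bsub>k,0\<^esub>\<close> and
  \<open>c\<^bsub>k,j\<^esub> = -(-1)\<^sup>k (r\<^bsub>k,j\<^esub> + r\<^bsub>k,0\<^esub> r\<^bsub>j,0\<^esub>)\<close>. The corresponding vectors form a reduced basis of
  \<open>{x \<in> U. x\<^sub>-\<^sub>0 = x\<^sub>+\<^sub>0}\<close> for a subspace \<open>U\<close> of the big cell. Skewness of \<open>R\<close> is equivalent to isotropy of \<open>U\<close>, so every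
  \<open>U\<close> arises, and a series killed by these operators is determined by its constant term: the part of lowest
  weight of a difference of two solutions is killed by all \<open>X\<^sub>-\<^sub>k\<close>, \<open>k > 0\<close>.
\<close>

text \<open>Augmentation is the obstacle: for odd length the Pfaffian has an extra index 0, so a row
  expansion looks different for the two parities, while a fermion mode must act by one formula. The
  rank one term \<open>A k 0 * A j 0\<close>, together with a corner term carrying
  \<open>(-1) ^ card T\<close>, gives an expansion valid for both parities
  (\<open>aug_pf_row\<close>). This identity is used twice: with the matrix of the
  \<open>Q_{a,b}\<close>, where the rank one term is half of \<open>q_a q_b\<close> and accounts for
  the factor 1/sqrt 2 in \<open>Q_{a,0}\<close>, and with R, where it is the quadratic term in the
  \<open>c_{k,j}\<close>. On the geometric side the same term is the contribution
  \<open>x_{+0} x_{-0}\<close> to the quadratic form. A second obstacle is that products of fermion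
  modes are double infinite sums. The Clifford relation is therefore proved on homogeneous series,
  where all sums are finite, and a series is replaced by a polynomial when one of its coefficients
  is followed. The exponential of derivations is characterized by the recursion that its logarithmic
  derivative gives.\<close>

section \<open>Pfaffians of submatrices\<close>

text \<open>With T listed decreasingly, this is the sign of moving k to the front, past the larger
  elements of T. It makes sense for k inside or outside T.\<close>

definition rank_sign :: "nat \<Rightarrow> nat set \<Rightarrow> 'a :: comm_ring_1" where
  "rank_sign k T = (-1) ^ card {i \<in> T. k < i}"

lemma rank_sign_empty [simp]: "rank_sign k {} = 1"
  by (simp add: rank_sign_def)

lemma rank_sign_square [simp]: "rank_sign k T * rank_sign k T = 1"
  by (simp add: rank_sign_def flip: power_add mult_2)

lemma rank_sign_square_left [simp]: "rank_sign k T * (rank_sign k T * x) = x"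
  by (simp flip: mult.assoc)

lemma rank_sign_insert:
  assumes "finite T" "m \<notin> T"
  shows "rank_sign k (insert m T) = (if k < m then - rank_sign k T else rank_sign k T)"
proof -
  have "{i \<in> insert m T. k < i} = (if k < m then insert m {i \<in> T. k < i} else {i \<in> T. k < i})"
    by auto
  then show ?thesis using assms by (simp add: rank_sign_def)
qed

lemma rank_sign_remove:
  fixes T :: "nat set"
  assumes "finite T" "m \<in> T"
  shows "rank_sign k (T - {m}) = (if k < m then - rank_sign k T else (rank_sign k T :: 'a :: comm_ring_1))"
proof -
  have "rank_sign k T = (rank_sign k (insert m (T - {m})) :: 'a)" using assms by (simp add: insert_absorb)
  also have "\<dots> = (if k < m then - rank_sign k (T - {m}) else rank_sign k (T - {m}))"
    by (rule rank_sign_insert) (use assms in auto)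
  finally show ?thesis by (simp split: if_splits)
qed

lemma rank_sign_remove_self [simp]: "rank_sign k (T - {k}) = rank_sign k T"
proof -
  have "{i \<in> T - {k}. k < i} = {i \<in> T. k < i}" by auto
  then show ?thesis by (simp add: rank_sign_def)
qed

lemma rank_sign_insert_self [simp]: "rank_sign k (insert k T) = rank_sign k T"
proof -
  have "{i \<in> insert k T. k < i} = {i \<in> T. k < i}" by auto
  then show ?thesis by (simp add: rank_sign_def)
qed

lemma rank_sign_Un:
  assumes "finite S" "finite T" "S \<inter> T = {}"
  shows "rank_sign k (S \<union> T) = rank_sign k S * rank_sign k T"
proof -
  have "{i \<in> S \<union> T. k < i} = {i \<in> S. k < i} \<union> {i \<in> T. k < i}" by auto
  moreover have "card ({i \<in> S. k < i} \<union> {i \<in> T. k < i}) = card {i \<in> S. k < i} + card {i \<in> T. k < i}"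
    by (rule card_Un_disjoint) (use assms in auto)
  ultimately show ?thesis by (simp add: rank_sign_def power_add)
qed

lemma rank_sign_above: "(\<And>i. i \<in> T \<Longrightarrow> i \<le> k) \<Longrightarrow> rank_sign k T = 1"
proof -
  assume "\<And>i. i \<in> T \<Longrightarrow> i \<le> k"
  then have "{i \<in> T. k < i} = {}" by force
  then show ?thesis unfolding rank_sign_def by (metis card.empty power_0)
qed

lemma rank_sign_below: "(\<And>i. i \<in> T \<Longrightarrow> k < i) \<Longrightarrow> rank_sign k T = (-1) ^ card T"
proof -
  assume "\<And>i. i \<in> T \<Longrightarrow> k < i"
  then have "{i \<in> T. k < i} = T" by force
  then show ?thesis unfolding rank_sign_def by metis
qed

text \<open>Deleting the larger of the two indices changes the rank of the smaller one by one, and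
  not conversely, so the two orders of deletion differ by exactly one sign.\<close>

lemma rank_sign_swap:
  assumes "finite T" "j \<in> T" "l \<in> T" "j \<noteq> l"
  shows "rank_sign l T * rank_sign j (T - {l}) = - (rank_sign j T * rank_sign l (T - {j}))"
  using assms by (cases "j < l") (auto simp: rank_sign_remove)

lemma sum_remove_two_swap:
  fixes g :: "nat \<Rightarrow> nat \<Rightarrow> 'a :: comm_ring_1"
  assumes T: "finite T"
  shows "(\<Sum>j\<in>T. \<Sum>l\<in>T - {j}. rank_sign j T * rank_sign l (T - {j}) * g j l) =
    - (\<Sum>l\<in>T. \<Sum>j\<in>T - {l}. rank_sign l T * rank_sign j (T - {l}) * g j l)"
proof -
  have "(\<Sum>j\<in>T. \<Sum>l\<in>T - {j}. rank_sign j T * rank_sign l (T - {j}) * g j l) =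
    (\<Sum>(j, l)\<in>Sigma T (\<lambda>j. T - {j}). rank_sign j T * rank_sign l (T - {j}) * g j l)"
    using T by (subst sum.Sigma) auto
  also have "\<dots> = (\<Sum>(l, j)\<in>Sigma T (\<lambda>l. T - {l}). - (rank_sign l T * rank_sign j (T - {l}) * g j l))"
  proof (rule sum.reindex_bij_witness[where i = "\<lambda>(a, b). (b, a)" and j = "\<lambda>(a, b). (b, a)"])
    fix x assume "x \<in> Sigma T (\<lambda>j. T - {j})"
    then obtain j l where [simp]: "x = (j, l)" and jl: "j \<in> T" "l \<in> T" "j \<noteq> l" by auto
    show "(case case x of (a, b) \<Rightarrow> (b, a) of (l, j) \<Rightarrow> - (rank_sign l T * rank_sign j (T - {l}) * g j l)) =
        (case x of (j, l) \<Rightarrow> rank_sign j T * rank_sign l (T - {j}) * g j l)"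
      using rank_sign_swap[OF T jl, where 'a = 'a] by simp
  qed auto
  also have "\<dots> = (\<Sum>l\<in>T. \<Sum>j\<in>T - {l}. - (rank_sign l T * rank_sign j (T - {l}) * g j l))"
    using T by (subst sum.Sigma) auto
  finally show ?thesis by (simp add: sum_negf)
qed

text \<open>By antisymmetry of the signs the terms for (j, l) and (l, j) cancel; this is the
  vanishing of an expansion with two equal rows.\<close>

lemma sum_remove_two_symmetric:
  fixes g :: "nat \<Rightarrow> nat \<Rightarrow> 'a :: comm_ring_1"
  assumes T: "finite T" and g: "\<And>j l. g j l = g l j"
  shows "(\<Sum>j\<in>T. \<Sum>l\<in>T - {j}. rank_sign j T * rank_sign l (T - {j}) * g j l) = 0"
proof -
  let ?h = "\<lambda>(j, l). rank_sign j T * rank_sign l (T - {j}) * g j l"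
  have "(\<Sum>j\<in>T. \<Sum>l\<in>T - {j}. rank_sign j T * rank_sign l (T - {j}) * g j l) =
    sum ?h (Sigma T (\<lambda>j. T - {j}))"
    using T by (subst sum.Sigma) auto
  also have "Sigma T (\<lambda>j. T - {j}) = {(j, l) \<in> T \<times> T. j < l} \<union> {(j, l) \<in> T \<times> T. l < j}"
    by auto
  also have "sum ?h \<dots> = sum ?h {(j, l) \<in> T \<times> T. j < l} + sum ?h {(j, l) \<in> T \<times> T. l < j}"
    by (rule sum.union_disjoint)
       (use T in \<open>auto intro: finite_subset[of _ "T \<times> T"]\<close>)
  also have "sum ?h {(j, l) \<in> T \<times> T. l < j} = (\<Sum>x\<in>{(j, l) \<in> T \<times> T. j < l}. - ?h x)"
  proof (rule sum.reindex_bij_witness[where i = "\<lambda>(a, b). (b, a)" and j = "\<lambda>(a, b). (b, a)"])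
    fix x assume "x \<in> {(j, l) \<in> T \<times> T. l < j}"
    then obtain j l where [simp]: "x = (j, l)" and jl: "j \<in> T" "l \<in> T" "l < j" by auto
    show "- ?h (case x of (a, b) \<Rightarrow> (b, a)) = ?h x"
      using rank_sign_swap[OF T, of j l, where 'a = 'a] jl by (simp add: g[of l j])
  qed auto
  finally show ?thesis by (simp add: sum_negf)
qed

text \<open>
  The Pfaffian of the submatrix with the finite index set \<open>S\<close>, its rows listed in decreasing order of the
  index, as in a partition.
\<close>

function subset_pf :: "(nat \<Rightarrow> nat \<Rightarrow> 'a :: comm_ring_1) \<Rightarrow> nat set \<Rightarrow> 'a" where
  "subset_pf A S = (if finite S \<and> S \<noteq> {} then
     (\<Sum>j\<in>S - {Max S}. rank_sign j (S - {Max S}) * A (Max S) j * subset_pf A (S - {Max S} - {j}))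
   else 1)"
  by auto
termination
  proof (relation "measure (\<lambda>(A, S). card S)")
  fix S :: "nat set" and j A assume "finite S \<and> S \<noteq> {}" "j \<in> S - {Max S}"
  then have "S - {Max S} - {j} \<subset> S" by auto
  then show "((A, S - {Max S} - {j}), A, S) \<in> measure (\<lambda>(A :: nat \<Rightarrow> nat \<Rightarrow> 'a, S). card S)"
    using \<open>finite S \<and> S \<noteq> {}\<close> by (simp add: psubset_card_mono)
qed simp

declare subset_pf.simps [simp del]

lemma subset_pf_empty [simp]: "subset_pf A {} = 1"
  by (subst subset_pf.simps) simp

lemma subset_pf_insert_max:
  assumes "finite T" "\<And>i. i \<in> T \<Longrightarrow> i < m"
  shows "subset_pf A (insert m T) = (\<Sum>j\<in>T. rank_sign j T * A m j * subset_pf A (T - {j}))"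
proof -
  have "Max (insert m T) = m" "insert m T - {m} = T"
    using assms by (auto intro!: Max_eqI dest: less_imp_le)
  then show ?thesis using assms by (subst subset_pf.simps) simp
qed

text \<open>The recursion of \<open>subset_pf\<close> deletes the largest index and one arbitrary
  further index, so the hypothesis has to cover more than T itself: every finite set with at most
  \<open>card T\<close> elements.\<close>

lemma finite_max_induct [consumes 1, case_names empty insert]:
  fixes S :: "nat set"
  assumes "finite S" and "P {}"
    and "\<And>m T. finite T \<Longrightarrow> (\<And>i. i \<in> T \<Longrightarrow> i < m) \<Longrightarrow>
      (\<And>T'. finite T' \<Longrightarrow> card T' \<le> card T \<Longrightarrow> P T') \<Longrightarrow> P (insert m T)"
  shows "P S"
  using assms(1)
proof (induction "card S" arbitrary: S rule: less_induct)
  case less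
  show ?case
  proof (cases "S = {}")
    case False
    define T where "T = S - {Max S}"
    have S: "S = insert (Max S) T" using Max_in[OF less.prems False] by (auto simp: T_def)
    have T: "finite T" "\<And>i. i \<in> T \<Longrightarrow> i < Max S"
      using less.prems by (auto simp: T_def less_le)
    then have "card S = Suc (card T)" by (subst S) (auto simp: card_insert_if)
    then show ?thesis by (subst S) (rule assms(3), use T less in auto)
  qed (simp add: assms(2))
qed

text \<open>Each recursion step removes two indices, so an odd set ends in a singleton, whose
  expansion is an empty sum.\<close>

lemma subset_pf_odd:
  assumes "finite S" "odd (card S)"
  shows "subset_pf A S = 0"
  using assms
proof (induction rule: finite_max_induct)
  case (insert m T)
  have "m \<notin> T" using insert(2) by auto
  then have "even (card T)" using insert by (simp add: card_insert_if)
  have "subset_pf A (T - {j}) = 0" if "j \<in> T" for j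
  proof (rule insert(3))
    show "odd (card (T - {j}))" "card (T - {j}) \<le> card T"
      using that \<open>even (card T)\<close> insert(1) by (auto simp: card_gt_0_iff)
  qed (use insert in auto)
  then show ?case using insert by (simp add: subset_pf_insert_max)
qed simp

lemma subset_pf_cong:
  assumes "finite S" "\<And>i j. i \<in> S \<Longrightarrow> j \<in> S \<Longrightarrow> j < i \<Longrightarrow> A i j = B i j"
  shows "subset_pf A S = subset_pf B S"
  using assms
proof (induction rule: finite_max_induct)
  case (insert m T)
  have "subset_pf A (T - {j}) = subset_pf B (T - {j})" if "j \<in> T" for j
    by (rule insert(3)) (use insert in \<open>auto intro!: card_mono\<close>)
  then show ?case using insert by (auto simp: subset_pf_insert_max intro!: sum.cong)
qed simp

lemma strict_mono_on_rank_sign: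
  assumes "strict_mono_on S f" "T \<subseteq> S" "k \<in> S"
  shows "rank_sign (f k) (f ` T) = rank_sign k T"
proof -
  have less: "f k < f i \<longleftrightarrow> k < i" if "i \<in> T" for i
    using strict_mono_on_less[OF assms(1)] assms that by blast
  have "{i \<in> f ` T. f k < i} = f ` {i \<in> T. k < i}" using less by auto
  moreover have "card (f ` {i \<in> T. k < i}) = card {i \<in> T. k < i}"
    by (rule card_image, rule inj_on_subset[OF strict_mono_on_imp_inj_on[OF assms(1)]]) (use assms in auto)
  ultimately show ?thesis by (simp add: rank_sign_def)
qed

lemma subset_pf_image:
  assumes "finite S" "strict_mono_on S f"
  shows "subset_pf A (f ` S) = subset_pf (\<lambda>i j. A (f i) (f j)) S"
  using assms
proof (induction rule: finite_max_induct)
  case (insert m T)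
  have mono: "strict_mono_on U f" if "U \<subseteq> insert m T" for U
    using insert.prems that by (rule monotone_on_subset)
  have inj: "inj_on f T" using strict_mono_on_imp_inj_on[OF mono[of T]] by auto
  have IH: "subset_pf A (f ` T - {f j}) = subset_pf (\<lambda>i j. A (f i) (f j)) (T - {j})" if "j \<in> T" for j
  proof -
    have "f ` T - {f j} = f ` (T - {j})" using inj that by (auto dest: inj_onD)
    moreover have "subset_pf A (f ` (T - {j})) = subset_pf (\<lambda>i j. A (f i) (f j)) (T - {j})"
      by (rule insert(3)) (use insert in \<open>auto intro!: card_mono mono\<close>)
    ultimately show ?thesis by simp
  qed
  have "subset_pf A (f ` insert m T) =
      (\<Sum>j\<in>f ` T. rank_sign j (f ` T) * A (f m) j * subset_pf A (f ` T - {j}))"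
    unfolding image_insert
    by (rule subset_pf_insert_max) (use insert in \<open>auto simp: strict_mono_on_def\<close>)
  also have "\<dots> = (\<Sum>j\<in>T. rank_sign j T * A (f m) (f j) * subset_pf (\<lambda>i j. A (f i) (f j)) (T - {j}))"
    using inj by (simp add: sum.reindex IH strict_mono_on_rank_sign[OF mono[of T]] subset_insertI)
  also have "\<dots> = subset_pf (\<lambda>i j. A (f i) (f j)) (insert m T)"
    using insert by (simp add: subset_pf_insert_max)
  finally show ?case .
qed simp

lemma subset_pf_uminus:
  assumes "finite S"
  shows "subset_pf (\<lambda>i j. - A i j) S = (-1) ^ (card S div 2) * subset_pf A S"
  using assms
proof (induction rule: finite_max_induct)
  case (insert m T)
  have mT: "m \<notin> T" using insert(2) by auto
  have "subset_pf (\<lambda>i j. - A i j) (T - {j}) = (-1) ^ (card (T - {j}) div 2) * subset_pf A (T - {j})"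
    if "j \<in> T" for j
    by (rule insert(3)) (use insert in \<open>auto intro!: card_mono\<close>)
  moreover have "card (insert m T) div 2 = Suc (card (T - {j}) div 2)" if "j \<in> T" for j
    using that insert(1) mT card_gt_0_iff[of T] by (auto simp: card_insert_if)
  ultimately show ?case using insert
    by (simp add: subset_pf_insert_max sum_distrib_left algebra_simps cong: sum.cong)
qed simp

text \<open>The recursion only expands along the largest row, whereas here k is any row; for k in T
  the left side has a repeated row. Expanding once more along the largest row m and exchanging the
  two deleted indices leads back to row k over sets without m.\<close>

lemma subset_pf_row:
  fixes A :: "nat \<Rightarrow> nat \<Rightarrow> 'a :: comm_ring_1"
  assumes skew: "\<And>i j. A i j = - A j i" and diag: "\<And>i. A i i = 0" and "finite T"
  shows "(\<Sum>j\<in>T. rank_sign j T * A k j * subset_pf A (T - {j})) =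
    (if k \<in> T then 0 else rank_sign k T * subset_pf A (insert k T))"
  using \<open>finite T\<close>
proof (induction rule: finite_max_induct)
  case empty
  show ?case by (simp add: subset_pf_insert_max[of "{}", simplified])
next
  case (insert m T)
  let ?P = "subset_pf A" and ?R = "\<lambda>k T. \<Sum>j\<in>T. rank_sign j T * A k j * subset_pf A (T - {j})"
  have mT: "m \<notin> T" using insert(2) by auto
  have IH: "?R k (T - {l}) = (if k \<in> T - {l} then 0 else rank_sign k (T - {l}) * ?P (insert k (T - {l})))"
    if "l \<in> T" for l
    using insert(3)[of "T - {l}"] insert(1) that by (simp add: card_mono)
  have expand: "?P (insert m (T - {j})) =
      (\<Sum>l\<in>T - {j}. rank_sign l (T - {j}) * A m l * ?P (T - {j} - {l}))" for j
    by (rule subset_pf_insert_max) (use insert in auto)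
  have "?R k (insert m T) = A k m * ?P T + (\<Sum>j\<in>T. rank_sign j (insert m T) * A k j * ?P (insert m T - {j}))"
    using insert(1,2) mT by (simp add: rank_sign_above less_imp_le)
  also have "(\<Sum>j\<in>T. rank_sign j (insert m T) * A k j * ?P (insert m T - {j})) =
      - (\<Sum>j\<in>T. rank_sign j T * A k j * ?P (insert m (T - {j})))"
    unfolding sum_negf[symmetric]
    by (rule sum.cong) (use insert mT in \<open>auto simp: rank_sign_insert insert_Diff_if\<close>)
  also have "(\<Sum>j\<in>T. rank_sign j T * A k j * ?P (insert m (T - {j}))) =
      (\<Sum>j\<in>T. \<Sum>l\<in>T - {j}. rank_sign j T * rank_sign l (T - {j}) * (A k j * A m l * ?P (T - {j} - {l})))"
    by (simp add: expand sum_distrib_left algebra_simps)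
  finally have LHS: "?R k (insert m T) = A k m * ?P T -
      (\<Sum>j\<in>T. \<Sum>l\<in>T - {j}. rank_sign j T * rank_sign l (T - {j}) * (A k j * A m l * ?P (T - {j} - {l})))"
    by simp
  have comm: "T - {j} - {l} = T - {l} - {j}" for j l by auto
  have swap: "(\<Sum>j\<in>T. \<Sum>l\<in>T - {j}. rank_sign j T * rank_sign l (T - {j}) * (A k j * A m l * ?P (T - {j} - {l}))) =
      - (\<Sum>l\<in>T. rank_sign l T * A m l * ?R k (T - {l}))"
    by (subst sum_remove_two_swap[OF insert(1)], unfold sum_distrib_left,
        intro arg_cong[where f = uminus] sum.cong refl)
       (simp only: mult_ac Diff_insert2[symmetric] insert_commute)
  show ?case
  proof (cases "k = m")
    case True
    \<comment> \<open>Both expanded rows are row m, so the double sum is symmetric in j and l and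
      vanishes.\<close>
    then show ?thesis
      unfolding LHS
      by (subst sum_remove_two_symmetric[OF insert(1)]) (simp_all add: diag True mult_ac Diff_insert2[symmetric] insert_commute)
  next
    case km: False
    show ?thesis
    proof (cases "k \<in> T")
      case True
      \<comment> \<open>For l different from k the row k still occurs in \<open>T - {l}\<close>, so
        only l = k survives, and skewness cancels it against the term with
        \<open>A k m\<close>.\<close>
      have "(\<Sum>l\<in>T. rank_sign l T * A m l * ?R k (T - {l})) =
          (\<Sum>l\<in>T. if l = k then A m k * ?P T else 0)"
      proof (rule sum.cong)
        fix l assume l: "l \<in> T"
        have "rank_sign k T * A m k * (rank_sign k T * ?P T) = (rank_sign k T * rank_sign k T) * A m k * ?P T"
          by (simp only: mult_ac)
        then show "rank_sign l T * A m l * ?R k (T - {l}) = (if l = k then A m k * ?P T else 0)"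
          unfolding IH[OF l] using True by (simp add: insert_absorb)
      qed simp
      also have "\<dots> = A m k * ?P T" using True insert by simp
      finally show ?thesis unfolding LHS swap using True by (simp add: skew[of k m])
    next
      case False
      have R: "?R k (T - {l}) = rank_sign k (T - {l}) * ?P (insert k (T - {l}))" if "l \<in> T" for l
        using IH[OF that] False by simp
      show ?thesis
      proof (cases "k < m")
        case True
        \<comment> \<open>The smaller of k and l sees the other one exactly once: either k loses l
          in \<open>T - {l}\<close>, or l gains k in \<open>insert k T\<close>.\<close>
        have sgn: "rank_sign l T * rank_sign k (T - {l}) = - ((rank_sign k T :: 'a) * rank_sign l (insert k T))"
          if "l \<in> T" for l
          using that False insert(1)
          by (cases "k < l"; cases "l < k") (auto simp: rank_sign_remove rank_sign_insert)
        have "rank_sign k (insert m T) * ?P (insert k (insert m T)) =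
            - (rank_sign k T * ?P (insert m (insert k T)))"
          using True insert(1) mT by (simp add: rank_sign_insert insert_commute)
        also have "?P (insert m (insert k T)) =
            (\<Sum>j\<in>insert k T. rank_sign j (insert k T) * A m j * ?P (insert k T - {j}))"
          by (rule subset_pf_insert_max) (use insert True in auto)
        also have "\<dots> = rank_sign k T * A m k * ?P T +
            (\<Sum>l\<in>T. rank_sign l (insert k T) * A m l * ?P (insert k (T - {l})))"
          using insert(1) False by (auto simp: insert_Diff_if intro!: sum.cong)
        also have "- (rank_sign k T * \<dots>) = - (rank_sign k T * rank_sign k T) * A m k * ?P T +
            (\<Sum>l\<in>T. - (rank_sign k T * rank_sign l (insert k T)) * A m l * ?P (insert k (T - {l})))"
          by (simp only: sum_distrib_left sum_negf distrib_left minus_add_distrib mult_minus_left mult.assoc)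
        also have "- (rank_sign k T * rank_sign k T) * A m k * ?P T = A k m * ?P T"
          by (simp add: skew[of k m])
        also have "(\<Sum>l\<in>T. - (rank_sign k T * rank_sign l (insert k T)) * A m l * ?P (insert k (T - {l}))) =
            (\<Sum>l\<in>T. rank_sign l T * A m l * ?R k (T - {l}))"
        proof (rule sum.cong)
          fix l assume l: "l \<in> T"
          have "rank_sign l T * A m l * ?R k (T - {l}) =
              (rank_sign l T * rank_sign k (T - {l})) * A m l * ?P (insert k (T - {l}))"
            unfolding R[OF l] by (simp only: mult_ac)
          then show "- (rank_sign k T * rank_sign l (insert k T)) * A m l * ?P (insert k (T - {l})) =
              rank_sign l T * A m l * ?R k (T - {l})"
            unfolding sgn[OF l] by simp
        qed simp
        finally show ?thesis unfolding LHS swap using False km by simp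
      next
        case F: False
        have "rank_sign k (insert m T) = (1 :: 'a)"
          by (rule rank_sign_above) (use F insert(2) in force)
        moreover have "\<And>i. i \<in> insert m T \<Longrightarrow> i < k" using F km insert(2) by force
        ultimately show ?thesis
          using False km insert(1) by (subst subset_pf_insert_max[of "insert m T" k]) auto
      qed
    qed
  qed
qed

section \<open>Shuffle signs and the Pfaffian of a sum\<close>

definition shuffle_sign :: "nat set \<Rightarrow> nat set \<Rightarrow> 'a :: comm_ring_1" where
  "shuffle_sign X Z = (\<Prod>x\<in>X. rank_sign x Z)"

text \<open>The exponent counts the inversions when the decreasing list of X is followed by that of
  Z, so this is the sign of sorting the concatenation.\<close>

lemma shuffle_sign_eq:
  assumes "finite X" "finite Z"
  shows "shuffle_sign X Z = (-1) ^ card {(x, z) \<in> X \<times> Z. x < z}"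
proof -
  have "{(x, z) \<in> X \<times> Z. x < z} = Sigma X (\<lambda>x. {z \<in> Z. x < z})" by auto
  then have "card {(x, z) \<in> X \<times> Z. x < z} = (\<Sum>x\<in>X. card {z \<in> Z. x < z})"
    using assms by simp
  then show ?thesis by (simp add: shuffle_sign_def rank_sign_def power_sum)
qed

text \<open>For disjoint X and Z every pair (x, z) is counted by exactly one of the two exponents,
  and the number of pairs is even.\<close>

lemma shuffle_sign_commute:
  assumes "finite X" "finite Z" "X \<inter> Z = {}" "even (card X)"
  shows "shuffle_sign X Z = (shuffle_sign Z X :: 'a :: comm_ring_1)"
proof -
  let ?L = "{(x, z) \<in> X \<times> Z. x < z}" and ?G = "{(x, z) \<in> X \<times> Z. z < x}"
  have fin: "finite ?L" "finite ?G" using assms by (auto intro: finite_subset[of _ "X \<times> Z"])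
  have "card X * card Z = card (?L \<union> ?G)"
    unfolding card_cartesian_product[symmetric] by (rule arg_cong[of _ _ card]) (use assms(3) in auto)
  also have "\<dots> = card ?L + card ?G" by (rule card_Un_disjoint[OF fin]) auto
  also have "card ?G = card {(z, x) \<in> Z \<times> X. z < x}"
    by (rule bij_betw_same_card[of "\<lambda>(a, b). (b, a)"]) (auto simp: bij_betw_def inj_on_def image_def)
  finally have "even (card ?L + card {(z, x) \<in> Z \<times> X. z < x})"
    using assms(4) by (metis even_mult_iff)
  then have "(-1 :: 'a) ^ card ?L = (-1) ^ card {(z, x) \<in> Z \<times> X. z < x}"
    by (simp add: minus_one_power_iff)
  then show ?thesis using assms by (simp add: shuffle_sign_eq)
qed

lemma sum_Pow_insert:
  assumes "finite T" "m \<notin> T"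
  shows "sum f (Pow (insert m T)) = sum f (Pow T) + (\<Sum>Y\<in>Pow T. f (insert m Y))"
proof -
  have "inj_on (insert m) (Pow T)" using assms(2) by (auto simp: inj_on_def)
  moreover have "Pow T \<inter> insert m ` Pow T = {}" using assms(2) by auto
  ultimately show ?thesis
    using assms(1) by (simp add: Pow_insert sum.union_disjoint sum.reindex)
qed

lemma sum_Pow_member:
  assumes "finite T"
  shows "(\<Sum>Y\<in>Pow T. \<Sum>j\<in>Y. f j (Y - {j})) = (\<Sum>j\<in>T. \<Sum>X\<in>Pow (T - {j}). f j X)"
proof -
  have "(\<Sum>Y\<in>Pow T. \<Sum>j\<in>Y. f j (Y - {j})) = (\<Sum>(Y, j)\<in>Sigma (Pow T) (\<lambda>Y. Y). f j (Y - {j}))"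
    using assms by (subst sum.Sigma) (auto intro: finite_subset)
  also have "\<dots> = (\<Sum>(j, X)\<in>Sigma T (\<lambda>j. Pow (T - {j})). f j X)"
    by (rule sum.reindex_bij_witness[where i = "\<lambda>(j, X). (insert j X, j)" and j = "\<lambda>(Y, j). (j, Y - {j})"]) auto
  also have "\<dots> = (\<Sum>j\<in>T. \<Sum>X\<in>Pow (T - {j}). f j X)"
    using assms by (subst sum.Sigma) auto
  finally show ?thesis .
qed

text \<open>These are the terms of Pf(A + B) in which the largest index m belongs to the A-block.
  Expanding along m deletes some j; the factor of j in the shuffle sign and its rank sign in Y
  combine to its rank sign in T.\<close>

lemma subset_pf_add_half:
  fixes A B :: "nat \<Rightarrow> nat \<Rightarrow> 'a :: comm_ring_1"
  assumes T: "finite T" "\<And>i. i \<in> T \<Longrightarrow> i < m"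
  shows "(\<Sum>Y\<in>Pow T. shuffle_sign (insert m Y) (T - Y) * subset_pf A (insert m Y) * subset_pf B (T - Y)) =
    (\<Sum>j\<in>T. rank_sign j T * A m j *
      (\<Sum>X\<in>Pow (T - {j}). shuffle_sign X (T - {j} - X) * subset_pf A X * subset_pf B (T - {j} - X)))"
proof -
  have "shuffle_sign (insert m Y) (T - Y) * subset_pf A (insert m Y) * subset_pf B (T - Y) =
      (\<Sum>j\<in>Y. rank_sign j T * A m j *
        (shuffle_sign (Y - {j}) (T - {j} - (Y - {j})) * subset_pf A (Y - {j}) * subset_pf B (T - {j} - (Y - {j}))))"
    if "Y \<in> Pow T" for Y
  proof -
    have Y: "finite Y" "\<And>i. i \<in> Y \<Longrightarrow> i < m" "m \<notin> Y" using that T by (auto intro: finite_subset)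
    have "rank_sign m (T - Y) = (1 :: 'a)" by (rule rank_sign_above) (use T in force)
    then have "shuffle_sign (insert m Y) (T - Y) = (shuffle_sign Y (T - Y) :: 'a)"
      using Y by (simp add: shuffle_sign_def)
    moreover have "shuffle_sign Y (T - Y) * rank_sign j Y =
        rank_sign j T * (shuffle_sign (Y - {j}) (T - {j} - (Y - {j})) :: 'a)" if j: "j \<in> Y" for j
    proof -
      have eq: "T - {j} - (Y - {j}) = T - Y" using j by auto
      have "rank_sign j T = (rank_sign j (Y \<union> (T - Y)) :: 'a)" using \<open>Y \<in> Pow T\<close> by (simp add: Un_absorb1)
      also have "\<dots> = rank_sign j Y * rank_sign j (T - Y)"
        by (rule rank_sign_Un) (use Y T in auto)
      finally show ?thesis
        unfolding eq shuffle_sign_def by (subst prod.remove[OF Y(1) j]) (simp add: mult_ac)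
    qed
    moreover have "T - {j} - (Y - {j}) = T - Y" if "j \<in> Y" for j using that by auto
    moreover have "sh * (r * a * p) * b = r' * a * (sh' * p * b)" if "sh * r = r' * sh'"
      for sh r a p b r' sh' :: 'a
    proof -
      have "sh * (r * a * p) * b = (sh * r) * (a * p * b)" by (simp only: mult_ac)
      then show ?thesis unfolding that by (simp only: mult_ac)
    qed
    ultimately have step: "shuffle_sign Y (T - Y) * (rank_sign j Y * A m j * subset_pf A (Y - {j})) * subset_pf B (T - Y) =
        rank_sign j T * A m j * (shuffle_sign (Y - {j}) (T - {j} - (Y - {j})) * subset_pf A (Y - {j}) *
          subset_pf B (T - {j} - (Y - {j})))" if "j \<in> Y" for j
      using that by presburger
    have expand: "subset_pf A (insert m Y) = (\<Sum>j\<in>Y. rank_sign j Y * A m j * subset_pf A (Y - {j}))"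
      by (rule subset_pf_insert_max) (use Y in auto)
    show ?thesis
      unfolding expand sum_distrib_left sum_distrib_right
        \<open>shuffle_sign (insert m Y) (T - Y) = _\<close>
      by (intro sum.cong refl step)
  qed
  then have "(\<Sum>Y\<in>Pow T. shuffle_sign (insert m Y) (T - Y) * subset_pf A (insert m Y) * subset_pf B (T - Y)) =
      (\<Sum>Y\<in>Pow T. \<Sum>j\<in>Y. rank_sign j T * A m j *
        (shuffle_sign (Y - {j}) (T - {j} - (Y - {j})) * subset_pf A (Y - {j}) * subset_pf B (T - {j} - (Y - {j}))))"
    by (intro sum.cong refl)
  also have "\<dots> = (\<Sum>j\<in>T. \<Sum>X\<in>Pow (T - {j}). rank_sign j T * A m j *
        (shuffle_sign X (T - {j} - X) * subset_pf A X * subset_pf B (T - {j} - X)))"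
    by (rule sum_Pow_member[OF T(1)])
  finally show ?thesis by (simp add: sum_distrib_left)
qed

text \<open>Pass to complements. A block of odd size has Pfaffian zero, and for blocks of even size
  the shuffle sign is symmetric.\<close>

lemma shuffle_sum_commute:
  fixes A B :: "nat \<Rightarrow> nat \<Rightarrow> 'a :: comm_ring_1"
  assumes "finite S"
  shows "(\<Sum>X\<in>Pow S. shuffle_sign X (S - X) * subset_pf A X * subset_pf B (S - X)) =
    (\<Sum>X\<in>Pow S. shuffle_sign X (S - X) * subset_pf B X * subset_pf A (S - X))"
proof (rule sum.reindex_bij_witness[where i = "\<lambda>X. S - X" and j = "\<lambda>X. S - X"])
  fix X assume "X \<in> Pow S"
  then have X: "S - (S - X) = X" "finite X" using assms by (auto intro: finite_subset)
  show "shuffle_sign (S - X) (S - (S - X)) * subset_pf B (S - X) * subset_pf A (S - (S - X)) =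
      shuffle_sign X (S - X) * subset_pf A X * subset_pf B (S - X)"
  proof (cases "even (card X)")
    case True
    then show ?thesis
      using shuffle_sign_commute[of X "S - X", where 'a = 'a] X assms by (simp add: mult_ac)
  qed (use X in \<open>simp add: subset_pf_odd\<close>)
qed auto

text \<open>Each pair of a matching takes its entry from A or from B, and X collects the indices of
  the A-pairs. The induction splits by the block that contains the largest index.\<close>

lemma subset_pf_add:
  fixes A B :: "nat \<Rightarrow> nat \<Rightarrow> 'a :: comm_ring_1"
  assumes "finite S"
  shows "subset_pf (\<lambda>i j. A i j + B i j) S =
    (\<Sum>X\<in>Pow S. shuffle_sign X (S - X) * subset_pf A X * subset_pf B (S - X))"
  using assms
proof (induction rule: finite_max_induct)
  case empty
  show ?case by (simp add: shuffle_sign_def)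
next
  case (insert m T)
  let ?C = "\<lambda>A B T. \<Sum>X\<in>Pow T. shuffle_sign X (T - X) * subset_pf A X * subset_pf B (T - X)"
  have mT: "m \<notin> T" using insert(2) by auto
  have half: "(\<Sum>Y\<in>Pow T. shuffle_sign (insert m Y) (insert m T - insert m Y) * subset_pf A (insert m Y) *
      subset_pf B (insert m T - insert m Y)) = (\<Sum>j\<in>T. rank_sign j T * A m j * ?C A B (T - {j}))"
    for A B :: "nat \<Rightarrow> nat \<Rightarrow> 'a"
  proof -
    have "insert m T - insert m Y = T - Y" for Y using mT by auto
    then show ?thesis using subset_pf_add_half[OF insert(1,2), of A B] by simp
  qed
  have "?C A B (insert m T) = (\<Sum>Y\<in>Pow T. shuffle_sign Y (insert m T - Y) * subset_pf A Y * subset_pf B (insert m T - Y))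
      + (\<Sum>j\<in>T. rank_sign j T * A m j * ?C A B (T - {j}))"
    unfolding sum_Pow_insert[OF insert(1) mT] half ..
  \<comment> \<open>Passing to complements turns the terms with m in the B-block into the case
    already treated, with A and B exchanged.\<close>
  also have "(\<Sum>Y\<in>Pow T. shuffle_sign Y (insert m T - Y) * subset_pf A Y * subset_pf B (insert m T - Y)) =
      (\<Sum>Y\<in>Pow T. shuffle_sign (insert m Y) (insert m T - insert m Y) * subset_pf B (insert m Y) *
      subset_pf A (insert m T - insert m Y))"
  proof (rule sum.reindex_bij_witness[where i = "\<lambda>X. T - X" and j = "\<lambda>X. T - X"])
    fix Y assume "Y \<in> Pow T"
    then have Y: "insert m T - insert m (T - Y) = Y" "insert m (T - Y) = insert m T - Y"
        "finite Y" "Y \<inter> (insert m T - Y) = {}"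
      using mT insert(1) by (auto intro: finite_subset)
    show "shuffle_sign (insert m (T - Y)) (insert m T - insert m (T - Y)) * subset_pf B (insert m (T - Y)) *
        subset_pf A (insert m T - insert m (T - Y)) =
        shuffle_sign Y (insert m T - Y) * subset_pf A Y * subset_pf B (insert m T - Y)"
    proof (cases "even (card Y)")
      case True
      then show ?thesis
        using shuffle_sign_commute[OF Y(3) _ Y(4), where 'a = 'a] insert(1) Y(1) unfolding Y(2) by (simp add: mult_ac)
    qed (use Y in \<open>simp add: subset_pf_odd\<close>)
  qed auto
  also have "\<dots> = (\<Sum>j\<in>T. rank_sign j T * B m j * ?C A B (T - {j}))"
    unfolding half by (intro sum.cong refl arg_cong2[of _ _ _ _ "(*)"] shuffle_sum_commute) (use insert(1) in auto)
  also have "\<dots> + (\<Sum>j\<in>T. rank_sign j T * A m j * ?C A B (T - {j})) =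
      (\<Sum>j\<in>T. rank_sign j T * (A m j + B m j) * subset_pf (\<lambda>i j. A i j + B i j) (T - {j}))"
    unfolding sum.distrib[symmetric]
  proof (rule sum.cong)
    fix j assume "j \<in> T"
    have "subset_pf (\<lambda>i j. A i j + B i j) (T - {j}) = ?C A B (T - {j})"
      by (rule insert(3)) (use insert(1) in \<open>auto intro!: card_mono\<close>)
    then show "rank_sign j T * B m j * ?C A B (T - {j}) + rank_sign j T * A m j * ?C A B (T - {j}) =
        rank_sign j T * (A m j + B m j) * subset_pf (\<lambda>i j. A i j + B i j) (T - {j})"
      by (simp only: distrib_left distrib_right add.commute)
  qed simp
  also have "\<dots> = subset_pf (\<lambda>i j. A i j + B i j) (insert m T)"
    by (rule subset_pf_insert_max[symmetric]) (use insert in auto)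
  finally show ?case by simp
qed

lemma subset_pf_zero_row:
  fixes A :: "nat \<Rightarrow> nat \<Rightarrow> 'a :: comm_ring_1"
  assumes skew: "\<And>i j. A i j = - A j i" and diag: "\<And>i. A i i = 0" and "finite S" "k \<in> S"
    and zero: "\<And>j. A k j = 0"
  shows "subset_pf A S = 0"
proof -
  have "rank_sign k (S - {k}) * subset_pf A (insert k (S - {k})) = 0"
    using subset_pf_row[where A = A and k = k and T = "S - {k}", OF skew diag] \<open>finite S\<close> by (simp add: zero)
  then have "rank_sign k (S - {k}) * (rank_sign k (S - {k}) * subset_pf A S) = 0"
    using \<open>k \<in> S\<close> by (simp add: insert_absorb)
  then show ?thesis unfolding rank_sign_square_left .
qed

text \<open>Reversing 2l rows has sign \<open>(-1) ^ l\<close>. The largest reflected index comes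
  from the smallest element of S, so the recursion becomes an expansion along the smallest row,
  which \<open>subset_pf_row\<close> provides.\<close>

lemma subset_pf_reflect:
  fixes A :: "nat \<Rightarrow> nat \<Rightarrow> 'a :: comm_ring_1"
  assumes skew: "\<And>i j. A i j = - A j i" and diag: "\<And>i. A i i = 0" and "S \<subseteq> {..n}"
  shows "subset_pf (\<lambda>i j. A (n - i) (n - j)) ((\<lambda>i. n - i) ` S) = (-1) ^ (card S div 2) * subset_pf A S"
  using \<open>S \<subseteq> {..n}\<close>
proof (induction "card S" arbitrary: S rule: less_induct)
  case less
  let ?f = "\<lambda>i. n - i"
  show ?case
  proof (cases "S = {}")
    case False
    have fin: "finite S" using less.prems by (auto intro: finite_subset)
    define k where "k = Min S"
    define T where "T = S - {k}"
    have S: "S = insert k T" and kT: "k \<notin> T" using Min_in[OF fin False] by (auto simp: T_def k_def)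
    have T: "finite T" "T \<subseteq> {..n}" "k \<le> n" using fin less.prems S by auto
    have kless: "k < i" if "i \<in> T" for i using that fin by (auto simp: T_def k_def less_le)
    have inj: "inj_on ?f T" using T(2) by (intro inj_onI) (metis diff_diff_cancel subsetD atMost_iff)
    have "subset_pf (\<lambda>i j. A (n - i) (n - j)) (?f ` S) =
        (\<Sum>j\<in>?f ` T. rank_sign j (?f ` T) * A (n - (n - k)) (n - j) *
          subset_pf (\<lambda>i j. A (n - i) (n - j)) (?f ` T - {j}))"
      unfolding S image_insert
    proof (rule subset_pf_insert_max)
      fix i assume "i \<in> ?f ` T"
      then obtain j where "i = n - j" "j \<in> T" by auto
      then show "i < n - k" using kless[of j] T by (auto intro: diff_less_mono2)
    qed (use T in auto)
    also have "\<dots> = (\<Sum>j\<in>T. rank_sign (n - j) (?f ` T) * A k j *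
          subset_pf (\<lambda>i j. A (n - i) (n - j)) (?f ` T - {n - j}))"
      using T by (subst sum.reindex[OF inj]) (auto intro!: sum.cong)
    also have "\<dots> = (\<Sum>j\<in>T. (-1) ^ (card S div 2) * (rank_sign k T * (rank_sign j T * A k j * subset_pf A (T - {j}))))"
    proof (rule sum.cong)
      fix j assume j: "j \<in> T"
      have "?f ` T - {n - j} = ?f ` (T - {j})" using inj j by (auto dest: inj_onD)
      moreover have "subset_pf (\<lambda>i j. A (n - i) (n - j)) (?f ` (T - {j})) = (-1) ^ (card (T - {j}) div 2) * subset_pf A (T - {j})"
        by (rule less.hyps) (use S T kT j in \<open>auto intro!: psubset_card_mono\<close>)
      ultimately have IH: "subset_pf (\<lambda>i j. A (n - i) (n - j)) (?f ` T - {n - j}) =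
          (-1) ^ (card (T - {j}) div 2) * subset_pf A (T - {j})" by simp
      have cardT: "card T = Suc (card (T - {j}))" using j T by (metis card_Suc_Diff1)
      have cS: "card S div 2 = Suc (card (T - {j}) div 2)" using S T kT cardT by simp
      have "{i \<in> ?f ` T. n - j < i} = ?f ` {i \<in> T. i < j}" using T j by force
      moreover have "card (?f ` {i \<in> T. i < j}) = card {i \<in> T. i < j}"
        by (rule card_image, rule inj_on_subset[OF inj]) auto
      ultimately have r: "rank_sign (n - j) (?f ` T) = (-1 :: 'a) ^ card {i \<in> T. i < j}"
        by (simp add: rank_sign_def)
      have "T = insert j ({i \<in> T. i < j} \<union> {i \<in> T. j < i})" using j by auto
      then have "card T = card (insert j ({i \<in> T. i < j} \<union> {i \<in> T. j < i}))" by simp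
      also have "\<dots> = Suc (card {i \<in> T. i < j} + card {i \<in> T. j < i})"
        using T by (subst card_insert_disjoint) (auto intro!: card_Un_disjoint)
      finally have cT: "card T = Suc (card {i \<in> T. i < j} + card {i \<in> T. j < i})" .
      have rk: "rank_sign k T = (-1 :: 'a) ^ card T" by (rule rank_sign_below) (rule kless)
      \<comment> \<open>The elements of T below j and those above j together number
        \<open>card T - 1\<close>, which leaves one sign for each pair.\<close>
      have "rank_sign k T * rank_sign j T = - (rank_sign (n - j) (?f ` T) :: 'a)"
        unfolding r rk by (simp add: cT rank_sign_def[of j] minus_one_power_iff)
      then have "rank_sign (n - j) (?f ` T) = - (rank_sign k T * rank_sign j T :: 'a)" by simp
      then show "rank_sign (n - j) (?f ` T) * A k j * subset_pf (\<lambda>i j. A (n - i) (n - j)) (?f ` T - {n - j}) =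
          (-1) ^ (card S div 2) * (rank_sign k T * (rank_sign j T * A k j * subset_pf A (T - {j})))"
        unfolding IH cS by (simp add: mult_ac)
    qed simp
    also have "\<dots> = (-1) ^ (card S div 2) * (rank_sign k T * (\<Sum>j\<in>T. rank_sign j T * A k j * subset_pf A (T - {j})))"
      by (simp only: sum_distrib_left)
    also have "\<dots> = (-1) ^ (card S div 2) * subset_pf A S"
      by (subst subset_pf_row[OF skew diag T(1)]) (use kT S in simp)
    finally show ?thesis .
  qed simp
qed

section \<open>Comparison with the sum over perfect matchings\<close>

text \<open>Applied twice, this frees the positions 0 and 1 for the pair that contains 0.\<close>

definition shift_perm :: "(nat \<Rightarrow> nat) \<Rightarrow> nat \<Rightarrow> nat" where
  "shift_perm p = (\<lambda>i. if i = 0 then 0 else Suc (p (i - 1)))"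

text \<open>The cycle that brings j + 1 to position 1 and keeps the order of the other numbers. It
  is a product of j adjacent transpositions, whence the sign in the row expansion.\<close>

definition move_cycle :: "nat \<Rightarrow> nat \<Rightarrow> nat" where
  "move_cycle j = (\<lambda>i. if i = 0 then 0 else if i = 1 then Suc j else if i \<le> Suc j then i - 1 else i)"

text \<open>The increasing enumeration of the numbers other than 0 and j + 1.\<close>

definition skip :: "nat \<Rightarrow> nat \<Rightarrow> nat" where
  "skip j i = (if i < j then i + 1 else i + 2)"

lemma skip_less_iff [simp]: "skip j a < skip j b \<longleftrightarrow> a < b"
  by (auto simp: skip_def)

lemma skip_eq_iff [simp]: "skip j a = skip j b \<longleftrightarrow> a = b"
  by (auto simp: skip_def)

lemma move_cycle_shift: "move_cycle j (shift_perm (shift_perm p) (Suc (Suc i))) = skip j (p i)"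
  by (simp add: move_cycle_def shift_perm_def skip_def)

lemma move_cycle_shift_0: "move_cycle j (shift_perm (shift_perm p) 0) = 0"
  by (simp add: move_cycle_def shift_perm_def)

lemma move_cycle_shift_1: "move_cycle j (shift_perm (shift_perm p) (Suc 0)) = Suc j"
  by (simp add: move_cycle_def shift_perm_def)

lemma shift_perm_permutes_sign:
  assumes "p permutes {..<n}"
  shows "shift_perm p permutes {..<Suc n} \<and> sign (shift_perm p) = sign p"
  using assms finite_lessThan
proof (induction rule: permutes_induct)
  case id
  have "shift_perm id = id" by (auto simp: shift_perm_def)
  then show ?case using permutes_id by metis
next
  case (swap a b p)
  have eq: "shift_perm (Transposition.transpose a b \<circ> p) = Transposition.transpose (Suc a) (Suc b) \<circ> shift_perm p"
    by (auto simp: shift_perm_def Transposition.transpose_def fun_eq_iff)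
  have t: "Transposition.transpose (Suc a) (Suc b) permutes {..<Suc n}"
    using swap.hyps by (intro permutes_swap_id) auto
  have perm: "permutation p" "permutation (shift_perm p)"
    using swap by (auto simp: permutation_permutes)
  have "sign (Transposition.transpose (Suc a) (Suc b) \<circ> shift_perm p) = sign (Transposition.transpose a b \<circ> p)"
    using perm swap by (simp add: sign_compose permutation_swap_id sign_swap_id)
  then show ?case unfolding eq using permutes_compose[OF conjunct1[OF swap.IH] t] by blast
qed

lemma move_cycle_permutes_sign:
  assumes "Suc j < n"
  shows "move_cycle j permutes {..<n} \<and> sign (move_cycle j) = (-1) ^ j"
  using assms
proof (induction j)
  case 0
  have "move_cycle 0 = id" by (auto simp: move_cycle_def)
  then show ?case by (metis permutes_id sign_id power_0)
next
  case (Suc j)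
  have eq: "move_cycle (Suc j) = Transposition.transpose (Suc j) (Suc (Suc j)) \<circ> move_cycle j"
    by (auto simp: move_cycle_def Transposition.transpose_def fun_eq_iff)
  have t: "Transposition.transpose (Suc j) (Suc (Suc j)) permutes {..<n}"
    using Suc.prems by (intro permutes_swap_id) auto
  have IH: "move_cycle j permutes {..<n}" "sign (move_cycle j) = (-1) ^ j" using Suc by auto
  have perm: "permutation (move_cycle j)" using IH by (auto simp: permutation_permutes)
  have "sign (Transposition.transpose (Suc j) (Suc (Suc j)) \<circ> move_cycle j) = (-1) ^ Suc j"
    using perm by (subst sign_compose) (simp_all add: permutation_swap_id sign_swap_id IH)
  then show ?case unfolding eq using permutes_compose[OF IH(1) t] by blast
qed

lemma shift_perm_surj:
  assumes q: "q permutes {..<Suc n}" and "q 0 = 0"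
  shows "\<exists>p. p permutes {..<n} \<and> q = shift_perm p"
proof -
  define p where "p = (\<lambda>i. q (Suc i) - 1)"
  have pos: "0 < q (Suc i)" for i
    using permutes_inj[OF q] \<open>q 0 = 0\<close> by (metis injD nat.distinct(1) neq0_conv)
  have inj: "inj p"
  proof (rule injI)
    fix x y assume "p x = p y"
    then have "q (Suc x) = q (Suc y)" using pos[of x] pos[of y] by (simp add: p_def)
    then show "x = y" using permutes_inj[OF q] by (auto dest: injD)
  qed
  have "p permutes {..<n}"
  proof (rule bij_imp_permutes)
    have "p ` {..<n} \<subseteq> {..<n}"
    proof (rule image_subsetI)
      fix i assume "i \<in> {..<n}"
      then have "q (Suc i) < Suc n" using permutes_in_image[OF q, of "Suc i"] by simp
      then show "p i \<in> {..<n}" using pos[of i] by (simp add: p_def)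
    qed
    moreover have "inj_on p {..<n}" using inj by (rule inj_on_subset) simp
    ultimately show "bij_betw p {..<n} {..<n}"
      by (simp add: bij_betw_def endo_inj_surj)
    show "p i = i" if "i \<notin> {..<n}" for i
      using permutes_not_in[OF q, of "Suc i"] that by (simp add: p_def)
  qed
  moreover have "q = shift_perm p"
  proof
    fix i show "q i = shift_perm p i"
      using pos \<open>q 0 = 0\<close> by (cases i) (simp_all add: shift_perm_def p_def)
  qed
  ultimately show ?thesis by blast
qed

definition matchings :: "nat \<Rightarrow> (nat \<Rightarrow> nat) set" where
  "matchings n = {p. p permutes {..<2 * n} \<and> (\<forall>i<n. p (2 * i) < p (2 * i + 1)) \<and>
          (\<forall>i j. i < j \<and> j < n \<longrightarrow> p (2 * i) < p (2 * j))}"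

text \<open>Within a pair the smaller number comes first, so 0 is the first entry of its pair; the
  first entries increase, so this pair is the first one.\<close>

lemma matching_0:
  assumes "q \<in> matchings (Suc n)"
  shows "q 0 = 0"
proof -
  from assms have q: "q permutes {..<2 * Suc n}" and le: "\<And>i. i < Suc n \<Longrightarrow> q (2 * i) < q (2 * i + 1)"
    and less: "\<And>i j. i < j \<Longrightarrow> j < Suc n \<Longrightarrow> q (2 * i) < q (2 * j)"
    by (auto simp: matchings_def)
  obtain i where i: "q i = 0" "i < 2 * Suc n"
    using permutes_image[OF q] by (metis imageE lessThan_iff zero_less_Suc mult_2 add_gr_0)
  have "i div 2 < Suc n" using i(2) by (simp add: div_less_iff_less_mult mult.commute)
  have "i = 2 * (i div 2)"
    using le[OF \<open>i div 2 < Suc n\<close>] i(1) by (cases "even i") (auto elim: oddE)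
  then have "\<not> 0 < i div 2" using less[of 0 "i div 2"] i \<open>i div 2 < Suc n\<close> by auto
  then show ?thesis using i(1) \<open>i = 2 * (i div 2)\<close> by simp
qed

text \<open>A matching of 2n + 2 points consists of the partner j + 1 of 0 and a matching of the
  remaining 2n points, relabelled by \<open>skip j\<close>.\<close>

lemma bij_betw_matchings:
  "bij_betw (\<lambda>(j, p). move_cycle j \<circ> shift_perm (shift_perm p))
     ({..<2 * n + 1} \<times> matchings n) (matchings (Suc n))"
proof (rule bij_betw_imageI)
  let ?f = "\<lambda>j p. move_cycle j \<circ> shift_perm (shift_perm p)"
  show "inj_on (\<lambda>(j, p). ?f j p) ({..<2 * n + 1} \<times> matchings n)"
  proof (clarsimp simp: inj_on_def)
    fix j p j' p' assume eq: "?f j p = ?f j' p'"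
    have j: "j = j'" using fun_cong[OF eq, of "Suc 0"] by (simp add: move_cycle_shift_1)
    have "p i = p' i" for i using fun_cong[OF eq, of "Suc (Suc i)"] j by (simp add: move_cycle_shift)
    then show "j = j' \<and> p = p'" using j by auto
  qed
  have char: "?f j p \<in> matchings (Suc n) \<longleftrightarrow> p \<in> matchings n"
    if j: "j < 2 * n + 1" and p: "p permutes {..<2 * n}" for j p
  proof -
    have "shift_perm (shift_perm p) permutes {..<2 * Suc n}"
      using shift_perm_permutes_sign[of p "2 * n"] shift_perm_permutes_sign[of "shift_perm p" "Suc (2 * n)"] p by simp
    moreover have "move_cycle j permutes {..<2 * Suc n}" using move_cycle_permutes_sign[of j "2 * Suc n"] j by simp
    ultimately have perm: "?f j p permutes {..<2 * Suc n}" by (rule permutes_compose)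
    have "(\<forall>i<Suc n. ?f j p (2 * i) < ?f j p (2 * i + 1)) \<longleftrightarrow> (\<forall>i<n. p (2 * i) < p (2 * i + 1))"
      unfolding All_less_Suc2 by (simp add: move_cycle_shift move_cycle_shift_0 move_cycle_shift_1)
    moreover have "(\<forall>b<Suc n. \<forall>a<b. ?f j p (2 * a) < ?f j p (2 * b)) \<longleftrightarrow> (\<forall>b<n. \<forall>a<b. p (2 * a) < p (2 * b))"
      unfolding All_less_Suc2 by (simp add: move_cycle_shift move_cycle_shift_0 move_cycle_shift_1)
         (simp add: skip_def)
    ultimately show ?thesis using perm p unfolding matchings_def by blast
  qed
  show "(\<lambda>(j, p). ?f j p) ` ({..<2 * n + 1} \<times> matchings n) = matchings (Suc n)"
  proof (intro equalityI subsetI)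
    fix q assume "q \<in> (\<lambda>(j, p). ?f j p) ` ({..<2 * n + 1} \<times> matchings n)"
    then obtain j p where "q = ?f j p" "j < 2 * n + 1" "p \<in> matchings n" by auto
    moreover from this have "p permutes {..<2 * n}" by (simp add: matchings_def)
    ultimately show "q \<in> matchings (Suc n)" using char by blast
  next
    fix q assume q: "q \<in> matchings (Suc n)"
    then have qp: "q permutes {..<2 * Suc n}" by (simp add: matchings_def)
    have q0: "q 0 = 0" by (rule matching_0[OF q])
    have q1: "0 < q 1" using q q0 by (fastforce simp: matchings_def)
    have "q 1 < 2 * Suc n" using permutes_in_image[OF qp, of 1] by simp
    define j where "j = q 1 - 1"
    have j: "Suc j = q 1" "j < 2 * n + 1" "Suc j < 2 * Suc n" using q1 \<open>q 1 < 2 * Suc n\<close> by (auto simp: j_def)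
    have c: "move_cycle j permutes {..<2 * Suc n}" using move_cycle_permutes_sign j(3) by blast
    define r where "r = inv (move_cycle j) \<circ> q"
    have r: "r permutes {..<Suc (Suc (2 * n))}"
      unfolding r_def using permutes_compose[OF qp permutes_inv[OF c]] by simp
    have qr: "q = move_cycle j \<circ> r" using permutes_inv_o[OF c] by (auto simp: r_def fun_eq_iff permutes_inverses[OF c])
    have "r 0 = 0" "r 1 = 1"
      using permutes_inverses(2)[OF c, of 0] permutes_inverses(2)[OF c, of 1] q0 j(1)
      by (auto simp: r_def move_cycle_def)
    obtain r1 where r1: "r1 permutes {..<Suc (2 * n)}" "r = shift_perm r1"
      using shift_perm_surj[OF r \<open>r 0 = 0\<close>] by blast
    have "r1 0 = 0" using \<open>r 1 = 1\<close> r1 by (simp add: shift_perm_def)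
    obtain p where p: "p permutes {..<2 * n}" "r1 = shift_perm p"
      using shift_perm_surj[OF r1(1) \<open>r1 0 = 0\<close>] by blast
    have "q = ?f j p" using qr r1 p by simp
    moreover have "p \<in> matchings n" using char[OF j(2) p(1)] q \<open>q = ?f j p\<close> by simp
    ultimately show "q \<in> (\<lambda>(j, p). ?f j p) ` ({..<2 * n + 1} \<times> matchings n)" using j(2) by force
  qed
qed

lemma pfaffian_Suc:
  "pfaffian (Suc n) B =
    (\<Sum>j<2 * n + 1. (-1) ^ j * B 0 (Suc j) * pfaffian n (\<lambda>a b. B (skip j a) (skip j b)))"
proof -
  let ?t = "\<lambda>n B p. of_int (sign p) * (\<Prod>i<n. B (p (2 * i)) (p (2 * i + 1)))"
  have pf: "pfaffian n B = sum (?t n B) (matchings n)" for n and B :: "nat \<Rightarrow> nat \<Rightarrow> 'a"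
    by (simp add: pfaffian_def matchings_def)
  have "pfaffian (Suc n) B = (\<Sum>(j, p)\<in>{..<2 * n + 1} \<times> matchings n.
      ?t (Suc n) B (move_cycle j \<circ> shift_perm (shift_perm p)))"
    unfolding pf by (subst sum.reindex_bij_betw[OF bij_betw_matchings, symmetric]) (simp add: case_prod_beta)
  also have "\<dots> = (\<Sum>(j, p)\<in>{..<2 * n + 1} \<times> matchings n.
      (-1) ^ j * B 0 (Suc j) * ?t n (\<lambda>a b. B (skip j a) (skip j b)) p)"
  proof (rule sum.cong, simp, clarsimp simp del: prod.lessThan_Suc o_apply)
    fix j p assume j: "j < Suc (2 * n)" and "p \<in> matchings n"
    then have p: "p permutes {..<2 * n}" by (simp add: matchings_def)
    note s1 = shift_perm_permutes_sign[OF p]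
    note s2 = shift_perm_permutes_sign[OF conjunct1[OF s1]]
    have c: "move_cycle j permutes {..<Suc (Suc (2 * n))}" "sign (move_cycle j) = (-1) ^ j"
      using move_cycle_permutes_sign[of j "Suc (Suc (2 * n))"] j by auto
    have "permutation (move_cycle j)" "permutation (shift_perm (shift_perm p))"
      using c s2 by (auto simp: permutation_permutes)
    then have "sign (move_cycle j \<circ> shift_perm (shift_perm p)) = (-1) ^ j * sign p"
      using s1 s2 c by (simp add: sign_compose)
    then show "of_int (sign (move_cycle j \<circ> shift_perm (shift_perm p))) *
        (\<Prod>i<Suc n. B ((move_cycle j \<circ> shift_perm (shift_perm p)) (2 * i)) ((move_cycle j \<circ> shift_perm (shift_perm p)) (Suc (2 * i)))) =
        (-1) ^ j * B 0 (Suc j) * (of_int (sign p) * (\<Prod>i<n. B (skip j (p (2 * i))) (skip j (p (Suc (2 * i))))))"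
      unfolding prod.lessThan_Suc_shift
      by (simp add: move_cycle_shift move_cycle_shift_0 move_cycle_shift_1 mult_ac)
  qed
  also have "\<dots> = (\<Sum>j<2 * n + 1. (-1) ^ j * B 0 (Suc j) * pfaffian n (\<lambda>a b. B (skip j a) (skip j b)))"
    unfolding pf by (simp add: sum.cartesian_product sum_distrib_left)
  finally show ?thesis .
qed

text \<open>A decreasing enumeration f turns the expansion along row 0 into the recursion along the
  largest index: exactly j elements of T exceed \<open>f (Suc j)\<close>, so the signs
  agree.\<close>

lemma pfaffian_eq_subset_pf:
  assumes "\<And>i j. i < j \<Longrightarrow> j < 2 * n \<Longrightarrow> f j < f i"
  shows "pfaffian n (\<lambda>i j. A (f i) (f j)) = subset_pf A (f ` {..<2 * n})"
  using assms
proof (induction n arbitrary: f)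
  case 0
  then show ?case by (simp add: pfaffian_def)
next
  case (Suc n)
  let ?I = "\<lambda>j. {..<2 * n + 1} - {j}"
  have dec: "f j < f i \<longleftrightarrow> i < j" if "i < 2 * Suc n" "j < 2 * Suc n" for i j
    using Suc.prems that by (metis linorder_neqE_nat order_less_asym)
  have inj: "inj_on f {..<2 * Suc n}"
    using dec by (auto simp: inj_on_def) (metis less_irrefl linorder_neqE_nat)
  define T where "T = (\<lambda>j. f (Suc j)) ` {..<2 * n + 1}"
  have img: "f ` {..<2 * Suc n} = insert (f 0) T"
    unfolding T_def by (simp add: lessThan_Suc_eq_insert_0 image_image)
  have injS: "inj_on (\<lambda>j. f (Suc j)) {..<2 * n + 1}"
    using inj by (auto simp: inj_on_def)
  have "subset_pf A (f ` {..<2 * Suc n}) =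
      (\<Sum>j\<in>T. rank_sign j T * A (f 0) j * subset_pf A (T - {j}))"
    unfolding img by (rule subset_pf_insert_max) (auto simp: T_def dec)
  also have "\<dots> = (\<Sum>j<2 * n + 1. rank_sign (f (Suc j)) T * A (f 0) (f (Suc j)) * subset_pf A (T - {f (Suc j)}))"
    unfolding T_def by (subst sum.reindex[OF injS]) simp
  also have "\<dots> = (\<Sum>j<2 * n + 1. (-1) ^ j * A (f 0) (f (Suc j)) * pfaffian n (\<lambda>a b. A (f (skip j a)) (f (skip j b))))"
  proof (rule sum.cong)
    fix j assume "j \<in> {..<2 * n + 1}"
    then have j: "j < 2 * n + 1" by simp
    have "{i \<in> T. f (Suc j) < i} = (\<lambda>j. f (Suc j)) ` {..<j}"
      using j by (auto simp: T_def dec)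
    moreover have "card ((\<lambda>j. f (Suc j)) ` {..<j}) = j"
      using j by (subst card_image) (auto intro: inj_on_subset[OF injS])
    ultimately have r: "rank_sign (f (Suc j)) T = (-1 :: 'a) ^ j" by (simp add: rank_sign_def)
    have "skip j ` {..<2 * n} = Suc ` ({..<2 * n + 1} - {j})"
    proof (intro equalityI subsetI)
      fix x assume "x \<in> Suc ` ({..<2 * n + 1} - {j})"
      then obtain i where i: "x = Suc i" "i < 2 * n + 1" "i \<noteq> j" by auto
      then have "x = skip j (if i < j then i else i - 1)" "(if i < j then i else i - 1) < 2 * n"
        using j by (auto simp: skip_def)
      then show "x \<in> skip j ` {..<2 * n}" by blast
    qed (use j in \<open>auto simp: skip_def image_iff split: if_splits\<close>)
    then have "f ` skip j ` {..<2 * n} = f ` Suc ` ({..<2 * n + 1} - {j})" by simp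
    then have "(\<lambda>a. f (skip j a)) ` {..<2 * n} = (\<lambda>j. f (Suc j)) ` ({..<2 * n + 1} - {j})"
      unfolding image_image .
    also have "\<dots> = T - {f (Suc j)}" unfolding T_def using j injS by (auto dest: inj_onD)
    finally have img: "(\<lambda>a. f (skip j a)) ` {..<2 * n} = T - {f (Suc j)}" .
    have "pfaffian n (\<lambda>a b. A (f (skip j a)) (f (skip j b))) = subset_pf A ((\<lambda>a. f (skip j a)) ` {..<2 * n})"
      by (rule Suc.IH, subst dec) (auto simp: skip_def)
    then show "rank_sign (f (Suc j)) T * A (f 0) (f (Suc j)) * subset_pf A (T - {f (Suc j)}) =
        (-1) ^ j * A (f 0) (f (Suc j)) * pfaffian n (\<lambda>a b. A (f (skip j a)) (f (skip j b)))"
      unfolding img r by simp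
  qed simp
  also have "\<dots> = pfaffian (Suc n) (\<lambda>i j. A (f i) (f j))"
    by (rule pfaffian_Suc[symmetric])
  finally show ?case by simp
qed

section \<open>Augmented index sets and the block matrix\<close>

text \<open>A strict partition is represented by the set \<open>T\<close> of its parts, with \<open>0 \<notin> T\<close>.\<close>

definition aug_pf :: "(nat \<Rightarrow> nat \<Rightarrow> 'a :: comm_ring_1) \<Rightarrow> nat set \<Rightarrow> 'a" where
  "aug_pf A T = (if even (card T) then subset_pf A T else subset_pf A (insert 0 T))"

lemma aug_pf_empty [simp]: "aug_pf A {} = 1"
  by (simp add: aug_pf_def)

text \<open>For odd size this is the expansion along row 0 of the set T with 0 adjoined. For even
  size that expansion repeats the row 0, so the sum vanishes.\<close>

lemma aug_pf_last_column:
  fixes A :: "nat \<Rightarrow> nat \<Rightarrow> 'a :: comm_ring_1"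
  assumes skew: "\<And>i j. A i j = - A j i" and diag: "\<And>i. A i i = 0" and T: "finite T" "0 \<notin> T"
  shows "(\<Sum>j\<in>T. rank_sign j T * A j 0 * aug_pf A (T - {j})) = (if odd (card T) then aug_pf A T else 0)"
proof (cases "odd (card T)")
  case True
  have "(\<Sum>j\<in>T. rank_sign j T * A j 0 * aug_pf A (T - {j})) = - (\<Sum>j\<in>T. rank_sign j T * A 0 j * subset_pf A (T - {j}))"
    unfolding sum_negf[symmetric] using True T(1)
    by (intro sum.cong refl) (simp add: aug_pf_def skew[of _ 0])
  also have "\<dots> = - (rank_sign 0 T * subset_pf A (insert 0 T))"
    using T subset_pf_row[where A = A and k = 0 and T = T, OF skew diag] by simp
  also have "rank_sign 0 T = ((-1) ^ card T :: 'a)" by (rule rank_sign_below) (use T in \<open>metis neq0_conv\<close>)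
  finally show ?thesis using True by (simp add: aug_pf_def)
next
  case False
  have "0 = (\<Sum>j\<in>insert 0 T. rank_sign j (insert 0 T) * A 0 j * subset_pf A (insert 0 T - {j}))"
    using T subset_pf_row[where A = A and k = 0 and T = "insert 0 T", OF skew diag] by simp
  also have "\<dots> = (\<Sum>j\<in>T. rank_sign j (insert 0 T) * A 0 j * subset_pf A (insert 0 T - {j}))"
    using T by (simp add: diag)
  also have "\<dots> = - (\<Sum>j\<in>T. rank_sign j T * A j 0 * aug_pf A (T - {j}))"
    unfolding sum_negf[symmetric]
  proof (rule sum.cong)
    fix j assume j: "j \<in> T"
    then have "j \<noteq> 0" "odd (card (T - {j}))" "insert 0 T - {j} = insert 0 (T - {j})"
      using False T card_gt_0_iff[of T] by auto
    then show "rank_sign j (insert 0 T) * A 0 j * subset_pf A (insert 0 T - {j}) =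
        - (rank_sign j T * A j 0 * aug_pf A (T - {j}))"
      using T by (simp add: aug_pf_def rank_sign_insert skew[of j 0])
  qed simp
  finally show ?thesis using False by simp
qed

text \<open>
  A row expansion that does not distinguish the two parities. For \<open>T\<close> of odd size the rank one
  summand of the matrix contributes what the corner term removes; for \<open>T\<close> of even size it
  contributes nothing, being an expansion with two equal columns.
\<close>

lemma aug_pf_row:
  fixes A :: "nat \<Rightarrow> nat \<Rightarrow> 'a :: comm_ring_1"
  assumes skew: "\<And>i j. A i j = - A j i" and diag: "\<And>i. A i i = 0" and T: "finite T" "0 \<notin> T" and k: "0 < k"
  shows "(\<Sum>j\<in>T. rank_sign j T * (A k j + A k 0 * A j 0) * aug_pf A (T - {j})) + (-1) ^ card T * A k 0 * aug_pf A T =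
    (if k \<in> T then 0 else rank_sign k T * aug_pf A (insert k T))"
proof -
  have split: "(\<Sum>j\<in>T. rank_sign j T * (A k j + A k 0 * A j 0) * aug_pf A (T - {j})) =
      (\<Sum>j\<in>T. rank_sign j T * A k j * aug_pf A (T - {j})) + A k 0 * (\<Sum>j\<in>T. rank_sign j T * A j 0 * aug_pf A (T - {j}))"
    unfolding sum_distrib_left sum.distrib[symmetric] by (intro sum.cong refl) (simp add: algebra_simps)
  show ?thesis
  proof (cases "odd (card T)")
    case True
    have "(\<Sum>j\<in>T. rank_sign j T * A k j * aug_pf A (T - {j})) = (\<Sum>j\<in>T. rank_sign j T * A k j * subset_pf A (T - {j}))"
      using True T(1) by (intro sum.cong refl) (simp add: aug_pf_def)
    also have "\<dots> = (if k \<in> T then 0 else rank_sign k T * aug_pf A (insert k T))"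
      using subset_pf_row[where A = A and k = k and T = T, OF skew diag T(1)] True T(1)
      by (simp add: aug_pf_def)
    finally show ?thesis
      unfolding split aug_pf_last_column[where A = A and T = T, OF skew diag T] using True by simp
  next
    case False
    have "(\<Sum>j\<in>T. rank_sign j T * A k j * aug_pf A (T - {j})) + (-1) ^ card T * A k 0 * aug_pf A T =
        (\<Sum>j\<in>insert 0 T. rank_sign j (insert 0 T) * A k j * subset_pf A (insert 0 T - {j}))"
    proof -
      have "rank_sign 0 T = ((-1) ^ card T :: 'a)" by (rule rank_sign_below) (use T in \<open>metis neq0_conv\<close>)
      moreover have "(\<Sum>j\<in>T. rank_sign j T * A k j * aug_pf A (T - {j})) =
          (\<Sum>j\<in>T. rank_sign j (insert 0 T) * A k j * subset_pf A (insert 0 T - {j}))"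
      proof (rule sum.cong)
        fix j assume j: "j \<in> T"
        then have "j \<noteq> 0" "odd (card (T - {j}))" "insert 0 T - {j} = insert 0 (T - {j})"
          using False T card_gt_0_iff[of T] by auto
        then show "rank_sign j T * A k j * aug_pf A (T - {j}) =
            rank_sign j (insert 0 T) * A k j * subset_pf A (insert 0 T - {j})"
          using T by (simp add: aug_pf_def rank_sign_insert)
      qed simp
      ultimately show ?thesis using T False by (simp add: aug_pf_def add.commute)
    qed
    also have "\<dots> = (if k \<in> T then 0 else rank_sign k T * aug_pf A (insert k T))"
      using subset_pf_row[where A = A and k = k and T = "insert 0 T", OF skew diag] T k False
      by (simp add: aug_pf_def rank_sign_insert insert_commute)
    finally show ?thesis
      unfolding split aug_pf_last_column[where A = A and T = T, OF skew diag T] using False by simp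
  qed
qed

lemma pf_at_eq_aug_pf:
  assumes "\<nu> \<in> DP"
  shows "pf_at A \<nu> = aug_pf A (set \<nu>)"
proof -
  define \<mu> where "\<mu> = augment \<nu>"
  have \<nu>: "sorted_wrt (>) \<nu>" "0 \<notin> set \<nu>" using assms by (auto simp: DP_def)
  have dist: "distinct \<nu>" using \<nu>(1) by (simp add: sorted_wrt_iff_nth_less distinct_conv_nth)
     (metis less_irrefl nat_neq_iff)
  have ev: "even (length \<mu>)" by (simp add: \<mu>_def augment_def)
  have "\<forall>x\<in>set \<nu>. 0 < x" using \<nu>(2) by (metis neq0_conv)
  then have sorted: "sorted_wrt (>) \<mu>"
    using \<nu> by (auto simp: \<mu>_def augment_def sorted_wrt_append)
  have "pf_at A \<nu> = pfaffian (length \<mu> div 2) (\<lambda>i j. A (\<mu> ! i) (\<mu> ! j))"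
    by (simp add: pf_at_def \<mu>_def Let_def)
  also have "\<dots> = subset_pf A ((!) \<mu> ` {..<2 * (length \<mu> div 2)})"
    by (rule pfaffian_eq_subset_pf) (use sorted in \<open>auto simp: sorted_wrt_iff_nth_less\<close>)
  also have "(!) \<mu> ` {..<2 * (length \<mu> div 2)} = set \<mu>"
    using ev by (auto simp: set_conv_nth)
  also have "subset_pf A (set \<mu>) = aug_pf A (set \<nu>)"
    using distinct_card[OF dist] by (simp add: aug_pf_def \<mu>_def augment_def)
  finally show ?thesis .
qed

text \<open>The only candidate matching pairs x with N - x, and for odd N no index is its own
  partner. The partner of the largest index is then the smallest one, an even number of indices lies
  between them, and all signs are +1.\<close>

lemma subset_pf_antidiagonal:
  assumes "Z \<subseteq> {..N}" "odd N"
  shows "subset_pf (\<lambda>x y. if x + y = N then 1 else 0) Z =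
    (if (\<lambda>x. N - x) ` Z = Z then 1 else 0 :: 'a :: comm_ring_1)"
  using finite_subset[OF assms(1) finite_atMost] assms(1)
proof (induction rule: finite_max_induct)
  case (insert m T)
  let ?J = "\<lambda>x y. if x + y = N then 1 else 0 :: 'a" and ?f = "\<lambda>x. N - x"
  have N: "m \<le> N" "T \<subseteq> {..N}" "m \<notin> T" using insert by auto
  have "subset_pf ?J (insert m T) = (\<Sum>j\<in>T. rank_sign j T * ?J m j * subset_pf ?J (T - {j}))"
    by (rule subset_pf_insert_max) (use insert in auto)
  also have "\<dots> = (\<Sum>j\<in>T. if j = N - m then rank_sign j T * subset_pf ?J (T - {j}) else 0)"
    by (rule sum.cong) (use N in auto)
  also have "\<dots> = (if N - m \<in> T then rank_sign (N - m) T * subset_pf ?J (T - {N - m}) else 0)"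
    using insert(1) by simp
  finally have pf: "subset_pf ?J (insert m T) = \<dots>" .
  have Nm: "N - m \<noteq> m" using assms(2) N by presburger
  have ff: "?f (?f x) = x" if "x \<in> insert m T" for x using that N by auto
  show ?case
  proof (cases "N - m \<in> T")
    case True
    let ?T = "T - {N - m}"
    have IH: "subset_pf ?J ?T = (if ?f ` ?T = ?T then 1 else 0)"
      by (rule insert(3)) (use insert(1) N in \<open>auto intro!: card_mono\<close>)
    have sym: "?f ` insert m T = insert m T \<longleftrightarrow> ?f ` ?T = ?T"
    proof -
      have eq: "insert m T = insert m (insert (N - m) ?T)" using True by auto
      have "?f ` insert m T = insert m (insert (N - m) (?f ` ?T))"
        by (subst eq) (use N in auto)
      moreover have "m \<notin> ?f ` ?T"
      proof
        assume "m \<in> ?f ` ?T"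
        then obtain x where x: "x \<in> ?T" "m = N - x" by (elim imageE)
        then have "N - m = x" using ff[of x] by simp
        then show False using x(1) by simp
      qed
      moreover have "N - m \<notin> ?f ` ?T"
      proof
        assume "N - m \<in> ?f ` ?T"
        then obtain x where x: "x \<in> ?T" "N - m = N - x" by (elim imageE)
        have "N - (N - m) = N - (N - x)" by (simp only: x(2))
        then have "m = x" using ff[of x] ff[of m] x(1) by (metis DiffD1 insertCI)
        then show False using x(1) N(3) by simp
      qed
      moreover have "m \<notin> ?T" "N - m \<notin> ?T" using N by auto
      ultimately show ?thesis using eq Nm by (metis insert_ident insert_iff)
    qed
    show ?thesis
    proof (cases "?f ` ?T = ?T")
      case s: True
      have "even (card ?T)" using IH s subset_pf_odd[of ?T ?J] insert(1) by auto
      moreover have "N - m < i" if i: "i \<in> ?T" for i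
      proof -
        have "N - i \<in> T" using i s by blast
        then show ?thesis using insert(2) N i by fastforce
      qed
      ultimately have "rank_sign (N - m) ?T = (1 :: 'a)" by (subst rank_sign_below) auto
      then show ?thesis using pf True s sym IH by simp
    qed (use pf True sym IH in simp)
  next
    case False
    have "?f ` insert m T \<noteq> insert m T" using False Nm by auto
    then show ?thesis using pf False by simp
  qed
qed simp

section \<open>The Pfaffian of the block matrix\<close>

context
  fixes n :: nat
begin

definition upper :: "nat set \<Rightarrow> nat set" where "upper S = (\<lambda>a. n + 1 + a) ` S"

definition lower :: "nat set \<Rightarrow> nat set" where "lower S = (\<lambda>a. n - a) ` S"

lemma upper_gt: "x \<in> upper S \<Longrightarrow> n < x" by (auto simp: upper_def)

lemma lower_le: "x \<in> lower S \<Longrightarrow> x \<le> n" by (auto simp: lower_def)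

lemma inj_lower: "S \<subseteq> {..n} \<Longrightarrow> inj_on (\<lambda>a. n - a) S"
  by (intro inj_onI) (metis diff_diff_cancel subsetD atMost_iff)

text \<open>For a in S count the larger positions that belong to S'. The position n + 1 + a sees the
  upper ones with b > a; the position n - a sees all \<open>card S'\<close> upper ones and the lower
  ones with b < a. Together these are \<open>2 * card S'\<close>.\<close>

lemma shuffle_sign_symmetric:
  assumes S: "S \<subseteq> {..n}" "S' \<subseteq> {..n}" "S \<inter> S' = {}"
  shows "shuffle_sign (upper S \<union> lower S) (upper S' \<union> lower S') = (1 :: 'a :: comm_ring_1)"
proof -
  let ?Z = "upper S' \<union> lower S'"
  have fin: "finite S" "finite S'" using S by (auto intro: finite_subset)
  then have fin': "finite (upper S)" "finite (lower S)" "finite (upper S')" "finite (lower S')"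
    by (auto simp: upper_def lower_def)
  have disj: "upper A \<inter> lower B = {}" for A B using upper_gt lower_le by fastforce
  have one: "rank_sign (n + 1 + a) ?Z * rank_sign (n - a) ?Z = (1 :: 'a)" if a: "a \<in> S" for a
  proof -
    have "rank_sign (n + 1 + a) (lower S') = (1 :: 'a)"
      by (rule rank_sign_above) (use lower_le in fastforce)
    moreover have "rank_sign (n - a) (upper S') = ((-1) ^ card S' :: 'a)"
    proof -
      have "rank_sign (n - a) (upper S') = ((-1) ^ card (upper S') :: 'a)"
        by (rule rank_sign_below) (use upper_gt in fastforce)
      also have "card (upper S') = card S'" unfolding upper_def by (rule card_image) (simp add: inj_on_def)
      finally show ?thesis .
    qed
    moreover have "rank_sign (n + 1 + a) (upper S') = (rank_sign a S' :: 'a)"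
    proof -
      have "strict_mono_on UNIV (\<lambda>a. n + 1 + a)" by (auto simp: strict_mono_on_def)
      then show ?thesis unfolding upper_def by (rule strict_mono_on_rank_sign) auto
    qed
    moreover have "rank_sign (n - a) (lower S') = ((-1) ^ card {b \<in> S'. b < a} :: 'a)"
    proof -
      have "{i \<in> lower S'. n - a < i} = (\<lambda>b. n - b) ` {b \<in> S'. b < a}"
        using S a unfolding lower_def by force
      moreover have "card ((\<lambda>b. n - b) ` {b \<in> S'. b < a}) = card {b \<in> S'. b < a}"
        by (rule card_image, rule inj_lower) (use S in auto)
      ultimately show ?thesis by (simp add: rank_sign_def)
    qed
    moreover have "card S' = card {b \<in> S'. b < a} + card {b \<in> S'. a < b}"
    proof -
      have "a \<notin> S'" using a S by auto
      then have "S' = {b \<in> S'. b < a} \<union> {b \<in> S'. a < b}" by (auto, metis nat_neq_iff)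
      then have "card S' = card ({b \<in> S'. b < a} \<union> {b \<in> S'. a < b})" by simp
      also have "\<dots> = card {b \<in> S'. b < a} + card {b \<in> S'. a < b}"
        by (rule card_Un_disjoint) (use fin in auto)
      finally show ?thesis .
    qed
    ultimately show ?thesis
      using rank_sign_Un[OF fin'(3,4) disj, where 'a = 'a] by (simp add: rank_sign_def[of a] minus_one_power_iff)
  qed
  have "shuffle_sign (upper S \<union> lower S) ?Z = (\<Prod>x\<in>upper S. rank_sign x ?Z) * (\<Prod>x\<in>lower S. (rank_sign x ?Z :: 'a))"
    unfolding shuffle_sign_def by (rule prod.union_disjoint[OF fin'(1,2) disj])
  also have "(\<Prod>x\<in>upper S. rank_sign x ?Z) = (\<Prod>a\<in>S. (rank_sign (n + 1 + a) ?Z :: 'a))"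
    unfolding upper_def[of S] by (subst prod.reindex) (auto simp: inj_on_def)
  also have "(\<Prod>x\<in>lower S. rank_sign x ?Z) = (\<Prod>a\<in>S. (rank_sign (n - a) ?Z :: 'a))"
    unfolding lower_def[of S] by (subst prod.reindex[OF inj_lower[OF S(1)]]) simp
  also have "(\<Prod>a\<in>S. rank_sign (n + 1 + a) ?Z) * (\<Prod>a\<in>S. (rank_sign (n - a) ?Z :: 'a)) = 1"
    unfolding prod.distrib[symmetric] by (rule prod.neutral) (use one in blast)
  finally show ?thesis .
qed

text \<open>In the formula for the Pfaffian of a sum, only the splitting into upper and lower
  positions avoids a zero row. The labels of R appear in reversed order, which produces the
  sign.\<close>

lemma subset_pf_block_diagonal:
  fixes Q R :: "nat \<Rightarrow> nat \<Rightarrow> 'a :: comm_ring_1"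
  assumes Q: "\<And>i j. Q i j = - Q j i" "\<And>i. Q i i = 0" and R: "\<And>i j. R i j = - R j i" "\<And>i. R i i = 0"
    and S: "S \<subseteq> {..n}"
  shows "subset_pf (\<lambda>x y. (if n < x \<and> n < y then Q (x - (n + 1)) (y - (n + 1)) else 0) +
      (if x \<le> n \<and> y \<le> n then R (n - x) (n - y) else 0)) (upper S \<union> lower S) =
    subset_pf Q S * ((-1) ^ (card S div 2) * subset_pf R S)"
proof -
  let ?X = "upper S \<union> lower S"
  let ?Q = "\<lambda>x y. if n < x \<and> n < y then Q (x - (n + 1)) (y - (n + 1)) else 0"
  let ?R = "\<lambda>x y. if x \<le> n \<and> y \<le> n then R (n - x) (n - y) else 0"
  have fin: "finite S" using S by (auto intro: finite_subset)
  then have fin': "finite (upper S)" "finite (lower S)" by (auto simp: upper_def lower_def)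
  have disj: "upper S \<inter> lower S = {}" using upper_gt lower_le by fastforce
  have skewQ: "?Q i j = - ?Q j i" "?Q i i = 0" for i j using Q(1)[of "i - (n + 1)" "j - (n + 1)"] Q(2) by auto
  have skewR: "?R i j = - ?R j i" "?R i i = 0" for i j using R(1)[of "n - i" "n - j"] R(2) by auto
  have "subset_pf (\<lambda>x y. ?Q x y + ?R x y) ?X =
      (\<Sum>Y\<in>Pow ?X. shuffle_sign Y (?X - Y) * subset_pf ?Q Y * subset_pf ?R (?X - Y))"
    by (rule subset_pf_add) (use fin' in auto)
  also have "\<dots> = (\<Sum>Y\<in>{upper S}. shuffle_sign Y (?X - Y) * subset_pf ?Q Y * subset_pf ?R (?X - Y))"
  proof (rule sum.mono_neutral_right)
    show "\<forall>Y\<in>Pow ?X - {upper S}. shuffle_sign Y (?X - Y) * subset_pf ?Q Y * subset_pf ?R (?X - Y) = 0"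
    proof
      fix Y assume Y: "Y \<in> Pow ?X - {upper S}"
      then have "finite Y" using fin' by (auto intro: finite_subset)
      from Y consider k where "k \<in> Y" "k \<in> lower S" | k where "k \<in> upper S" "k \<notin> Y" by blast
      then show "shuffle_sign Y (?X - Y) * subset_pf ?Q Y * subset_pf ?R (?X - Y) = 0"
      proof cases
        case 1
        have "subset_pf ?Q Y = 0"
          by (rule subset_pf_zero_row[OF skewQ \<open>finite Y\<close> 1(1)]) (use lower_le[OF 1(2)] in auto)
        then show ?thesis by simp
      next
        case 2
        have "subset_pf ?R (?X - Y) = 0"
          by (rule subset_pf_zero_row[OF skewR, where k = k]) (use fin' upper_gt[OF 2(1)] 2 in auto)
        then show ?thesis by simp
      qed
    qed
  qed (use fin' in auto)
  also have "?X - upper S = lower S" using disj by auto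
  then have "(\<Sum>Y\<in>{upper S}. shuffle_sign Y (?X - Y) * subset_pf ?Q Y * subset_pf ?R (?X - Y)) =
      shuffle_sign (upper S) (lower S) * subset_pf ?Q (upper S) * subset_pf ?R (lower S)" by simp
  also have "shuffle_sign (upper S) (lower S) = (1 :: 'a)"
    unfolding shuffle_sign_def
    by (rule prod.neutral) (use upper_gt lower_le in \<open>fastforce intro!: rank_sign_above\<close>)
  also have "subset_pf ?Q (upper S) = subset_pf Q S"
    unfolding upper_def by (subst subset_pf_image[OF fin]) (auto simp: strict_mono_on_def)
  also have "subset_pf ?R (lower S) = subset_pf (\<lambda>i j. R (n - i) (n - j)) (lower S)"
    by (rule subset_pf_cong[OF fin'(2)]) (use lower_le in auto)
  also have "\<dots> = (-1) ^ (card S div 2) * subset_pf R S"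
    unfolding lower_def by (rule subset_pf_reflect[OF R S])
  finally show ?thesis by simp
qed

text \<open>
  The index set of the block matrix is numbered backwards, so that decreasing order is the order of its
  rows: \<open>n + 1 + a\<close> is the label \<open>a\<close> of \<open>Q\<close>, and \<open>n - a\<close> the label \<open>a\<close> of \<open>R\<close>.
\<close>

lemma subset_pf_block:
  fixes Q R M :: "nat \<Rightarrow> nat \<Rightarrow> 'a :: comm_ring_1"
  assumes Q: "\<And>i j. Q i j = - Q j i" "\<And>i. Q i i = 0" and R: "\<And>i j. R i j = - R j i" "\<And>i. R i i = 0"
    and M: "\<And>x y. y < x \<Longrightarrow> x < 2 * n + 2 \<Longrightarrow> M x y =
      (if n < y then Q (x - (n + 1)) (y - (n + 1)) else if x \<le> n then R (n - x) (n - y)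
       else if x + y = 2 * n + 1 then 1 else 0)"
  shows "subset_pf M {..<2 * n + 2} =
    (\<Sum>S\<in>Pow {..n}. subset_pf Q S * ((-1) ^ (card S div 2) * subset_pf R S))"
proof -
  define N where "N = 2 * n + 1"
  let ?U = "{..N}" and ?E = "\<lambda>S. upper S \<union> lower S"
  let ?D = "\<lambda>x y. (if n < x \<and> n < y then Q (x - (n + 1)) (y - (n + 1)) else 0) +
      (if x \<le> n \<and> y \<le> n then R (n - x) (n - y) else 0)"
  let ?J = "\<lambda>x y. if x + y = N then 1 else 0 :: 'a"
  let ?t = "\<lambda>X. shuffle_sign X (?U - X) * subset_pf ?D X * subset_pf ?J (?U - X)"
  have E: "?E S \<subseteq> ?U" "?U - ?E S = ?E ({..n} - S)" "(\<lambda>x. N - x) ` ?E S = ?E S"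
      "{a. n + 1 + a \<in> ?E S} = S" if "S \<in> Pow {..n}" for S
  proof -
    have up: "x \<in> upper S \<longleftrightarrow> n < x \<and> x - (n + 1) \<in> S" for x S
      by (auto simp: upper_def image_iff intro!: bexI[of _ "x - Suc n"])
    have lo: "x \<in> lower S \<longleftrightarrow> x \<le> n \<and> n - x \<in> S" if "S \<subseteq> {..n}" for x S
      using that by (force simp: lower_def image_iff)
    show "?E S \<subseteq> ?U" "?U - ?E S = ?E ({..n} - S)" "{a. n + 1 + a \<in> ?E S} = S"
      using that by (auto simp: up lo N_def)
    have "(\<lambda>x. N - x) ` upper S = lower S" "(\<lambda>x. N - x) ` lower S = upper S"
      using that unfolding upper_def lower_def image_image by (auto simp: N_def intro!: image_cong)
    then show "(\<lambda>x. N - x) ` ?E S = ?E S" by auto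
  qed
  have "subset_pf M {..<2 * n + 2} = subset_pf (\<lambda>x y. ?D x y + ?J x y) ?U"
    unfolding N_def atMost_atLeast0 lessThan_atLeast0
    by (simp only: atLeastLessThanSuc_atLeastAtMost[symmetric], simp, rule subset_pf_cong) (auto simp: M)
  also have "\<dots> = sum ?t (Pow ?U)"
    by (rule subset_pf_add) simp
  also have "\<dots> = sum ?t (?E ` Pow {..n})"
  proof (rule sum.mono_neutral_right)
    show "?E ` Pow {..n} \<subseteq> Pow ?U" using E(1) by auto
    show "\<forall>X\<in>Pow ?U - ?E ` Pow {..n}. ?t X = 0"
    proof
      fix X assume X: "X \<in> Pow ?U - ?E ` Pow {..n}"
      \<comment> \<open>The Pfaffian of the anti-diagonal vanishes unless the complement of X is
        invariant under the reflection of the positions, and the invariant sets are exactly the sets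
        \<open>?E S\<close>.\<close>
      have "(\<lambda>x. N - x) ` (?U - X) \<noteq> ?U - X"
      proof
        assume sym: "(\<lambda>x. N - x) ` (?U - X) = ?U - X"
        have X': "N - x \<in> X \<longleftrightarrow> x \<in> X" if "x \<le> N" for x
        proof -
          have "N - y \<in> ?U - X" if "y \<in> ?U - X" for y using that sym by blast
          from this[of x] this[of "N - x"] show ?thesis using that by auto
        qed
        let ?S = "{a. a \<le> n \<and> n + 1 + a \<in> X}"
        have "X = ?E ?S"
        proof (intro equalityI subsetI)
          fix x assume x: "x \<in> X"
          then have xN: "x \<le> N" using X by auto
          show "x \<in> ?E ?S"
          proof (cases "n < x")
            case True
            then have "x = n + 1 + (x - (n + 1))" "x - (n + 1) \<in> ?S" using x xN by (auto simp: N_def)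
            then have "x \<in> upper ?S" unfolding upper_def by (rule image_eqI)
            then show ?thesis ..
          next
            case False
            then have "N - x = n + 1 + (n - x)" by (simp add: N_def)
            then have "x = n - (n - x)" "n - x \<in> ?S" using x X'[OF xN] False by auto
            then have "x \<in> lower ?S" unfolding lower_def by (rule image_eqI)
            then show ?thesis ..
          qed
        next
          fix x assume "x \<in> ?E ?S"
          then consider "x \<in> upper ?S" | a where "x = n - a" "a \<le> n" "n + 1 + a \<in> X"
            by (auto simp: lower_def)
          then show "x \<in> X"
          proof cases
            case 2
            then have "N - x = n + 1 + a" "x \<le> N" by (auto simp: N_def)
            then show ?thesis using X' 2 by metis
          qed (auto simp: upper_def)
        qed
        then show False using X by blast
      qed
      then have "subset_pf ?J (?U - X) = 0" by (subst subset_pf_antidiagonal) (auto simp: N_def)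
      then show "?t X = 0" by simp
    qed
  qed simp
  also have "\<dots> = (\<Sum>S\<in>Pow {..n}. ?t (?E S))"
  proof -
    have "inj_on ?E (Pow {..n})"
      by (rule inj_on_inverseI[where g = "\<lambda>X. {a. n + 1 + a \<in> X}"]) (rule E(4))
    then show ?thesis by (simp only: sum.reindex o_def)
  qed
  also have "\<dots> = (\<Sum>S\<in>Pow {..n}. subset_pf Q S * ((-1) ^ (card S div 2) * subset_pf R S))"
  proof (rule sum.cong)
    fix S assume S: "S \<in> Pow {..n}"
    have S': "{..n} - S \<in> Pow {..n}" by auto
    have oddN: "odd N" by (simp add: N_def)
    have "subset_pf ?J (?U - ?E S) = 1"
      unfolding E(2)[OF S] by (subst subset_pf_antidiagonal[OF E(1)[OF S']]) (simp_all only: E(3)[OF S'] oddN if_True simp_thms)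
    moreover have "shuffle_sign (?E S) (?U - ?E S) = (1 :: 'a)"
      unfolding E(2)[OF S] by (rule shuffle_sign_symmetric) (use S in auto)
    moreover have "subset_pf ?D (?E S) = subset_pf Q S * ((-1) ^ (card S div 2) * subset_pf R S)"
      by (rule subset_pf_block_diagonal[OF Q R]) (use S in auto)
    ultimately show "?t (?E S) = subset_pf Q S * ((-1) ^ (card S div 2) * subset_pf R S)" by simp
  qed simp
  finally show ?thesis .
qed

end

text \<open>Exactly one of T and \<open>insert 0 T\<close> has even size: the subsets of even size
  are the augmented strict partitions.\<close>

lemma sum_Pow_aug_pf:
  fixes n :: nat
  assumes "\<And>S. S \<subseteq> {..n} \<Longrightarrow> odd (card S) \<Longrightarrow> f S = 0"
  shows "sum f (Pow {..n}) = (\<Sum>T\<in>Pow {1..n}. if even (card T) then f T else f (insert 0 T))"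
proof -
  have "{..n} = insert 0 {1..n}" by auto
  then have "sum f (Pow {..n}) = (\<Sum>T\<in>Pow {1..n}. f T + f (insert 0 T))"
    by (simp add: sum_Pow_insert sum.distrib)
  also have "\<dots> = (\<Sum>T\<in>Pow {1..n}. if even (card T) then f T else f (insert 0 T))"
  proof (rule sum.cong)
    fix T assume T: "T \<in> Pow {1..n}"
    then have "finite T" "0 \<notin> T" by (auto intro: finite_subset)
    moreover have "T \<subseteq> {..n}" "insert 0 T \<subseteq> {..n}" using T by auto
    ultimately show "f T + f (insert 0 T) = (if even (card T) then f T else f (insert 0 T))"
      using assms[of T] assms[of "insert 0 T"] by auto
  qed simp
  finally show ?thesis .
qed

section \<open>Derivations of the series ring\<close>

lemma coeff_zero [simp]: "coeff 0 m = 0"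
  by (simp add: zero_tseries_def)

lemma coeff_one: "coeff 1 m = (if m = 0 then 1 else 0)"
  by (simp add: one_tseries_def)

lemma coeff_add [simp]: "coeff (f + g) m = coeff f m + coeff g m"
  by (simp add: plus_tseries_def)

lemma coeff_diff [simp]: "coeff (f - g) m = coeff f m - coeff g m"
  by (simp add: minus_tseries_def)

lemma coeff_uminus [simp]: "coeff (- f) m = - coeff f m"
  by (simp add: uminus_tseries_def)

lemma coeff_sum [simp]: "coeff (sum F I) m = (\<Sum>i\<in>I. coeff (F i) m)"
  by (induction I rule: infinite_finite_induct) auto

lemma coeff_mult: "coeff (f * g) m = (\<Sum>(a, b)\<in>splits m. coeff f a * coeff g b)"
  by (simp add: times_tseries_def)

lemma coeff_tconst: "coeff (tconst c) m = (if m = 0 then c else 0)"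
  by (simp add: tconst_def)

lemma coeff_tconst_mult [simp]: "coeff (tconst c * f) m = c * coeff f m"
proof -
  have "coeff (tconst c * f) m = (\<Sum>(a, b)\<in>splits m. coeff (tconst c) a * coeff f b)"
    by (rule coeff_mult)
  also have "\<dots> = (\<Sum>(a, b)\<in>splits m. c * (coeff 1 a * coeff f b))"
    by (rule sum.cong) (auto simp: coeff_tconst coeff_one)
  also have "\<dots> = c * coeff (1 * f) m"
    unfolding coeff_mult by (simp add: sum_distrib_left case_prod_beta)
  finally show ?thesis by simp
qed

lemma tconst_0 [simp]: "tconst 0 = 0"
  by (rule tseries_eqI) (simp add: coeff_tconst)

lemma tconst_1 [simp]: "tconst 1 = 1"
  by (rule tseries_eqI) (simp add: coeff_tconst coeff_one)

lemma tconst_add: "tconst (a + b) = tconst a + tconst b"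
  by (rule tseries_eqI) (simp add: coeff_tconst)

lemma tconst_minus: "tconst (- a) = - tconst a"
  by (rule tseries_eqI) (simp add: coeff_tconst)

lemma tconst_diff: "tconst (a - b) = tconst a - tconst b"
  by (rule tseries_eqI) (simp add: coeff_tconst)

lemma tconst_mult: "tconst (a * b) = tconst a * tconst b"
  by (rule tseries_eqI) (simp add: coeff_tconst)

lemma tconst_mult_tconst [simp]: "tconst a * (tconst b * f) = tconst (a * b) * f"
  by (simp add: tconst_mult mult.assoc)

lemma tconst_sum: "tconst (sum c I) = (\<Sum>i\<in>I. tconst (c i))"
  by (induction I rule: infinite_finite_induct) (auto simp: tconst_add)

lemma tconst_minus_one_power: "tconst ((-1) ^ n) = (-1) ^ n"
  by (induction n) (simp_all add: tconst_minus)

lemma of_nat_tseries: "of_nat n = tconst (of_nat n)"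
  by (induction n) (simp_all add: tconst_add)

lemma tconst_mult_cancel: "c \<noteq> 0 \<Longrightarrow> tconst c * f = tconst c * g \<longleftrightarrow> f = g"
  by (metis (no_types) mult_1 nonzero_eq_divide_eq tconst_1 tconst_mult_tconst times_divide_eq_left)

section \<open>Weights and homogeneous series\<close>

lemma weight_eq:
  assumes "finite S" "Poly_Mapping.keys m \<subseteq> S"
  shows "weight m = (\<Sum>i\<in>S. (2 * i + 1) * Poly_Mapping.lookup m i)"
  unfolding weight_def by (rule sum.mono_neutral_left) (use assms in \<open>auto simp: in_keys_iff\<close>)

lemma weight_0 [simp]: "weight 0 = 0"
  by (simp add: weight_def)

lemma weight_add [simp]: "weight (m + n) = weight m + weight n"
proof -
  let ?S = "Poly_Mapping.keys m \<union> Poly_Mapping.keys n"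
  have "Poly_Mapping.keys (m + n) \<subseteq> ?S" by (rule Poly_Mapping.keys_add)
  then have "weight (m + n) = (\<Sum>i\<in>?S. (2 * i + 1) * Poly_Mapping.lookup (m + n) i)"
    by (intro weight_eq) auto
  also have "\<dots> = weight m + weight n"
    using weight_eq[of ?S m] weight_eq[of ?S n] by (simp add: lookup_add algebra_simps sum.distrib)
  finally show ?thesis .
qed

lemma weight_single [simp]: "weight (Poly_Mapping.single i n) = (2 * i + 1) * n"
  by (subst weight_eq[of "{i}"]) auto

lemma weight_eq_0_iff: "weight m = 0 \<longleftrightarrow> m = 0"
proof
  assume "weight m = 0"
  then have "Poly_Mapping.lookup m i = 0" for i by (auto simp: weight_def in_keys_iff)
  then show "m = 0" by (intro poly_mapping_eqI) simp
qed simp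

lemma odd_div_2: "odd (k :: nat) \<Longrightarrow> 2 * (k div 2) + 1 = k"
  by (metis odd_two_times_div_two_succ)

text \<open>The degree is an integer so that it may be lowered freely; at a negative degree the
  condition is vacuous.\<close>

definition eq_at :: "int \<Rightarrow> tseries \<Rightarrow> tseries \<Rightarrow> bool" where
  "eq_at d f g \<longleftrightarrow> (\<forall>m. int (weight m) = d \<longrightarrow> coeff f m = coeff g m)"

definition homogeneous :: "nat \<Rightarrow> tseries \<Rightarrow> bool" where
  "homogeneous d f \<longleftrightarrow> (\<forall>m. coeff f m \<noteq> 0 \<longrightarrow> weight m = d)"

text \<open>Only finitely many monomials have weight at most d, so these series are polynomials, and
  on them the sums defining the fermions are finite.\<close>

definition weight_bounded :: "nat \<Rightarrow> tseries \<Rightarrow> bool" where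
  "weight_bounded d f \<longleftrightarrow> (\<forall>m. coeff f m \<noteq> 0 \<longrightarrow> weight m \<le> d)"

lemma weight_bounded_eq_at: "weight_bounded d f \<longleftrightarrow> (\<forall>e > int d. eq_at e f 0)"
proof
  assume R: "\<forall>e > int d. eq_at e f 0"
  show "weight_bounded d f"
    unfolding weight_bounded_def
  proof (intro allI impI, rule ccontr)
    fix m assume "coeff f m \<noteq> 0" "\<not> weight m \<le> d"
    then show False using R[rule_format, of "int (weight m)"] by (auto simp: eq_at_def)
  qed
next
  assume L: "weight_bounded d f"
  show "\<forall>e > int d. eq_at e f 0"
    unfolding eq_at_def
  proof (intro allI impI)
    fix e m assume "int d < e" "int (weight m) = e"
    then have "\<not> weight m \<le> d" by simp
    then show "coeff f m = coeff 0 m" using L by (auto simp: weight_bounded_def)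
  qed
qed

lemma weight_bounded_mono: "weight_bounded d f \<Longrightarrow> d \<le> e \<Longrightarrow> weight_bounded e f"
  by (auto simp: weight_bounded_def intro: order_trans)

lemma weight_bounded_homogeneous: "homogeneous d f \<Longrightarrow> weight_bounded d f"
  by (auto simp: homogeneous_def weight_bounded_def)

lemma coeff_mult_nonzeroE:
  assumes "coeff (f * g) m \<noteq> 0"
  obtains a b where "coeff f a \<noteq> 0" "coeff g b \<noteq> 0" "a + b = m"
proof -
  obtain x where x: "x \<in> splits m" "(case x of (a, b) \<Rightarrow> coeff f a * coeff g b) \<noteq> 0"
    using assms unfolding coeff_mult by (rule sum.not_neutral_contains_not_neutral)
  obtain a b where "x = (a, b)" by (cases x)
  with x that[of a b] show ?thesis by (auto simp: splits_def)
qed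

lemma weight_bounded_mult: "weight_bounded d f \<Longrightarrow> weight_bounded e g \<Longrightarrow> weight_bounded (d + e) (f * g)"
  unfolding weight_bounded_def by (metis add_mono coeff_mult_nonzeroE weight_add)

lemma homogeneous_mult: "homogeneous d f \<Longrightarrow> homogeneous e g \<Longrightarrow> homogeneous (d + e) (f * g)"
  unfolding homogeneous_def by (metis coeff_mult_nonzeroE weight_add)

lemma homogeneous_sum:
  assumes "\<And>i. i \<in> I \<Longrightarrow> homogeneous d (F i)"
  shows "homogeneous d (sum F I)"
  unfolding homogeneous_def
proof (intro allI impI)
  fix m assume "coeff (sum F I) m \<noteq> 0"
  then obtain i where "i \<in> I" "coeff (F i) m \<noteq> 0"
    unfolding coeff_sum by (rule sum.not_neutral_contains_not_neutral)
  then show "weight m = d" using assms by (auto simp: homogeneous_def)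
qed

lemma homogeneous_uminus [simp]: "homogeneous d (- f) \<longleftrightarrow> homogeneous d f"
  by (simp add: homogeneous_def)

lemma homogeneous_0 [simp]: "homogeneous d 0"
  by (simp add: homogeneous_def)

lemma homogeneous_1 [simp]: "homogeneous 0 1"
  by (simp add: homogeneous_def coeff_one)

lemma homogeneous_tconst_mult: "homogeneous d f \<Longrightarrow> homogeneous d (tconst c * f)"
  by (simp add: homogeneous_def)

lemma homogeneous_tvar: "odd k \<Longrightarrow> homogeneous k (tvar k)"
  by (auto simp: homogeneous_def tvar_def odd_div_2 split: if_splits)

lemma weight_bounded_sum:
  assumes "\<And>i. i \<in> I \<Longrightarrow> weight_bounded d (F i)"
  shows "weight_bounded d (sum F I)"
  unfolding weight_bounded_def
proof (intro allI impI)
  fix m assume "coeff (sum F I) m \<noteq> 0"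
  then obtain i where "i \<in> I" "coeff (F i) m \<noteq> 0"
    unfolding coeff_sum by (rule sum.not_neutral_contains_not_neutral)
  then show "weight m \<le> d" using assms by (auto simp: weight_bounded_def)
qed

lemma weight_bounded_tconst_mult: "weight_bounded d f \<Longrightarrow> weight_bounded d (tconst c * f)"
  by (simp add: weight_bounded_def)

lemma remove_single:
  "Poly_Mapping.lookup m i \<noteq> 0 \<Longrightarrow> m - Poly_Mapping.single i (1 :: nat) + Poly_Mapping.single i 1 = m"
  by (rule poly_mapping_eqI) (auto simp: lookup_add lookup_minus lookup_single when_def)

lemma coeff_tderiv: "coeff (tderiv k f) m =
    of_nat (Poly_Mapping.lookup m (k div 2) + 1) * coeff f (m + Poly_Mapping.single (k div 2) 1)"
  by (simp add: tderiv_def)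

lemma tderiv_add: "tderiv k (f + g) = tderiv k f + tderiv k g"
  by (rule tseries_eqI) (simp add: coeff_tderiv algebra_simps)

lemma tderiv_tconst_mult: "tderiv k (tconst c * f) = tconst c * tderiv k f"
  by (rule tseries_eqI) (simp add: coeff_tderiv mult.left_commute)

lemma tderiv_0 [simp]: "tderiv k 0 = 0"
  by (rule tseries_eqI) (simp add: coeff_tderiv)

lemma tderiv_diff: "tderiv k (f - g) = tderiv k f - tderiv k g"
  by (rule tseries_eqI) (simp add: coeff_tderiv algebra_simps)

lemma tderiv_sum: "tderiv k (sum F I) = (\<Sum>i\<in>I. tderiv k (F i))"
  by (induction I rule: infinite_finite_induct) (auto simp: tderiv_add)

lemma tderiv_one [simp]: "tderiv k 1 = 0"
proof (rule tseries_eqI)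
  fix m
  have "m + Poly_Mapping.single (k div 2) (1 :: nat) \<noteq> 0"
    by (metis add_is_0 lookup_add lookup_single_eq lookup_zero one_neq_zero)
  then show "coeff (tderiv k 1) m = coeff 0 m" by (simp add: coeff_tderiv coeff_one)
qed

lemma tderiv_commute: "tderiv k (tderiv l f) = tderiv l (tderiv k f)"
proof (rule tseries_eqI)
  fix m
  show "coeff (tderiv k (tderiv l f)) m = coeff (tderiv l (tderiv k f)) m"
    by (cases "k div 2 = l div 2") (simp_all add: coeff_tderiv lookup_add lookup_single ac_simps)
qed

lemma tderiv_mult: "tderiv k (f * g) = tderiv k f * g + f * tderiv k g"
proof (rule tseries_eqI)
  fix m
  let ?i = "k div 2"
  let ?e = "Poly_Mapping.single ?i (1 :: nat)"
  let ?l = "\<lambda>a. Poly_Mapping.lookup a ?i"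
  have half: "(\<Sum>(a, b)\<in>splits (m + ?e). of_nat (?l a) * coeff f a * coeff g b) = coeff (tderiv k f * g) m"
    for f g
  proof -
    have "(\<Sum>(a, b)\<in>splits (m + ?e). of_nat (?l a) * coeff f a * coeff g b) =
        (\<Sum>(a, b)\<in>{(a, b) \<in> splits (m + ?e). ?l a \<noteq> 0}. of_nat (?l a) * coeff f a * coeff g b)"
      by (rule sum.mono_neutral_right) auto
    also have "\<dots> = (\<Sum>(a, b)\<in>splits m. of_nat (?l a + 1) * coeff f (a + ?e) * coeff g b)"
    proof (rule sum.reindex_bij_witness[where i = "\<lambda>(a, b). (a + ?e, b)" and j = "\<lambda>(a, b). (a - ?e, b)"])
      fix x assume "x \<in> {(a, b) \<in> splits (m + ?e). ?l a \<noteq> 0}"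
      then obtain a b where x [simp]: "x = (a, b)" and ab: "a + b = m + ?e" "?l a \<noteq> 0"
        by (auto simp: splits_def)
      note a = remove_single[OF ab(2)]
      then have "a - ?e + b + ?e = m + ?e" using ab(1) by (metis add.assoc add.commute)
      then have "a - ?e + b = m" by simp
      then show "(case x of (a, b) \<Rightarrow> (a - ?e, b)) \<in> splits m"
        "(case case x of (a, b) \<Rightarrow> (a - ?e, b) of (a, b) \<Rightarrow> (a + ?e, b)) = x"
        using a by (auto simp: splits_def)
      have "?l a = ?l (a - ?e) + 1" using ab(2) by (simp add: lookup_minus)
      then show "(case case x of (a, b) \<Rightarrow> (a - ?e, b) of (a, b) \<Rightarrow> of_nat (?l a + 1) * coeff f (a + ?e) * coeff g b) =
          (case x of (a, b) \<Rightarrow> of_nat (?l a) * coeff f a * coeff g b)"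
        using a by simp
    qed (auto simp: splits_def lookup_add ac_simps)
    also have "\<dots> = coeff (tderiv k f * g) m"
      unfolding coeff_mult by (rule sum.cong) (auto simp: coeff_tderiv algebra_simps)
    finally show ?thesis .
  qed
  have "coeff (tderiv k (f * g)) m = (\<Sum>(a, b)\<in>splits (m + ?e). of_nat (?l m + 1) * (coeff f a * coeff g b))"
    by (simp add: coeff_tderiv coeff_mult sum_distrib_left case_prod_beta)
  also have "\<dots> = (\<Sum>(a, b)\<in>splits (m + ?e). of_nat (?l a) * coeff f a * coeff g b) +
      (\<Sum>(a, b)\<in>splits (m + ?e). of_nat (?l b) * coeff g b * coeff f a)"
    unfolding sum.distrib[symmetric]
  proof (rule sum.cong, simp, clarify)
    fix a b assume "(a, b) \<in> splits (m + ?e)"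
    then have "?l a + ?l b = ?l (m + ?e)" by (auto simp: splits_def simp flip: lookup_add)
    then have "of_nat (?l m + 1) = (of_nat (?l a) + of_nat (?l b) :: complex)"
      by (simp add: lookup_add flip: of_nat_add)
    then show "of_nat (?l m + 1) * (coeff f a * coeff g b) =
        of_nat (?l a) * coeff f a * coeff g b + of_nat (?l b) * coeff g b * coeff f a"
      by (simp only: distrib_right distrib_left mult_ac)
  qed
  also have "(\<Sum>(a, b)\<in>splits (m + ?e). of_nat (?l b) * coeff g b * coeff f a) =
      (\<Sum>(a, b)\<in>splits (m + ?e). of_nat (?l a) * coeff g a * coeff f b)"
    by (rule sum.reindex_bij_witness[where i = "\<lambda>(a, b). (b, a)" and j = "\<lambda>(a, b). (b, a)"])
       (auto simp: splits_def add.commute)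
  finally show "coeff (tderiv k (f * g)) m = coeff (tderiv k f * g + f * tderiv k g) m"
    by (simp only: half coeff_add mult.commute[of f])
qed

lemma tderiv_tvar:
  assumes "odd k" "odd l"
  shows "tderiv k (tvar l) = (if k = l then 1 else 0)"
proof (rule tseries_eqI)
  fix m :: monomial
  have kl: "k div 2 = l div 2 \<longleftrightarrow> k = l" using assms by (metis odd_div_2)
  show "coeff (tderiv k (tvar l)) m = coeff (if k = l then 1 else 0) m"
  proof (cases "k = l")
    case False
    have "m + Poly_Mapping.single (k div 2) 1 \<noteq> Poly_Mapping.single (l div 2) (1 :: nat)"
    proof
      assume "m + Poly_Mapping.single (k div 2) 1 = Poly_Mapping.single (l div 2) (1 :: nat)"
      then have "Poly_Mapping.lookup (m + Poly_Mapping.single (k div 2) 1) (k div 2) = Poly_Mapping.lookup (Poly_Mapping.single (l div 2) (1 :: nat)) (k div 2)"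
        by simp
      then show False using False kl by (simp add: lookup_add lookup_single when_def)
    qed
    then show ?thesis using False by (simp add: coeff_tderiv tvar_def)
  qed (auto simp: coeff_tderiv tvar_def coeff_one)
qed

lemma tderiv_eq_at:
  assumes "eq_at d f g" "odd k"
  shows "eq_at (d - int k) (tderiv k f) (tderiv k g)"
proof -
  have "int (2 * (k div 2) + 1) = int k" using odd_div_2[OF assms(2)] by simp
  then show ?thesis using assms(1) by (auto simp: eq_at_def coeff_tderiv)
qed

lemma coeff_tvar_mult:
  "coeff (tvar k * f) m = (if Poly_Mapping.lookup m (k div 2) = 0 then 0
    else coeff f (m - Poly_Mapping.single (k div 2) 1))"
proof -
  let ?e = "Poly_Mapping.single (k div 2) (1 :: nat)"
  have "coeff (tvar k * f) m = (\<Sum>(a, b)\<in>{(a, b) \<in> splits m. a = ?e}. coeff f b)"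
    unfolding coeff_mult by (rule sum.mono_neutral_cong_right) (auto simp: tvar_def split: if_split_asm)
  also have "{(a, b) \<in> splits m. a = ?e} =
      (if Poly_Mapping.lookup m (k div 2) = 0 then {} else {(?e, m - ?e)})"
    using remove_single[of m "k div 2"] by (auto simp: splits_def lookup_add add.commute)
  finally show ?thesis by simp
qed

text \<open>Euler's identity for the grading: \<open>t_k\<close> times the derivative by
  \<open>t_k\<close> multiplies a monomial by its exponent of \<open>t_k\<close>. Variables with k >
  d do not occur in degree d.\<close>

lemma euler_homogeneous:
  assumes "homogeneous d f"
  shows "tconst (of_nat d) * f = (\<Sum>k | k \<le> d \<and> odd k. tconst (of_nat k) * (tvar k * tderiv k f))"
proof (rule tseries_eqI)
  fix m :: monomial
  let ?l = "\<lambda>k. Poly_Mapping.lookup m (k div 2)"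
  have "coeff (tvar k * tderiv k f) m = of_nat (?l k) * coeff f m" for k
    using remove_single[of m "k div 2"] by (simp add: coeff_tvar_mult coeff_tderiv lookup_minus of_nat_diff)
  then have "coeff (\<Sum>k | k \<le> d \<and> odd k. tconst (of_nat k) * (tvar k * tderiv k f)) m =
      of_nat (\<Sum>k | k \<le> d \<and> odd k. k * ?l k) * coeff f m"
    by (simp add: sum_distrib_right mult.assoc)
  moreover have "(\<Sum>k | k \<le> d \<and> odd k. k * ?l k) = d" if "coeff f m \<noteq> 0"
  proof -
    have d: "d = weight m" using assms that by (auto simp: homogeneous_def)
    have "2 * i + 1 \<le> d" if "i \<in> Poly_Mapping.keys m" for i
    proof -
      have "(2 * i + 1) * 1 \<le> (2 * i + 1) * Poly_Mapping.lookup m i"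
        using that by (intro mult_le_mono2) (simp add: in_keys_iff Suc_le_eq)
      also have "\<dots> \<le> d" unfolding d weight_def using that by (intro member_le_sum) auto
      finally show ?thesis by simp
    qed
    then have "weight m = (\<Sum>i | 2 * i + 1 \<le> d. (2 * i + 1) * Poly_Mapping.lookup m i)"
      by (intro weight_eq) (auto intro: finite_subset[of _ "{..d}"])
    also have "\<dots> = (\<Sum>k | k \<le> d \<and> odd k. k * ?l k)"
      by (rule sum.reindex_bij_witness[where i = "\<lambda>k. k div 2" and j = "\<lambda>i. 2 * i + 1"]) (auto simp: odd_div_2)
    finally show ?thesis using d by simp
  qed
  ultimately show "coeff (tconst (of_nat d) * f) m =
      coeff (\<Sum>k | k \<le> d \<and> odd k. tconst (of_nat k) * (tvar k * tderiv k f)) m"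
    by (cases "coeff f m = 0") simp_all
qed

lemma homogeneous_tderiv:
  assumes "homogeneous d f" "odd k"
  shows "homogeneous (d - k) (tderiv k f)"
  using assms odd_div_2[OF assms(2)] by (fastforce simp: homogeneous_def coeff_tderiv)

text \<open>Euler's identity, divided by d, expresses a series of degree d > 0 through products of
  some \<open>t_k\<close> with series of smaller degree. Operator identities known on 1 are extended
  in this way.\<close>

lemma homogeneous_induct [consumes 1, case_names one mult sum scale]:
  assumes "homogeneous d f" and one: "P 1"
    and mult: "\<And>k d f. odd k \<Longrightarrow> homogeneous d f \<Longrightarrow> P f \<Longrightarrow> P (tvar k * f)"
    and sum: "\<And>F I. finite I \<Longrightarrow> (\<And>i. i \<in> I \<Longrightarrow> P (F i :: tseries)) \<Longrightarrow> P (sum F (I :: nat set))"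
    and scale: "\<And>c f. P f \<Longrightarrow> P (tconst c * f)"
  shows "P f"
  using \<open>homogeneous d f\<close>
proof (induction d arbitrary: f rule: less_induct)
  case (less d)
  show ?case
  proof (cases "d = 0")
    case True
    then have "f = tconst (coeff f 0) * 1"
      using less.prems by (intro tseries_eqI) (auto simp: homogeneous_def weight_eq_0_iff coeff_tconst)
    then show ?thesis using scale[OF one] by metis
  next
    case False
    have "P (\<Sum>k | k \<le> d \<and> odd k. tconst (of_nat k) * (tvar k * tderiv k f))"
    proof (intro sum scale)
      fix k assume "k \<in> {k. k \<le> d \<and> odd k}"
      then have k: "odd k" and "homogeneous (d - k) (tderiv k f)" "d - k < d"
        using homogeneous_tderiv[OF less.prems, of k] False odd_pos[of k] by auto
      then show "P (tvar k * tderiv k f)" by (metis mult less.IH)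
    qed simp
    then have "P (tconst (1 / of_nat d) * (tconst (of_nat d) * f))"
      unfolding euler_homogeneous[OF less.prems] by (rule scale)
    then show ?thesis using False by simp
  qed
qed

section \<open>The exponential of the derivations through its recursion\<close>

definition odds :: "nat \<Rightarrow> nat set" where
  "odds j = {k. k \<le> j \<and> odd k}"

lemma finite_odds [simp]: "finite (odds j)"
  by (simp add: odds_def)

lemma oddsD: "k \<in> odds j \<Longrightarrow> 0 < k" "k \<in> odds j \<Longrightarrow> k \<le> j" "k \<in> odds j \<Longrightarrow> odd k"
  by (simp_all add: odds_def odd_pos)

lemma odds_0 [simp]: "odds 0 = {}"
  using oddsD(1,2)[of _ 0] by fastforce

lemma sum_odds_swap:
  "(\<Sum>k\<in>odds j. \<Sum>l\<in>odds (j - k). g k l) = (\<Sum>l\<in>odds j. \<Sum>k\<in>odds (j - l). g k l)"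
proof -
  have "(\<Sum>k\<in>odds j. \<Sum>l\<in>odds (j - k). g k l) = (\<Sum>(k, l)\<in>Sigma (odds j) (\<lambda>k. odds (j - k)). g k l)"
    by (subst sum.Sigma) auto
  also have "\<dots> = (\<Sum>(l, k)\<in>Sigma (odds j) (\<lambda>l. odds (j - l)). g k l)"
    by (rule sum.reindex_bij_witness[where i = "\<lambda>(a, b). (b, a)" and j = "\<lambda>(a, b). (b, a)"])
       (auto simp: odds_def)
  also have "\<dots> = (\<Sum>l\<in>odds j. \<Sum>k\<in>odds (j - l). g k l)"
    by (subst sum.Sigma) auto
  finally show ?thesis .
qed

lemma deriv_op_nth: "deriv_op F $ j = (\<Sum>k\<in>odds j. tconst (-2 / of_nat k) * tderiv k (F $ (j - k)))"
  by (simp add: deriv_op_def odds_def)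

lemma deriv_op_power_order: "j < n \<Longrightarrow> (deriv_op ^^ n) F $ j = 0"
proof (induction n arbitrary: j)
  case (Suc n)
  have "(deriv_op ^^ n) F $ (j - k) = 0" if "k \<in> odds j" for k
    using oddsD[OF that] Suc.prems by (intro Suc.IH) auto
  then show ?case by (simp add: deriv_op_nth)
qed simp

text \<open>
  The operator \<open>-2 \<Sum>\<^sub>k w^k/k \<partial>/\<partial>t\<^sub>k\<close> commutes with its derivative \<open>w d/dw\<close>; hence the power rule
  holds, and with it the recursion of Newton's identities for its exponential.
\<close>

lemma deriv_op_power_rule:
  "tconst (of_nat j) * (deriv_op ^^ Suc n) (fps_const f) $ j =
    (\<Sum>k\<in>odds j. tconst (-2 * of_nat (Suc n)) * tderiv k ((deriv_op ^^ n) (fps_const f) $ (j - k)))"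
proof (induction n arbitrary: j)
  case 0
  have "tconst (of_nat j) * (deriv_op ^^ Suc 0) (fps_const f) $ j =
      (\<Sum>k\<in>odds j. tconst (of_nat j * (-2 / of_nat k)) * tderiv k (fps_const f $ (j - k)))"
    by (simp add: deriv_op_nth sum_distrib_left)
  also have "\<dots> = (\<Sum>k\<in>odds j. tconst (-2 * of_nat (Suc 0)) * tderiv k (fps_const f $ (j - k)))"
  proof (rule sum.cong)
    fix k assume "k \<in> odds j"
    then show "tconst (of_nat j * (-2 / of_nat k)) * tderiv k (fps_const f $ (j - k)) =
        tconst (-2 * of_nat (Suc 0)) * tderiv k (fps_const f $ (j - k))"
      using oddsD[of k j] by (cases "k = j") auto
  qed simp
  finally show ?case by simp
next
  case (Suc n)
  let ?G = "\<lambda>n. (deriv_op ^^ n) (fps_const f)"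
  have "tconst (of_nat j) * ?G (Suc (Suc n)) $ j =
      (\<Sum>k\<in>odds j. tconst (of_nat j * (-2 / of_nat k)) * tderiv k (?G (Suc n) $ (j - k)))"
    unfolding funpow.simps(2)[of "Suc n"] o_apply by (simp only: deriv_op_nth sum_distrib_left tconst_mult_tconst)
  \<comment> \<open>Since j / k = (j - k) / k + 1, one part falls under the induction hypothesis and
    the other is one more summand of the desired shape.\<close>
  also have "\<dots> = (\<Sum>k\<in>odds j. tconst (-2 / of_nat k) * tderiv k (tconst (of_nat (j - k)) * ?G (Suc n) $ (j - k))) +
      (\<Sum>k\<in>odds j. tconst (-2) * tderiv k (?G (Suc n) $ (j - k)))"
    unfolding sum.distrib[symmetric]
  proof (rule sum.cong)
    fix k assume "k \<in> odds j"
    then have k: "k \<le> j" "k \<noteq> 0" using oddsD[of k j] by auto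
    then have "of_nat j * (-2 / of_nat k) = (-2 / of_nat k) * of_nat (j - k) + (-2 :: complex)"
      by (simp add: of_nat_diff field_simps)
    then show "tconst (of_nat j * (-2 / of_nat k)) * tderiv k (?G (Suc n) $ (j - k)) =
        tconst (-2 / of_nat k) * tderiv k (tconst (of_nat (j - k)) * ?G (Suc n) $ (j - k)) +
        tconst (-2) * tderiv k (?G (Suc n) $ (j - k))"
      by (simp only: tderiv_tconst_mult tconst_mult_tconst tconst_add distrib_right)
  qed simp
  also have "(\<Sum>k\<in>odds j. tconst (-2 / of_nat k) * tderiv k (tconst (of_nat (j - k)) * ?G (Suc n) $ (j - k))) =
      (\<Sum>k\<in>odds j. \<Sum>l\<in>odds (j - k). tconst (-2 / of_nat k * (-2 * of_nat (Suc n))) * tderiv k (tderiv l (?G n $ (j - k - l))))"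
    unfolding Suc.IH by (simp only: tderiv_sum tderiv_tconst_mult sum_distrib_left tconst_mult_tconst)
  also have "\<dots> = (\<Sum>l\<in>odds j. \<Sum>k\<in>odds (j - l). tconst (-2 / of_nat k * (-2 * of_nat (Suc n))) * tderiv k (tderiv l (?G n $ (j - k - l))))"
    by (rule sum_odds_swap)
  also have "\<dots> = (\<Sum>l\<in>odds j. tconst (-2 * of_nat (Suc n)) * tderiv l (?G (Suc n) $ (j - l)))"
    unfolding funpow.simps(2)[of n] o_apply deriv_op_nth
    by (simp only: tderiv_sum tderiv_tconst_mult sum_distrib_left tconst_mult_tconst mult.commute[of "-2 / _"]
          tderiv_commute[of _ _ "?G n $ _"] diff_commute[of j])
  also have "\<dots> + (\<Sum>k\<in>odds j. tconst (-2) * tderiv k (?G (Suc n) $ (j - k))) =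
      (\<Sum>k\<in>odds j. tconst (-2 * of_nat (Suc (Suc n))) * tderiv k (?G (Suc n) $ (j - k)))"
    unfolding sum.distrib[symmetric] distrib_right[symmetric] tconst_add[symmetric]
    by (simp add: algebra_simps)
  finally show ?case .
qed

lemma exp_deriv_0 [simp]: "exp_deriv 0 f = f"
  by (simp add: exp_deriv_def)

lemma exp_deriv_newton:
  "tconst (of_nat j) * exp_deriv j f = tconst (-2) * (\<Sum>k\<in>odds j. tderiv k (exp_deriv (j - k) f))"
proof (cases j)
  case 0
  then show ?thesis by simp
next
  case (Suc i)
  let ?G = "\<lambda>n. (deriv_op ^^ n) (fps_const f)"
  have "tconst (of_nat j) * exp_deriv j f = (\<Sum>n\<le>j. tconst (1 / fact n) * (tconst (of_nat j) * ?G n $ j))"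
    by (simp add: exp_deriv_def sum_distrib_left mult.commute)
  also have "\<dots> = (\<Sum>n\<le>i. tconst (1 / fact (Suc n)) * (tconst (of_nat j) * ?G (Suc n) $ j))"
    unfolding Suc sum.atMost_Suc_shift by simp
  also have "\<dots> = (\<Sum>n\<le>i. \<Sum>k\<in>odds j. tconst (-2 / fact n) * tderiv k (?G n $ (j - k)))"
    unfolding deriv_op_power_rule sum_distrib_left tconst_mult_tconst
    by (intro sum.cong refl arg_cong2[of _ _ _ _ "(*)"] arg_cong[of _ _ tconst]) (simp add: field_simps del: of_nat_Suc)
  also have "\<dots> = (\<Sum>k\<in>odds j. \<Sum>n\<le>i. tconst (-2 / fact n) * tderiv k (?G n $ (j - k)))"
    by (rule sum.swap)
  also have "\<dots> = (\<Sum>k\<in>odds j. \<Sum>n\<le>j - k. tconst (-2 / fact n) * tderiv k (?G n $ (j - k)))"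
  proof (rule sum.cong, rule refl, rule sum.mono_neutral_right)
    fix k assume "k \<in> odds j"
    then have "j - k \<le> i" using Suc oddsD[of k j] by simp
    then show "{..j - k} \<subseteq> {..i}" by auto
    show "\<forall>n\<in>{..i} - {..j - k}. tconst (-2 / fact n) * tderiv k (?G n $ (j - k)) = 0"
      by (auto simp: deriv_op_power_order)
  qed auto
  also have "\<dots> = tconst (-2) * (\<Sum>k\<in>odds j. tderiv k (exp_deriv (j - k) f))"
    by (simp add: exp_deriv_def tderiv_sum tderiv_tconst_mult sum_distrib_left)
  finally show ?thesis .
qed

text \<open>For j > 0 the factor j is invertible, so the recursion and the value at 0 determine all
  coefficients. Linearity and the commutation rules are obtained by checking the recursion.\<close>

lemma exp_deriv_eqI:
  assumes "\<And>j. tconst (of_nat j) * F j = tconst (-2) * (\<Sum>k\<in>odds j. tderiv k (F (j - k)))" "F 0 = f"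
  shows "F j = exp_deriv j f"
proof (induction j rule: less_induct)
  case (less j)
  show ?case
  proof (cases "j = 0")
    case False
    have "F (j - k) = exp_deriv (j - k) f" if "k \<in> odds j" for k
      using oddsD[OF that] by (intro less) auto
    then have "tconst (of_nat j) * F j = tconst (of_nat j) * exp_deriv j f"
      unfolding assms(1) exp_deriv_newton by (intro arg_cong2[of _ _ _ _ "(*)"] sum.cong refl) simp
    then show ?thesis using False by (simp add: tconst_mult_cancel)
  qed (simp add: assms(2))
qed

lemma exp_deriv_add: "exp_deriv j (f + g) = exp_deriv j f + exp_deriv j g"
  by (rule exp_deriv_eqI[symmetric])
     (simp_all add: distrib_left exp_deriv_newton tderiv_add sum.distrib)

lemma exp_deriv_tconst_mult: "exp_deriv j (tconst c * f) = tconst c * exp_deriv j f"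
proof (rule exp_deriv_eqI[symmetric])
  fix j
  have "tconst (of_nat j) * (tconst c * exp_deriv j f) = tconst c * (tconst (of_nat j) * exp_deriv j f)"
    by (rule mult.left_commute)
  also have "\<dots> = tconst (-2) * (\<Sum>k\<in>odds j. tderiv k (tconst c * exp_deriv (j - k) f))"
    unfolding exp_deriv_newton tderiv_tconst_mult sum_distrib_left[symmetric] by (rule mult.left_commute)
  finally show "tconst (of_nat j) * (tconst c * exp_deriv j f) =
      tconst (-2) * (\<Sum>k\<in>odds j. tderiv k (tconst c * exp_deriv (j - k) f))" .
qed simp

lemma exp_deriv_zero [simp]: "exp_deriv j 0 = 0"
  using exp_deriv_tconst_mult[of j 0 0] by simp

lemma tderiv_exp_deriv: "tderiv l (exp_deriv j f) = exp_deriv j (tderiv l f)"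
proof (rule exp_deriv_eqI)
  fix j
  have "tconst (of_nat j) * tderiv l (exp_deriv j f) = tderiv l (tconst (of_nat j) * exp_deriv j f)"
    by (simp add: tderiv_tconst_mult)
  also have "\<dots> = tconst (-2) * (\<Sum>k\<in>odds j. tderiv k (tderiv l (exp_deriv (j - k) f)))"
    unfolding exp_deriv_newton by (simp add: tderiv_tconst_mult tderiv_sum tderiv_commute[of l])
  finally show "tconst (of_nat j) * tderiv l (exp_deriv j f) =
      tconst (-2) * (\<Sum>k\<in>odds j. tderiv k (tderiv l (exp_deriv (j - k) f)))" .
qed simp

text \<open>The commutator of the exponent with \<open>t_l\<close> is the scalar
  \<open>-2 w^l / l\<close>, so the exponential moves past \<open>t_l\<close> at the cost of that
  term.\<close>

lemma exp_deriv_tvar_mult: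
  assumes "odd l"
  shows "exp_deriv j (tvar l * f) =
    tvar l * exp_deriv j f - (if l \<le> j then tconst (2 / of_nat l) * exp_deriv (j - l) f else 0)"
proof (rule exp_deriv_eqI[symmetric])
  fix j
  let ?E = "\<lambda>j. exp_deriv j f" and ?S = "\<lambda>j. tconst (-2) * (\<Sum>k\<in>odds j. tderiv k (exp_deriv (j - k) f))"
  let ?G = "\<lambda>j. tvar l * ?E j - (if l \<le> j then tconst (2 / of_nat l) * ?E (j - l) else 0)"
  have "0 < l" using assms by (rule odd_pos)
  have "(\<Sum>k\<in>odds j. if l \<le> j - k then tderiv k (?E (j - k - l)) else 0) =
      (if l \<le> j then \<Sum>k\<in>odds (j - l). tderiv k (?E (j - l - k)) else 0)"
    using \<open>0 < l\<close> by (auto simp: odds_def add.commute intro!: sum.mono_neutral_cong_right sum.neutral split: if_split_asm)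
  moreover have "(\<Sum>k\<in>odds j. if k = l then ?E (j - l) else 0) = (if l \<le> j then ?E (j - l) else 0)"
    using assms by (simp add: odds_def)
  moreover have "tderiv k (?G (j - k)) = (if k = l then ?E (j - l) else 0) + tvar l * tderiv k (?E (j - k)) -
      tconst (2 / of_nat l) * (if l \<le> j - k then tderiv k (?E (j - k - l)) else 0)" if "k \<in> odds j" for k
    using oddsD[OF that] assms by (simp add: tderiv_diff tderiv_mult[of k "tvar l"] tderiv_tvar tderiv_tconst_mult)
  ultimately have "tconst (-2) * (\<Sum>k\<in>odds j. tderiv k (?G (j - k))) = tvar l * ?S j +
      (if l \<le> j then tconst (-2) * ?E (j - l) - tconst (2 / of_nat l) * ?S (j - l) else 0)"
    by (simp add: sum.distrib sum_subtractf sum_distrib_left[symmetric] distrib_left right_diff_distrib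
        mult.left_commute[of _ "tvar l"] cong: sum.cong)
  also have "\<dots> = tconst (of_nat j) * ?G j"
  proof -
    have "-2 - 2 / of_nat l * of_nat (j - l) = - (of_nat j * (2 / of_nat l) :: complex)" if "l \<le> j"
      using that \<open>0 < l\<close> by (simp add: of_nat_diff field_simps)
    then have "tconst (-2) * x - tconst (2 / of_nat l) * (tconst (of_nat (j - l)) * x) =
        - (tconst (of_nat j) * (tconst (2 / of_nat l) * x))" if "l \<le> j" for x
      using that by (simp only: tconst_mult_tconst flip: left_diff_distrib tconst_diff tconst_minus mult_minus_left)
    then show ?thesis
      unfolding exp_deriv_newton[symmetric] by (simp add: right_diff_distrib mult.left_commute[of _ "tvar l"] del: tconst_mult_tconst)
  qed
  finally show "tconst (of_nat j) * ?G j = tconst (-2) * (\<Sum>k\<in>odds j. tderiv k (?G (j - k)))" ..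
qed (use odd_pos[OF assms] in simp)

lemma exp_deriv_eq_at: "eq_at d f g \<Longrightarrow> eq_at (d - int j) (exp_deriv j f) (exp_deriv j g)"
proof (induction j rule: less_induct)
  case (less j)
  show ?case
  proof (cases "j = 0")
    case False
    have "eq_at (d - int j) (tderiv k (exp_deriv (j - k) f)) (tderiv k (exp_deriv (j - k) g))" if "k \<in> odds j" for k
    proof -
      note k = oddsD[OF that]
      then have "eq_at (d - int (j - k) - int k) (tderiv k (exp_deriv (j - k) f)) (tderiv k (exp_deriv (j - k) g))"
        by (intro tderiv_eq_at less) auto
      then show ?thesis using k by (simp add: of_nat_diff)
    qed
    then have "coeff (tconst (of_nat j) * exp_deriv j f) m = coeff (tconst (of_nat j) * exp_deriv j g) m"
      if "int (weight m) = d - int j" for m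
      unfolding exp_deriv_newton using that by (auto simp: eq_at_def intro!: sum.cong)
    then show ?thesis using False by (simp add: eq_at_def)
  qed (use less in simp)
qed

text \<open>In the recursion at index k only the summand l = k survives, and there
  \<open>exp_deriv 0\<close> is the identity.\<close>

lemma tderiv_eq_0:
  assumes "\<And>j. 0 < j \<Longrightarrow> exp_deriv j f = 0" "odd k"
  shows "tderiv k f = 0"
proof -
  have "0 < k" using \<open>odd k\<close> by (rule odd_pos)
  then have "0 = tconst (-2) * (\<Sum>l\<in>odds k. tderiv l (exp_deriv (k - l) f))"
    using exp_deriv_newton[of k f] assms(1) by simp
  also have "(\<Sum>l\<in>odds k. tderiv l (exp_deriv (k - l) f)) = (\<Sum>l\<in>odds k. if l = k then tderiv k f else 0)"
    by (rule sum.cong) (auto simp: odds_def assms(1))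
  also have "\<dots> = tderiv k f" using assms(2) by (simp add: odds_def)
  finally have "tconst (-2) * tderiv k f = tconst (-2) * 0" by simp
  then show ?thesis by (subst (asm) tconst_mult_cancel) auto
qed

lemma constant_if_tderiv_eq_0:
  assumes "\<And>k. odd k \<Longrightarrow> tderiv k f = 0" "m \<noteq> 0"
  shows "coeff f m = 0"
proof -
  obtain i where i: "Poly_Mapping.lookup m i \<noteq> 0"
    using assms(2) by (metis lookup_zero poly_mapping_eqI)
  let ?e = "Poly_Mapping.single i (1 :: nat)"
  have m: "m - ?e + ?e = m"
    using i by (rule remove_single)
  have "coeff (tderiv (2 * i + 1) f) (m - ?e) = 0" using assms(1)[of "2 * i + 1"] by simp
  then show ?thesis using m by (simp add: coeff_tderiv del: of_nat_Suc)
qed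

section \<open>The series \<open>q\<^sub>i\<close> and the neutral fermions\<close>

text \<open>The extension by zero lets index shifts, such as differentiation by \<open>t_k\<close>,
  hold without a case distinction.\<close>

definition q_int :: "int \<Rightarrow> tseries" where
  "q_int n = (if n < 0 then 0 else q_poly (nat n))"

lemma q_int_of_nat [simp]: "q_int (int n) = q_poly n"
  by (simp add: q_int_def)

lemma q_int_neg [simp]: "n < 0 \<Longrightarrow> q_int n = 0"
  by (simp add: q_int_def)

lemma q_poly_0 [simp]: "q_poly 0 = 1"
  by (simp add: q_poly_def)

text \<open>These are the coefficients of z d/dz applied to the generating exponential.\<close>

lemma q_poly_recursion:
  "tconst (of_nat i) * q_poly i = (\<Sum>k\<in>odds i. tconst (of_nat k) * (tvar k * q_poly (i - k)))"
proof (cases i)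
  case (Suc n)
  define T where "T = Abs_fps (\<lambda>k. if odd k then tvar k else 0)"
  let ?c = "\<lambda>n. tconst (1 / fact n)"
  have T0: "T $ 0 = 0" by (simp add: T_def)
  \<comment> \<open>The exponent has no constant term, so the sum may be prolonged to a common bound
    N for all coefficients up to N.\<close>
  have q: "q_poly i = (\<Sum>m\<le>N. ?c m * (T ^ m) $ i)" if "i \<le> N" for i N
  proof -
    have "q_poly i = (\<Sum>m\<le>i. ?c m * (T ^ m) $ i)"
      by (simp add: q_poly_def T_def fps_compose_nth atLeast0AtMost)
    also have "\<dots> = (\<Sum>m\<le>N. ?c m * (T ^ m) $ i)"
      by (rule sum.mono_neutral_left) (use that T0 in \<open>auto simp: startsby_zero_power_prefix\<close>)
    finally show ?thesis .
  qed
  have "tconst (of_nat i) * q_poly i = (\<Sum>m\<le>Suc n. ?c m * (tconst (of_nat (Suc n)) * (T ^ m) $ Suc n))"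
    unfolding Suc q[OF order_refl] by (simp add: sum_distrib_left mult.commute del: sum.atMost_Suc)
  also have "\<dots> = (\<Sum>m\<le>Suc n. ?c m * fps_deriv (T ^ m) $ n)"
    by (simp only: fps_deriv_nth Suc_eq_plus1 of_nat_tseries)
  also have "\<dots> = (\<Sum>m\<le>n. ?c (Suc m) * fps_deriv (T ^ Suc m) $ n)"
    unfolding sum.atMost_Suc_shift by simp
  also have "\<dots> = (\<Sum>m\<le>n. ?c m * (fps_deriv T * T ^ m) $ n)"
  proof (rule sum.cong)
    fix m
    have "fps_deriv (T ^ Suc m) = fps_const (tconst (of_nat (Suc m))) * (fps_deriv T * T ^ m)"
      unfolding fps_deriv_power of_nat_tseries by (simp add: mult.assoc)
    then have "?c (Suc m) * fps_deriv (T ^ Suc m) $ n = ?c (Suc m) * (tconst (of_nat (Suc m)) * (fps_deriv T * T ^ m) $ n)"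
      by (simp only: fps_mult_left_const_nth)
    also have "\<dots> = ?c m * (fps_deriv T * T ^ m) $ n"
      unfolding tconst_mult_tconst by (rule arg_cong2[of _ _ _ _ "(*)"]) (simp_all del: of_nat_Suc)
    finally show "?c (Suc m) * fps_deriv (T ^ Suc m) $ n = ?c m * (fps_deriv T * T ^ m) $ n" .
  qed simp
  also have "\<dots> = (\<Sum>m\<le>n. \<Sum>a\<le>n. fps_deriv T $ a * (?c m * (T ^ m) $ (n - a)))"
    by (simp add: fps_mult_nth atLeast0AtMost sum_distrib_left mult.left_commute)
  also have "\<dots> = (\<Sum>a\<le>n. \<Sum>m\<le>n. fps_deriv T $ a * (?c m * (T ^ m) $ (n - a)))"
    by (rule sum.swap)
  also have "\<dots> = (\<Sum>a\<le>n. fps_deriv T $ a * q_poly (n - a))"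
    by (intro sum.cong refl) (simp add: q[of "n - _" n] sum_distrib_left)
  also have "\<dots> = (\<Sum>a\<in>{a. a \<le> n \<and> odd (Suc a)}. tconst (of_nat (Suc a)) * (tvar (Suc a) * q_poly (n - a)))"
    by (rule sum.mono_neutral_cong_right) (auto simp: T_def of_nat_tseries mult.assoc simp del: of_nat_Suc)
  also have "\<dots> = (\<Sum>k\<in>odds i. tconst (of_nat k) * (tvar k * q_poly (i - k)))"
    by (rule sum.reindex_bij_witness[where i = "\<lambda>k. k - 1" and j = Suc])
       (use Suc in \<open>auto simp: odds_def intro: odd_pos\<close>)
  finally show ?thesis .
qed simp

lemma homogeneous_q_poly: "homogeneous i (q_poly i)"
proof (induction i rule: less_induct)
  case (less i)
  show ?case
  proof (cases "i = 0")
    case False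
    have "homogeneous i (tconst (of_nat i) * q_poly i)"
      unfolding q_poly_recursion
    proof (intro homogeneous_sum homogeneous_tconst_mult)
      fix k assume "k \<in> odds i"
      note k = oddsD[OF this]
      have "homogeneous (k + (i - k)) (tvar k * q_poly (i - k))"
        by (intro homogeneous_mult homogeneous_tvar less) (use k in auto)
      then show "homogeneous i (tvar k * q_poly (i - k))" using k by simp
    qed
    then show ?thesis using False by (simp add: homogeneous_def)
  qed simp
qed

lemma tderiv_tconst [simp]: "tderiv k (tconst c) = 0"
  using tderiv_tconst_mult[of k c 1] by simp

text \<open>Differentiation by \<open>t_k\<close> multiplies the generating exponential by z^k; on
  coefficients this follows from the recursion.\<close>

lemma tderiv_q_poly:
  assumes "odd k"
  shows "tderiv k (q_poly i) = (if k \<le> i then q_poly (i - k) else 0)"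
proof (induction i rule: less_induct)
  case (less i)
  show ?case
  proof (cases "i = 0")
    case True
    then show ?thesis using assms by (auto dest: odd_pos)
  next
    case False
    have "tconst (of_nat i) * tderiv k (q_poly i) = tderiv k (tconst (of_nat i) * q_poly i)"
      by (simp add: tderiv_tconst_mult)
    also have "\<dots> = (\<Sum>l\<in>odds i. (if l = k then tconst (of_nat k) * q_poly (i - k) else 0) +
        tconst (of_nat l) * (tvar l * (if k \<le> i - l then q_poly (i - l - k) else 0)))"
      unfolding q_poly_recursion tderiv_sum
    proof (rule sum.cong)
      fix l assume "l \<in> odds i"
      note l = oddsD[OF this]
      have "tderiv k (q_poly (i - l)) = (if k \<le> i - l then q_poly (i - l - k) else 0)"
        by (rule less) (use l False in auto)
      then show "tderiv k (tconst (of_nat l) * (tvar l * q_poly (i - l))) =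
          (if l = k then tconst (of_nat k) * q_poly (i - k) else 0) +
          tconst (of_nat l) * (tvar l * (if k \<le> i - l then q_poly (i - l - k) else 0))"
        by (simp add: tderiv_tconst_mult tderiv_mult tderiv_tvar[OF assms l(3)] distrib_left)
    qed simp
    also have "\<dots> = (if k \<le> i then tconst (of_nat k) * q_poly (i - k) else 0) +
        (\<Sum>l\<in>odds i. tconst (of_nat l) * (tvar l * (if k \<le> i - l then q_poly (i - l - k) else 0)))"
      using assms by (simp add: sum.distrib) (simp add: odds_def)
    also have "(\<Sum>l\<in>odds i. tconst (of_nat l) * (tvar l * (if k \<le> i - l then q_poly (i - l - k) else 0))) =
        (if k \<le> i then tconst (of_nat (i - k)) * q_poly (i - k) else 0)"
    proof (cases "k \<le> i")
      case True
      have "(\<Sum>l\<in>odds i. tconst (of_nat l) * (tvar l * (if k \<le> i - l then q_poly (i - l - k) else 0))) =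
          (\<Sum>l\<in>odds (i - k). tconst (of_nat l) * (tvar l * q_poly (i - k - l)))"
        by (rule sum.mono_neutral_cong_right) (use True odd_pos[OF assms] in \<open>auto simp: odds_def add.commute\<close>)
      then show ?thesis using True by (simp only: if_True q_poly_recursion)
    next
      case False
      then have "\<not> k \<le> i - l" for l by simp
      then show ?thesis using False by simp
    qed
    also have "(if k \<le> i then tconst (of_nat k) * q_poly (i - k) else 0) +
        (if k \<le> i then tconst (of_nat (i - k)) * q_poly (i - k) else 0) =
        tconst (of_nat i) * (if k \<le> i then q_poly (i - k) else 0)"
      by (simp add: of_nat_diff flip: distrib_right tconst_add)
    finally show ?thesis using False by (subst (asm) tconst_mult_cancel) auto
  qed
qed

lemma tderiv_q_int:
  assumes "odd k"
  shows "tderiv k (q_int n) = q_int (n - int k)"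
  using odd_pos[OF assms] by (auto simp: q_int_def tderiv_q_poly[OF assms] nat_diff_distrib le_nat_iff)

text \<open>The coefficients of (1 - u)/(1 + u), which is the exponential of -2 times the sum of
  u^k/k over odd k. The operator exponential multiplies the generating series of the
  \<open>q_i\<close> by this series at u = w z.\<close>

definition exp_deriv_q_coeff :: "nat \<Rightarrow> complex" where
  "exp_deriv_q_coeff j = (if j = 0 then 1 else 2 * (-1) ^ j)"

lemma sum_exp_deriv_q_coeff:
  "2 * (\<Sum>k\<in>odds j. exp_deriv_q_coeff (j - k)) = - (of_nat j * exp_deriv_q_coeff j)"
proof (induction j rule: less_induct)
  case (less j)
  consider "j = 0" | "j = 1" | i where "j = Suc (Suc i)" by (cases j rule: nat.exhaust) (auto, metis One_nat_def not0_implies_Suc)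
  then show ?case
  proof cases
    case 2
    have "odds 1 = {1}" by (auto simp: odds_def le_Suc_eq)
    then show ?thesis using 2 by (simp add: exp_deriv_q_coeff_def)
  next
    case 3
    have "odds j = insert 1 ((\<lambda>k. k + 2) ` odds i)"
    proof (intro equalityI subsetI)
      fix k assume k: "k \<in> odds j"
      then have "k = 1 \<or> k = (k - 2) + 2 \<and> k - 2 \<in> odds i"
        using oddsD[OF k] 3 by (auto simp: odds_def)
      then show "k \<in> insert 1 ((\<lambda>k. k + 2) ` odds i)" by blast
    qed (use 3 in \<open>auto simp: odds_def\<close>)
    moreover have "1 \<notin> (\<lambda>k. k + 2) ` odds i" by auto
    ultimately have "(\<Sum>k\<in>odds j. exp_deriv_q_coeff (j - k)) =
        exp_deriv_q_coeff (j - 1) + (\<Sum>k\<in>odds i. exp_deriv_q_coeff (j - (k + 2)))"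
      by (simp add: sum.reindex inj_on_def)
    also have "(\<Sum>k\<in>odds i. exp_deriv_q_coeff (j - (k + 2))) = (\<Sum>k\<in>odds i. exp_deriv_q_coeff (i - k))"
      using 3 by simp
    finally have "2 * (\<Sum>k\<in>odds j. exp_deriv_q_coeff (j - k)) = 2 * exp_deriv_q_coeff (j - 1) - of_nat i * exp_deriv_q_coeff i"
      using less[of i] 3 by (simp add: distrib_left)
    also have "\<dots> = - (of_nat j * exp_deriv_q_coeff j)"
      using 3 by (cases "i = 0") (simp_all add: exp_deriv_q_coeff_def algebra_simps)
    finally show ?thesis .
  qed simp
qed

lemma exp_deriv_q_int: "exp_deriv j (q_int n) = tconst (exp_deriv_q_coeff j) * q_int (n - int j)"
proof (rule exp_deriv_eqI[symmetric])
  fix j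
  have "(\<Sum>k\<in>odds j. tderiv k (tconst (exp_deriv_q_coeff (j - k)) * q_int (n - int (j - k)))) =
      (\<Sum>k\<in>odds j. tconst (exp_deriv_q_coeff (j - k)) * q_int (n - int j))"
  proof (rule sum.cong)
    fix k assume "k \<in> odds j"
    then show "tderiv k (tconst (exp_deriv_q_coeff (j - k)) * q_int (n - int (j - k))) =
        tconst (exp_deriv_q_coeff (j - k)) * q_int (n - int j)"
      using oddsD[of k j] by (simp add: tderiv_tconst_mult tderiv_q_int of_nat_diff)
  qed simp
  also have "tconst (-2) * \<dots> = tconst (- (2 * (\<Sum>k\<in>odds j. exp_deriv_q_coeff (j - k)))) * q_int (n - int j)"
    by (simp add: tconst_sum sum_distrib_right tconst_mult tconst_minus mult.assoc)
  also have "\<dots> = tconst (of_nat j) * (tconst (exp_deriv_q_coeff j) * q_int (n - int j))"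
    unfolding sum_exp_deriv_q_coeff by simp
  finally show "tconst (of_nat j) * (tconst (exp_deriv_q_coeff j) * q_int (n - int j)) =
      tconst (-2) * (\<Sum>k\<in>odds j. tderiv k (tconst (exp_deriv_q_coeff (j - k)) * q_int (n - int (j - k))))" ..
qed (simp add: exp_deriv_q_coeff_def)

text \<open>The generating series satisfies q(z) q(-z) = 1, because its exponent is odd in z. For N
  > 0 the sum has all derivatives zero and is homogeneous of positive degree, hence it
  vanishes.\<close>

lemma q_poly_orthogonality:
  "(\<Sum>i\<le>N. tconst ((-1) ^ i) * (q_poly i * q_poly (N - i))) = (if N = 0 then 1 else 0)" (is "?S = _")
proof (cases "N = 0")
  case False
  have "tderiv k ?S = 0" if k: "odd k" for k
  proof (cases "k \<le> N")
    case True
    have "(\<Sum>i\<le>N. tconst ((-1) ^ i) * ((if k \<le> i then q_poly (i - k) else 0) * q_poly (N - i))) =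
        (\<Sum>i\<in>{k..N}. tconst ((-1) ^ i) * (q_poly (i - k) * q_poly (N - i)))"
      by (rule sum.mono_neutral_cong_right) auto
    \<comment> \<open>The shift by the odd number k reverses the alternating sign, so the two halves
      of the product rule cancel.\<close>
    also have "\<dots> = (\<Sum>i\<le>N - k. - (tconst ((-1) ^ i) * (q_poly i * q_poly (N - k - i))))"
      by (rule sum.reindex_bij_witness[where i = "\<lambda>i. i + k" and j = "\<lambda>i. i - k"])
         (use k True in \<open>auto simp: minus_one_power_iff tconst_minus\<close>)
    finally have "(\<Sum>i\<le>N. tconst ((-1) ^ i) * ((if k \<le> i then q_poly (i - k) else 0) * q_poly (N - i))) = \<dots>" .
    moreover have "(\<Sum>i\<le>N. tconst ((-1) ^ i) * (q_poly i * (if k \<le> N - i then q_poly (N - i - k) else 0))) =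
        (\<Sum>i\<le>N - k. tconst ((-1) ^ i) * (q_poly i * q_poly (N - k - i)))"
      by (rule sum.mono_neutral_cong_right) (use True in \<open>auto simp: add.commute\<close>)
    ultimately show ?thesis
      by (simp only: tderiv_sum tderiv_tconst_mult tderiv_mult tderiv_q_poly[OF k] distrib_left sum.distrib sum_negf left_minus
        tderiv_tconst mult_zero_left sum.neutral_const add_0)
  next
    case False
    then have "\<not> k \<le> i" "\<not> k \<le> N - i" if "i \<le> N" for i using that by auto
    then show ?thesis
      by (auto simp: tderiv_sum tderiv_tconst_mult tderiv_mult tderiv_q_poly[OF k] intro!: sum.neutral)
  qed
  moreover have "homogeneous N ?S"
  proof (rule homogeneous_sum)
    fix i assume "i \<in> {..N}"
    then show "homogeneous N (tconst ((-1) ^ i) * (q_poly i * q_poly (N - i)))"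
      using homogeneous_mult[OF homogeneous_q_poly homogeneous_q_poly, of i "N - i"] by (simp add: homogeneous_tconst_mult)
  qed
  ultimately have "coeff ?S m = 0" for m
    using False constant_if_tderiv_eq_0[of ?S m] weight_eq_0_iff[of m] unfolding homogeneous_def by metis
  then have "?S = 0" by (intro tseries_eqI) (simp only: coeff_zero)
  then show ?thesis using False by (simp only: if_False)
qed simp

section \<open>Finite forms of the fermion modes\<close>

lemma has_sum_tseriesI:
  assumes fin: "\<And>n. finite {i \<in> I. \<exists>m. weight m < n \<and> coeff (F i) m \<noteq> 0}"
    and S: "\<And>m. coeff S m = (\<Sum>i\<in>{i \<in> I. coeff (F i) m \<noteq> 0}. coeff (F i) m)"
  shows "(F has_sum S) I"
  unfolding has_sum_def tendsto_tseries_iff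
proof
  fix n
  let ?K = "{i \<in> I. \<exists>m. weight m < n \<and> coeff (F i) m \<noteq> 0}"
  have "agree_below n S (sum F Y)" if Y: "finite Y" "?K \<subseteq> Y" "Y \<subseteq> I" for Y
    unfolding agree_below_def coeff_sum S
    by (intro allI impI sum.mono_neutral_left) (use Y in auto)
  then show "eventually (\<lambda>Y. agree_below n S (sum F Y)) (finite_subsets_at_top I)"
    unfolding eventually_finite_subsets_at_top using fin[of n] by (intro exI[of _ ?K]) auto
qed

lemma coeff_q_int_mult_nonzero:
  assumes "coeff (q_int n * f) m \<noteq> 0"
  shows "0 \<le> n \<and> n \<le> int (weight m)"
proof -
  obtain a b where ab: "coeff (q_int n) a \<noteq> 0" "a + b = m" using assms by (rule coeff_mult_nonzeroE)
  then have "0 \<le> n" by (auto simp: q_int_def split: if_splits)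
  then have "weight a = nat n" using ab(1) homogeneous_q_poly[of "nat n"]
    by (auto simp: q_int_def homogeneous_def)
  then show ?thesis using ab(2) \<open>0 \<le> n\<close> by auto
qed

text \<open>A coefficient of weight w only receives \<open>q_n\<close> with n at most w, so j is at
  most w - \<alpha>; every larger bound D gives the same sum.\<close>

lemma coeff_fermion:
  assumes "int (weight m) - \<alpha> \<le> int D"
  shows "coeff (fermion \<alpha> f) m = 1 / complex_of_real (sqrt 2) *
    (\<Sum>j\<le>D. coeff (q_int (\<alpha> + int j) * exp_deriv j f) m)"
proof -
  let ?I = "{j. \<alpha> + int j \<ge> 0}" and ?F = "\<lambda>j. q_poly (nat (\<alpha> + int j)) * exp_deriv j f"
  let ?G = "\<lambda>j. q_int (\<alpha> + int j) * exp_deriv j f"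
  define S where "S = Abs_tseries (\<lambda>m. \<Sum>j\<in>{j \<in> ?I. coeff (?F j) m \<noteq> 0}. coeff (?F j) m)"
  have FG: "?F j = ?G j" if "j \<in> ?I" for j using that by (simp add: q_int_def)
  have le: "int j \<le> int (weight m) - \<alpha>" if "j \<in> ?I" "coeff (?F j) m \<noteq> 0" for j m
    using coeff_q_int_mult_nonzero[of "\<alpha> + int j" "exp_deriv j f" m] that FG[OF that(1)] by auto
  have "(?F has_sum S) ?I"
  proof (rule has_sum_tseriesI)
    fix n
    have "{j \<in> ?I. \<exists>m. weight m < n \<and> coeff (?F j) m \<noteq> 0} \<subseteq> {..nat (int n - \<alpha>)}"
      using le by fastforce
    then show "finite {j \<in> ?I. \<exists>m. weight m < n \<and> coeff (?F j) m \<noteq> 0}" by (rule finite_subset) simp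
  qed (simp add: S_def)
  then have "infsum ?F ?I = S" by (rule infsumI)
  then have "coeff (fermion \<alpha> f) m = 1 / complex_of_real (sqrt 2) * coeff S m"
    by (simp add: fermion_def)
  also have "coeff S m = (\<Sum>j\<in>{j \<in> ?I. coeff (?F j) m \<noteq> 0}. coeff (?G j) m)"
    unfolding S_def coeff_Abs using FG by (intro sum.cong refl) auto
  also have "\<dots> = (\<Sum>j\<le>D. coeff (?G j) m)"
  proof (rule sum.mono_neutral_left)
    show "{j \<in> ?I. coeff (?F j) m \<noteq> 0} \<subseteq> {..D}" using le assms by fastforce
    show "\<forall>j\<in>{..D} - {j \<in> ?I. coeff (?F j) m \<noteq> 0}. coeff (?G j) m = 0"
      using FG coeff_q_int_mult_nonzero by fastforce
  qed simp
  finally show ?thesis .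
qed

lemma exp_deriv_bounded:
  assumes "weight_bounded d f" "d < j"
  shows "exp_deriv j f = 0"
proof (rule tseries_eqI)
  fix m
  have "eq_at (int (weight m) + int j) f 0"
    using assms unfolding weight_bounded_eq_at by auto
  then have "eq_at (int (weight m)) (exp_deriv j f) (exp_deriv j 0)"
    using exp_deriv_eq_at[of "int (weight m) + int j" f 0 j] by simp
  then show "coeff (exp_deriv j f) m = coeff 0 m" by (simp add: eq_at_def)
qed

lemma weight_bounded_exp_deriv:
  assumes "weight_bounded d f"
  shows "weight_bounded d (exp_deriv j f)"
  unfolding weight_bounded_eq_at
proof (intro allI impI)
  fix e assume "int d < e"
  then have "eq_at (e + int j) f 0" using assms unfolding weight_bounded_eq_at by auto
  then show "eq_at e (exp_deriv j f) 0" using exp_deriv_eq_at[of "e + int j" f 0 j] by simp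
qed

lemma fermion_bounded:
  assumes "weight_bounded d f" "d \<le> D"
  shows "fermion \<alpha> f = tconst (1 / complex_of_real (sqrt 2)) * (\<Sum>j\<le>D. q_int (\<alpha> + int j) * exp_deriv j f)"
proof (rule tseries_eqI)
  fix m
  define D' where "D' = max D (nat (int (weight m) - \<alpha>))"
  have "coeff (fermion \<alpha> f) m = 1 / complex_of_real (sqrt 2) *
      (\<Sum>j\<le>D'. coeff (q_int (\<alpha> + int j) * exp_deriv j f) m)"
    by (rule coeff_fermion) (simp add: D'_def)
  also have "(\<Sum>j\<le>D'. coeff (q_int (\<alpha> + int j) * exp_deriv j f) m) =
      (\<Sum>j\<le>D. coeff (q_int (\<alpha> + int j) * exp_deriv j f) m)"
    by (rule sum.mono_neutral_right) (use assms exp_deriv_bounded[OF assms(1)] in \<open>auto simp: D'_def\<close>)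
  finally show "coeff (fermion \<alpha> f) m = coeff (tconst (1 / complex_of_real (sqrt 2)) *
      (\<Sum>j\<le>D. q_int (\<alpha> + int j) * exp_deriv j f)) m" by simp
qed

lemma weight_bounded_q_int: "weight_bounded (nat n) (q_int n)"
  using weight_bounded_homogeneous[OF homogeneous_q_poly[of "nat n"]]
  by (auto simp: q_int_def weight_bounded_def)

lemma weight_bounded_fermion:
  assumes "weight_bounded d f"
  shows "weight_bounded (nat \<bar>\<alpha>\<bar> + 2 * d) (fermion \<alpha> f)"
  unfolding fermion_bounded[OF assms order_refl]
proof (intro weight_bounded_tconst_mult weight_bounded_sum)
  fix j assume "j \<in> {..d}"
  then have "nat (\<alpha> + int j) + d \<le> nat \<bar>\<alpha>\<bar> + 2 * d" by auto
  then show "weight_bounded (nat \<bar>\<alpha>\<bar> + 2 * d) (q_int (\<alpha> + int j) * exp_deriv j f)"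
    by (rule weight_bounded_mono[rotated]) (intro weight_bounded_mult weight_bounded_q_int weight_bounded_exp_deriv assms)
qed

text \<open>The mode with index \<alpha> raises degrees by \<alpha>. One coefficient thus depends on
  a single homogeneous part, which permits replacing a series by a polynomial.\<close>

lemma coeff_fermion_cong:
  assumes "eq_at (int (weight m) - \<alpha>) f g"
  shows "coeff (fermion \<alpha> f) m = coeff (fermion \<alpha> g) m"
proof -
  define D where "D = nat (int (weight m) - \<alpha>)"
  have "coeff (q_int (\<alpha> + int j) * exp_deriv j f) m = coeff (q_int (\<alpha> + int j) * exp_deriv j g) m" for j
    unfolding coeff_mult
  proof (rule sum.cong, simp, clarify)
    fix a b assume "(a, b) \<in> splits m"
    then have ab: "weight m = weight a + weight b" by (auto simp: splits_def)
    show "coeff (q_int (\<alpha> + int j)) a * coeff (exp_deriv j f) b = coeff (q_int (\<alpha> + int j)) a * coeff (exp_deriv j g) b"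
    proof (cases "coeff (q_int (\<alpha> + int j)) a = 0")
      case False
      then have "0 \<le> \<alpha> + int j" by (auto simp: q_int_def split: if_splits)
      then have "int (weight a) = \<alpha> + int j" using False homogeneous_q_poly[of "nat (\<alpha> + int j)"]
        by (auto simp: q_int_def homogeneous_def)
      then have "int (weight b) = int (weight m) - \<alpha> - int j" using ab by simp
      then show ?thesis using exp_deriv_eq_at[OF assms, of j] by (simp add: eq_at_def)
    qed simp
  qed
  then show ?thesis
    using coeff_fermion[of m \<alpha> D f] coeff_fermion[of m \<alpha> D g] by (simp add: D_def)
qed

lemma fermion_add: "fermion \<alpha> (f + g) = fermion \<alpha> f + fermion \<alpha> g"
proof (rule tseries_eqI)
  fix m
  have "int (weight m) - \<alpha> \<le> int (nat (int (weight m) - \<alpha>))" by simp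
  note c = coeff_fermion[OF this]
  show "coeff (fermion \<alpha> (f + g)) m = coeff (fermion \<alpha> f + fermion \<alpha> g) m"
    by (simp add: c exp_deriv_add distrib_left sum.distrib add_divide_distrib)
qed

lemma fermion_tconst_mult: "fermion \<alpha> (tconst c * f) = tconst c * fermion \<alpha> f"
proof (rule tseries_eqI)
  fix m
  have "int (weight m) - \<alpha> \<le> int (nat (int (weight m) - \<alpha>))" by simp
  note c = coeff_fermion[OF this]
  show "coeff (fermion \<alpha> (tconst c * f)) m = coeff (tconst c * fermion \<alpha> f) m"
    by (simp add: c exp_deriv_tconst_mult mult.left_commute[of _ "tconst c"] flip: sum_distrib_left)
qed

lemma coeff_fermion_homogeneous:
  assumes "homogeneous d f" "int (weight m) \<noteq> int d + \<alpha>"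
  shows "coeff (fermion \<alpha> f) m = 0"
proof -
  have "eq_at (int (weight m) - \<alpha>) f (tconst 0 * f)" using assms by (auto simp: eq_at_def homogeneous_def)
  from coeff_fermion_cong[OF this] show ?thesis unfolding fermion_tconst_mult by simp
qed

lemma fermion_zero [simp]: "fermion \<alpha> 0 = 0"
  using fermion_tconst_mult[of \<alpha> 0 0] by simp

lemma fermion_diff: "fermion \<alpha> (f - g) = fermion \<alpha> f - fermion \<alpha> g"
  using fermion_add[of \<alpha> "f - g" g] by simp

lemma fermion_sum: "fermion \<alpha> (sum F I) = (\<Sum>i\<in>I. fermion \<alpha> (F i))"
  by (induction I rule: infinite_finite_induct) (auto simp: fermion_add)

definition parity_sign :: "int \<Rightarrow> complex" where
  "parity_sign a = (if even a then 1 else -1)"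

text \<open>Only the factor exp(sum of \<open>t_k\<close> z^k) fails to commute with the derivative,
  and it contributes the factor z^k.\<close>

lemma tderiv_fermion:
  assumes "weight_bounded d f" "odd k"
  shows "tderiv k (fermion \<alpha> f) = fermion \<alpha> (tderiv k f) + fermion (\<alpha> - int k) f"
proof -
  have "weight_bounded d (tderiv k f)"
    using assms(1) odd_div_2[OF assms(2)] by (fastforce simp: weight_bounded_def coeff_tderiv)
  note b = fermion_bounded[OF this order_refl] fermion_bounded[OF assms(1) order_refl]
  have shift: "q_int (\<alpha> - int k + int j) = q_int (\<alpha> + int j - int k)" for j by (rule arg_cong) simp
  show ?thesis
    unfolding b by (simp add: tderiv_tconst_mult tderiv_sum tderiv_mult tderiv_q_int[OF assms(2)] tderiv_exp_deriv
        distrib_left sum.distrib shift)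
qed

text \<open>Here only the differential factor fails to commute; it contributes -(2/k) z^(-k), which
  raises the index by k.\<close>

lemma fermion_tvar_mult:
  assumes f: "weight_bounded d f" and k: "odd k"
  shows "fermion \<alpha> (tvar k * f) = tvar k * fermion \<alpha> f - tconst (2 / of_nat k) * fermion (\<alpha> + int k) f"
proof -
  let ?q = "\<lambda>j. q_int (\<alpha> + int j)" and ?E = "\<lambda>j. exp_deriv j f"
  have b: "weight_bounded (k + d) (tvar k * f)"
    by (intro weight_bounded_mult weight_bounded_homogeneous homogeneous_tvar f k)
  have "(\<Sum>j\<le>k + d. if k \<le> j then ?q j * ?E (j - k) else 0) = (\<Sum>j\<in>{k..k + d}. ?q j * ?E (j - k))"
    by (rule sum.mono_neutral_cong_right) auto
  also have "\<dots> = (\<Sum>j\<le>d. q_int (\<alpha> + int k + int j) * ?E j)"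
    by (rule sum.reindex_bij_witness[where i = "\<lambda>j. k + j" and j = "\<lambda>j. j - k"]) (auto simp: of_nat_diff)
  finally have shift: "(\<Sum>j\<le>k + d. if k \<le> j then ?q j * ?E (j - k) else 0) = \<dots>" .
  have "?q j * exp_deriv j (tvar k * f) =
      tvar k * (?q j * ?E j) - tconst (2 / of_nat k) * (if k \<le> j then ?q j * ?E (j - k) else 0)" for j
    by (simp add: exp_deriv_tvar_mult[OF k] right_diff_distrib mult.left_commute)
  then show ?thesis
    unfolding fermion_bounded[OF b order_refl] fermion_bounded[OF f, of "k + d" \<alpha>, OF le_add2]
      fermion_bounded[OF f order_refl, of "\<alpha> + int k"] shift[symmetric]
    by (simp add: sum_subtractf right_diff_distrib mult.left_commute flip: sum_distrib_left)
qed

section \<open>The Clifford relations\<close>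

lemma fermion_one: "fermion \<alpha> 1 = tconst (1 / complex_of_real (sqrt 2)) * q_int \<alpha>"
  using fermion_bounded[OF weight_bounded_homogeneous[OF homogeneous_1] order_refl, of \<alpha>] by simp

text \<open>The defect of the Clifford relation rather than the bare anticommutator: the claim
  becomes a vanishing statement that an induction can propagate.\<close>

definition anticommutator :: "int \<Rightarrow> int \<Rightarrow> tseries \<Rightarrow> tseries" where
  "anticommutator a b f = fermion a (fermion b f) + fermion b (fermion a f) -
    (if a + b = 0 then tconst (parity_sign a) * f else 0)"

text \<open>Only j = a reaches the constant term. The two factors 1/sqrt 2 and the coefficient
  \<open>2 * (-1) ^ a\<close> combine to the sign.\<close>

lemma coeff_fermion_one_pair:
  assumes "0 < a"
  shows "coeff (fermion (- int a) (fermion (int a) 1)) 0 = (-1) ^ a"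
proof -
  have "weight_bounded a (fermion (int a) 1)"
    unfolding fermion_one by (simp add: weight_bounded_tconst_mult weight_bounded_homogeneous homogeneous_q_poly)
  then have "coeff (fermion (- int a) (fermion (int a) 1)) 0 =
      1 / complex_of_real (sqrt 2) * (\<Sum>j\<le>a. coeff (q_int (- int a + int j) * exp_deriv j (fermion (int a) 1)) 0)"
    using fermion_bounded[OF _ order_refl, of a _ "- int a"] by simp
  also have "(\<Sum>j\<le>a. coeff (q_int (- int a + int j) * exp_deriv j (fermion (int a) 1)) 0) =
      (\<Sum>j\<le>a. if j = a then coeff (exp_deriv a (fermion (int a) 1)) 0 else 0)"
    by (rule sum.cong) (auto simp: q_int_def)
  also have "exp_deriv a (fermion (int a) 1) = tconst (1 / complex_of_real (sqrt 2) * (2 * (-1) ^ a)) * q_int 0"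
    unfolding fermion_one exp_deriv_tconst_mult exp_deriv_q_int using assms by (simp add: exp_deriv_q_coeff_def)
  finally show ?thesis by (simp add: q_int_def coeff_tconst divide_divide_eq_left flip: of_real_mult)
qed

text \<open>The defect is homogeneous of degree a + b. For positive degree its derivatives are sums
  of defects of smaller degree, so it is constant by induction, and only the constant term for a + b
  = 0 needs a computation.\<close>

lemma anticommutator_one: "anticommutator a b 1 = 0"
proof (induction "nat (a + b)" arbitrary: a b rule: less_induct)
  case less
  have hom: "int (weight m) = a + b" if "coeff (fermion a (fermion b 1)) m \<noteq> 0" for a b m
  proof (cases "b < 0")
    case False
    then have "homogeneous (nat b) (fermion b 1)"
      unfolding fermion_one by (simp add: q_int_def homogeneous_tconst_mult homogeneous_q_poly)
    from coeff_fermion_homogeneous[OF this, of m a] that False show ?thesis by (auto simp: add.commute)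
  qed (use that in \<open>simp add: fermion_one\<close>)
  have hom': "int (weight m) = a + b" if "coeff (anticommutator a b 1) m \<noteq> 0" for m
  proof (rule ccontr)
    assume n: "int (weight m) \<noteq> a + b"
    then have "coeff (fermion a (fermion b 1)) m = 0" "coeff (fermion b (fermion a 1)) m = 0"
      using hom[of a b m] hom[of b a m] by auto
    then show False using that n by (auto simp: anticommutator_def coeff_tconst split: if_splits)
  qed
  show ?case
  proof (rule tseries_eqI)
    fix m
    have "tderiv k (anticommutator a b 1) = 0" if k: "odd k" for k
    proof (cases "a + b \<le> 0")
      case True
      then have "coeff (anticommutator a b 1) m = 0" if "m \<noteq> 0" for m
        using hom'[of m] that weight_eq_0_iff[of m] by fastforce
      moreover have "m + Poly_Mapping.single (k div 2) (1 :: nat) \<noteq> 0" for m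
        using weight_eq_0_iff[of "m + Poly_Mapping.single (k div 2) (1 :: nat)"] by simp
      ultimately show ?thesis by (intro tseries_eqI) (simp add: coeff_tderiv)
    next
      case False
      have b: "weight_bounded d 1" for d using weight_bounded_homogeneous[OF homogeneous_1] weight_bounded_mono by blast
      note bb = weight_bounded_fermion[OF b[of 0]]
      \<comment> \<open>If a + b = k, both defects on the right contain scalars; these cancel
        because k is odd.\<close>
      have "tderiv k (anticommutator a b 1) = anticommutator (a - int k) b 1 + anticommutator a (b - int k) 1"
        using False k by (auto simp: anticommutator_def tderiv_diff tderiv_add tderiv_tconst_mult tderiv_fermion[OF bb k]
            tderiv_fermion[OF b[of 0] k] fermion_add parity_sign_def tconst_minus algebra_simps)
      also have "\<dots> = 0" using less[of "a - int k" b] less[of a "b - int k"] False odd_pos[OF k] by (simp add: algebra_simps)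
      finally show ?thesis .
    qed
    then have zero: "coeff (anticommutator a b 1) m = 0" if "m \<noteq> 0" using constant_if_tderiv_eq_0 that by blast
    have "coeff (anticommutator a b 1) 0 = 0"
    proof (cases "a + b = 0")
      case True
      have neg: "fermion (- int c) 1 = 0" if "0 < c" for c using that by (simp add: fermion_one)
      consider "a = 0" | c where "0 < c" "a = int c" | c where "0 < c" "a = - int c"
        by (metis neg_0_less_iff_less not_less_iff_gr_or_eq zero_less_imp_eq_int minus_minus)
      then show ?thesis
      proof cases
        case 1
        have "fermion 0 (fermion 0 1) = tconst (1 / 2)"
          using fermion_tconst_mult[of 0 _ 1] by (simp add: fermion_one q_int_def flip: tconst_mult of_real_mult)
        then show ?thesis
          using True 1 unfolding anticommutator_def coeff_diff coeff_add
          by (simp add: parity_sign_def coeff_one coeff_tconst)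
      next
        case 2
        then have "b = - int c" using True by simp
        then show ?thesis using 2 coeff_fermion_one_pair[of c] neg[of c]
          by (auto simp: anticommutator_def parity_sign_def coeff_one coeff_tconst minus_one_power_iff)
      next
        case 3
        then have "b = int c" using True by simp
        then show ?thesis using 3 coeff_fermion_one_pair[of c] neg[of c]
          by (auto simp: anticommutator_def parity_sign_def coeff_one coeff_tconst minus_one_power_iff)
      qed
    qed (use hom'[of 0] in auto)
    then show "coeff (anticommutator a b 1) m = coeff 0 m" using zero by (cases "m = 0") auto
  qed
qed

text \<open>
  Multiplication by \<open>t\<^sub>k\<close> changes the two indices by \<open>k\<close>, so it is enough to know the anticommutators on \<open>1\<close>.
\<close>

lemma fermion_anticommute:
  assumes "homogeneous d f"
  shows "fermion a (fermion b f) + fermion b (fermion a f) = (if a + b = 0 then tconst (parity_sign a) * f else 0)"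
proof -
  have "\<forall>a b. anticommutator a b f = 0"
    using assms
  proof (induction rule: homogeneous_induct)
    case one
    show ?case using anticommutator_one by blast
  next
    case (mult k d f)
    note b = weight_bounded_homogeneous[OF mult.hyps(2)]
    note bb = weight_bounded_fermion[OF b]
    \<comment> \<open>If a + b + k = 0, the two shifted defects contain scalars of opposite sign,
      since k is odd.\<close>
    have "anticommutator a b (tvar k * f) = tvar k * anticommutator a b f -
        tconst (2 / of_nat k) * (anticommutator (a + int k) b f + anticommutator a (b + int k) f)" for a b
      unfolding anticommutator_def fermion_tvar_mult[OF b mult.hyps(1)] fermion_diff fermion_tconst_mult
        fermion_tvar_mult[OF bb mult.hyps(1)]
      using mult.hyps(1) by (auto simp: parity_sign_def tconst_minus algebra_simps)
    then show ?case using mult.IH by simp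
  next
    case (sum F I)
    have "anticommutator a b (sum F I) = (\<Sum>i\<in>I. anticommutator a b (F i))" for a b
      by (simp add: anticommutator_def fermion_sum sum.distrib sum_subtractf sum_distrib_left)
    then show ?case using sum by simp
  next
    case (scale c f)
    have "anticommutator a b (tconst c * f) = tconst c * anticommutator a b f" for a b
      by (simp add: anticommutator_def fermion_tconst_mult distrib_left right_diff_distrib mult.commute[of c])
    then show ?case using scale by simp
  qed
  then show ?thesis by (simp add: anticommutator_def)
qed

section \<open>Positive modes from the remaining ones, and the entries
  \<open>Q_{a,b}\<close>\<close>

definition q_conv :: "nat \<Rightarrow> nat \<Rightarrow> tseries" where
  "q_conv a k = (\<Sum>i\<le>k. tconst ((-1) ^ i) * (q_poly (a + k - i) * q_poly i))"

lemma q_conv_0 [simp]: "q_conv a 0 = q_poly a"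
  by (simp add: q_conv_def)

text \<open>For fixed a the \<open>q_conv a k\<close> are the coefficients of (sum of
  \<open>q_{a+s}\<close> z^s) times q(-z) = 1/q(z); multiplication by q(z) recovers the shifted
  series.\<close>

lemma sum_q_conv: "(\<Sum>k\<le>l. q_conv a k * q_poly (l - k)) = q_poly (a + l)"
proof -
  have "(\<Sum>k\<le>l. q_conv a k * q_poly (l - k)) =
      (\<Sum>k\<le>l. \<Sum>i\<le>k. tconst ((-1) ^ i) * (q_poly (a + (k - i)) * (q_poly i * q_poly (l - (k - i) - i))))"
    unfolding q_conv_def sum_distrib_right by (intro sum.cong refl) (simp add: mult.assoc)
  also have "\<dots> = (\<Sum>(i, s)\<in>{(i, s). i + s \<le> l}. tconst ((-1) ^ i) * (q_poly (a + s) * (q_poly i * q_poly (l - s - i))))"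
    by (rule sum.triangle_reindex_eq[symmetric])
  also have "\<dots> = (\<Sum>(s, i)\<in>Sigma {..l} (\<lambda>s. {..l - s}). tconst ((-1) ^ i) * (q_poly (a + s) * (q_poly i * q_poly (l - s - i))))"
    by (rule sum.reindex_bij_witness[where i = "\<lambda>(a, b). (b, a)" and j = "\<lambda>(a, b). (b, a)"]) auto
  also have "\<dots> = (\<Sum>s\<le>l. \<Sum>i\<le>l - s. tconst ((-1) ^ i) * (q_poly (a + s) * (q_poly i * q_poly (l - s - i))))"
    by (subst sum.Sigma) auto
  also have "\<dots> = (\<Sum>s\<le>l. q_poly (a + s) * (\<Sum>i\<le>l - s. tconst ((-1) ^ i) * (q_poly i * q_poly (l - s - i))))"
    by (simp only: sum_distrib_left mult.left_commute[of "q_poly (a + _)"])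
  also have "\<dots> = (\<Sum>s\<le>l. if s = l then q_poly (a + l) else 0)"
    unfolding q_poly_orthogonality by (rule sum.cong) auto
  also have "\<dots> = q_poly (a + l)" by simp
  finally show ?thesis .
qed

text \<open>
  All the operators \<open>X\<^sub>a\<close> are combinations of the \<open>X\<^sub>-\<^sub>k\<close> with \<open>k \<ge> 0\<close>, because
  \<open>exp(-2 \<Sum>\<^sub>k w^k/k \<partial>/\<partial>t\<^sub>k)\<close> can be recovered from them.
\<close>

lemma fermion_expand:
  assumes f: "weight_bounded d f" and "d \<le> D"
  shows "fermion (int a) f = (\<Sum>k\<le>D. q_conv a k * fermion (- int k) f)"
proof -
  let ?c = "tconst (1 / complex_of_real (sqrt 2))"
  have "(\<Sum>k\<le>D. q_conv a k * fermion (- int k) f) =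
      (\<Sum>k\<le>D. \<Sum>l\<le>D. ?c * (q_conv a k * q_int (int l - int k) * exp_deriv l f))"
    unfolding fermion_bounded[OF assms] sum_distrib_left by (intro sum.cong refl) (simp add: mult_ac)
  also have "\<dots> = (\<Sum>l\<le>D. \<Sum>k\<le>D. ?c * (q_conv a k * q_int (int l - int k) * exp_deriv l f))"
    by (rule sum.swap)
  also have "\<dots> = (\<Sum>l\<le>D. ?c * ((\<Sum>k\<le>l. q_conv a k * q_poly (l - k)) * exp_deriv l f))"
  proof (rule sum.cong)
    fix l assume l: "l \<in> {..D}"
    have "(\<Sum>k\<le>D. ?c * (q_conv a k * q_int (int l - int k) * exp_deriv l f)) =
        (\<Sum>k\<le>l. ?c * (q_conv a k * q_poly (l - k) * exp_deriv l f))"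
      by (rule sum.mono_neutral_cong_right) (use l in \<open>auto simp: q_int_def nat_diff_distrib\<close>)
    then show "(\<Sum>k\<le>D. ?c * (q_conv a k * q_int (int l - int k) * exp_deriv l f)) =
        ?c * ((\<Sum>k\<le>l. q_conv a k * q_poly (l - k)) * exp_deriv l f)"
      by (simp only: sum_distrib_left sum_distrib_right)
  qed simp
  also have "\<dots> = (\<Sum>l\<le>D. ?c * (q_int (int a + int l) * exp_deriv l f))"
    by (simp add: sum_q_conv flip: of_nat_add)
  also have "\<dots> = fermion (int a) f"
    by (simp add: fermion_bounded[OF assms] sum_distrib_left)
  finally show ?thesis ..
qed

lemma Q2_skew: "Q2 i j = - Q2 j i" "Q2 i i = 0"
  by (auto simp: Q2_def)

lemma Q2_0: "0 < a \<Longrightarrow> Q2 a 0 = tconst (1 / complex_of_real (sqrt 2)) * q_poly a"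
  by (simp add: Q2_def Q_gt_def)

text \<open>Orthogonality in degree a + k gives G a k + G k a = \<open>q_a q_k\<close>, so G minus
  half of the product is skew, and for a > k it is the defining formula of \<open>Q_{a,k}\<close>.
  The subtracted half is \<open>Q_{a,0} Q_{k,0}\<close>, because of the two factors 1/sqrt
  2.\<close>

lemma q_conv_eq_Q2:
  assumes "0 < a" "0 < k"
  shows "tconst ((-1) ^ k) * q_conv a k = Q2 a k + Q2 a 0 * Q2 k 0"
proof -
  define G where "G a k = (\<Sum>i\<le>k. tconst ((-1) ^ i) * (q_poly (a + i) * q_poly (k - i)))" for a k
  have conv: "tconst ((-1) ^ k) * q_conv a k = G a k"
    unfolding q_conv_def G_def sum_distrib_left tconst_mult_tconst
  proof (rule sum.reindex_bij_witness[where i = "\<lambda>i. k - i" and j = "\<lambda>i. k - i"])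
    fix i assume "i \<in> {..k}"
    then have "(-1) ^ (k - i) = (-1) ^ k * (-1 :: complex) ^ i" "k - (k - i) = i" "a + (k - i) = a + k - i"
      by (auto simp: minus_one_power_iff)
    then show "tconst ((-1) ^ (k - i)) * (q_poly (a + (k - i)) * q_poly (k - (k - i))) =
        tconst ((-1) ^ k * (-1) ^ i) * (q_poly (a + k - i) * q_poly i)" by simp
  qed auto
  have sum: "G a k + G k a = q_poly a * q_poly k" if "0 < a" for a k
  proof -
    let ?h = "\<lambda>p. tconst ((-1) ^ p) * (q_poly p * q_poly (a + k - p))"
    have "(\<Sum>p\<in>{a..a + k}. ?h p) = tconst ((-1) ^ a) * G a k"
      unfolding G_def sum_distrib_left
      by (rule sum.reindex_bij_witness[where i = "\<lambda>i. a + i" and j = "\<lambda>p. p - a"])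
         (auto simp: add.commute simp flip: power_add)
    moreover have "(\<Sum>p\<le>a. ?h p) = tconst ((-1) ^ a) * G k a"
      unfolding G_def sum_distrib_left
      by (rule sum.reindex_bij_witness[where i = "\<lambda>i. a - i" and j = "\<lambda>p. a - p"])
         (auto simp: minus_one_power_iff mult.commute add.commute)
    moreover have "sum ?h {..a + k} = sum ?h {..a} + sum ?h {a..a + k} - ?h a"
    proof -
      have "{..a + k} = {..a} \<union> {a..a + k}" "{..a} \<inter> {a..a + k} = {a}" by auto
      then show ?thesis using sum.union_inter[of "{..a}" "{a..a + k}" ?h] by (simp add: algebra_simps)
    qed
    ultimately have "tconst ((-1) ^ a) * (G k a + G a k - q_poly a * q_poly k) = tconst ((-1) ^ a) * 0"
      using q_poly_orthogonality[of "a + k"] that by (simp add: distrib_left right_diff_distrib)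
    then show ?thesis by (subst (asm) tconst_mult_cancel) (auto simp: add.commute)
  qed
  have gt: "Q_gt a k = G a k - tconst (1 / 2) * (q_poly a * q_poly k)" if "0 < k" for a k
  proof -
    have "G a k = q_poly a * q_poly k + (\<Sum>i = 1..k. tconst ((-1) ^ i) * (q_poly (a + i) * q_poly (k - i)))"
      unfolding G_def by (subst atMost_atLeast0, subst sum.atLeast_Suc_atMost) auto
    moreover have "tconst (1 / 2) * (q_poly a * q_poly k) + tconst (1 / 2) * (q_poly a * q_poly k) = q_poly a * q_poly k"
      by (simp flip: distrib_right tconst_add)
    ultimately show ?thesis
      using that by (simp add: Q_gt_def tconst_minus_one_power mult.assoc algebra_simps)
  qed
  have "Q2 a 0 * Q2 k 0 = tconst (1 / complex_of_real (sqrt 2)) * (tconst (1 / complex_of_real (sqrt 2)) * (q_poly a * q_poly k))"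
    using assms by (simp only: Q2_0 mult_ac)
  also have "\<dots> = tconst (1 / 2) * (q_poly a * q_poly k)"
    by (simp flip: of_real_mult)
  finally have rank1: "Q2 a 0 * Q2 k 0 = tconst (1 / 2) * (q_poly a * q_poly k)" .
  have half: "x = tconst (1 / 2) * y + tconst (1 / 2) * y \<longleftrightarrow> x = y" for x y
    by (simp flip: distrib_right tconst_add)
  consider "k < a" | "a < k" | "a = k" by linarith
  then have "G a k = Q2 a k + tconst (1 / 2) * (q_poly a * q_poly k)"
  proof cases
    case 1
    then show ?thesis using assms by (simp add: Q2_def gt)
  next
    case 2
    have "G a k + G k a = tconst (1 / 2) * (q_poly a * q_poly k) + tconst (1 / 2) * (q_poly a * q_poly k)"
      unfolding half by (rule sum[OF assms(1)])
    then show ?thesis using 2 assms by (simp add: Q2_def gt mult.commute[of "q_poly k"]) (simp add: algebra_simps)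
  next
    case 3
    have "tconst 2 * G a a = tconst 2 * (tconst (1 / 2) * (q_poly a * q_poly a))"
    proof -
      have "tconst 2 * x = x + x" for x
        using tconst_add[of 1 1] by (simp only: tconst_1 one_add_one) (simp only: flip: one_add_one, simp only: distrib_right mult_1_left)
      then show ?thesis using sum[of a a] assms by simp
    qed
    then have "G a a = tconst (1 / 2) * (q_poly a * q_poly a)" by (subst (asm) tconst_mult_cancel) auto
    then show ?thesis using 3 by (simp add: Q2_def)
  qed
  then show ?thesis unfolding conv rank1 .
qed

section \<open>Vacuum and uniqueness\<close>

lemma fermion_vacuum:
  "fermion (- int k) 1 = (if k = 0 then tconst (1 / complex_of_real (sqrt 2)) else 0)"
  by (auto simp: fermion_one q_int_def)

text \<open>Up to a constant factor, \<open>X_{-k} f\<close> is \<open>exp_deriv k f\<close> plus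
  multiples of \<open>exp_deriv l f\<close> with l > k. Descending induction from the weight bound
  kills all of these for positive index, and hence all derivatives of f.\<close>

lemma vacuum_constant:
  assumes f: "weight_bounded d f" and ann: "\<And>k. 0 < k \<Longrightarrow> fermion (- int k) f = 0" and "m \<noteq> 0"
  shows "coeff f m = 0"
proof -
  have "exp_deriv j f = 0" if "0 < j" for j
    using that
  proof (induction "d - j" arbitrary: j rule: less_induct)
    case less
    show ?case
    proof (cases "d < j")
      case True
      then show ?thesis by (rule exp_deriv_bounded[OF f])
    next
      case False
      have "0 = tconst (1 / complex_of_real (sqrt 2)) * (\<Sum>l\<le>d. q_int (- int j + int l) * exp_deriv l f)"
        using ann[OF less.prems] fermion_bounded[OF f order_refl, of "- int j"] by simp
      also have "(\<Sum>l\<le>d. q_int (- int j + int l) * exp_deriv l f) = (\<Sum>l\<le>d. if l = j then exp_deriv j f else 0)"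
      proof (rule sum.cong)
        fix l assume l: "l \<in> {..d}"
        consider "l < j" | "l = j" | "j < l" by linarith
        then show "q_int (- int j + int l) * exp_deriv l f = (if l = j then exp_deriv j f else 0)"
        proof cases
          case 3
          then have "exp_deriv l f = 0" using less.hyps[of l] less.prems l by simp
          then show ?thesis using 3 by simp
        qed (auto simp: q_int_def)
      qed simp
      finally have "tconst (1 / complex_of_real (sqrt 2)) * exp_deriv j f = tconst (1 / complex_of_real (sqrt 2)) * 0"
        using False by simp
      then show ?thesis by (subst (asm) tconst_mult_cancel) auto
    qed
  qed
  then have "tderiv k f = 0" if "odd k" for k using tderiv_eq_0 that by blast
  then show ?thesis using constant_if_tderiv_eq_0 \<open>m \<noteq> 0\<close> by blast
qed

lemma coeff_fermion_eq_0:
  assumes "int (weight m) < \<alpha>"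
  shows "coeff (fermion \<alpha> f) m = 0"
proof -
  have "coeff (q_int \<alpha> * f) m = 0"
    using coeff_q_int_mult_nonzero[of \<alpha> f m] assms by force
  then show ?thesis using coeff_fermion[of m \<alpha> 0 f] assms by simp
qed

text \<open>Modes below -K are absent from x, and modes above the weight of m do not reach this
  coefficient.\<close>

lemma coeff_fermion_vec:
  assumes x: "\<And>j. K < j \<Longrightarrow> x (Neg j) = 0" and W: "weight m \<le> W"
  shows "coeff (fermion_vec x f) m = complex_of_real (sqrt 2) * x (Neg 0) * coeff (fermion 0 f) m +
    (\<Sum>\<alpha>\<in>{- int K..int W} - {0}. x (index_of \<alpha>) * coeff (fermion \<alpha> f) m)"
proof -
  let ?F = "\<lambda>\<alpha>. tconst (x (index_of \<alpha>)) * fermion \<alpha> f"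
  define S where "S = Abs_tseries (\<lambda>m. \<Sum>\<alpha>\<in>{\<alpha> \<in> - {0}. coeff (?F \<alpha>) m \<noteq> 0}. coeff (?F \<alpha>) m)"
  have nz: "- int K \<le> \<alpha> \<and> \<alpha> \<le> int (weight m)" if "coeff (?F \<alpha>) m \<noteq> 0" "\<alpha> \<noteq> 0" for \<alpha> m
  proof -
    have "coeff (fermion \<alpha> f) m \<noteq> 0" "x (index_of \<alpha>) \<noteq> 0" using that by auto
    then have "\<alpha> \<le> int (weight m)" using coeff_fermion_eq_0[of m \<alpha> f] by linarith
    moreover have "- int K \<le> \<alpha>"
    proof (rule ccontr)
      assume "\<not> - int K \<le> \<alpha>"
      then have "K < nat (- \<alpha>)" "\<not> \<alpha> > 0" by auto
      then show False using x \<open>x (index_of \<alpha>) \<noteq> 0\<close> by (simp add: index_of_def)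
    qed
    ultimately show ?thesis by simp
  qed
  have "(?F has_sum S) (- {0})"
  proof (rule has_sum_tseriesI)
    fix n
    have "{\<alpha> \<in> - {0}. \<exists>m. weight m < n \<and> coeff (?F \<alpha>) m \<noteq> 0} \<subseteq> {- int K..int n}"
      using nz by fastforce
    then show "finite {\<alpha> \<in> - {0}. \<exists>m. weight m < n \<and> coeff (?F \<alpha>) m \<noteq> 0}" by (rule finite_subset) simp
  qed (simp add: S_def)
  then have "infsum ?F (- {0}) = S" by (rule infsumI)
  then have "coeff (fermion_vec x f) m = complex_of_real (sqrt 2) * x (Neg 0) * coeff (fermion 0 f) m + coeff S m"
    by (simp add: fermion_vec_def)
  also have "coeff S m = (\<Sum>\<alpha>\<in>{- int K..int W} - {0}. coeff (?F \<alpha>) m)"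
    unfolding S_def coeff_Abs
    by (rule sum.mono_neutral_left) (use nz[of _ m] W in force)+
  finally show ?thesis by simp
qed

text \<open>
  Only the part of lowest weight of a difference of two solutions sees the leading term \<open>X\<^sub>-\<^sub>k\<close>,
  and it is a vacuum, hence constant.
\<close>

lemma fermion_vec_solution_unique:
  assumes one: "\<And>k. 0 < k \<Longrightarrow> w k (Neg k) = 1" and zero: "\<And>k j. 0 < k \<Longrightarrow> k < j \<Longrightarrow> w k (Neg j) = 0"
    and f: "\<And>k. 0 < k \<Longrightarrow> fermion_vec (w k) f = 0" and g: "\<And>k. 0 < k \<Longrightarrow> fermion_vec (w k) g = 0"
    and fg: "coeff f 0 = coeff g 0"
  shows "f = g"
proof (rule ccontr)
  assume "f \<noteq> g"
  define h where "h = f + tconst (-1) * g"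
  have h_nz: "\<exists>m. coeff h m \<noteq> 0"
    using \<open>f \<noteq> g\<close> tseries_eqI[of f g] by (auto simp: h_def)
  define d where "d = (LEAST d. \<exists>m. coeff h m \<noteq> 0 \<and> weight m = d)"
  have ex: "\<exists>m. coeff h m \<noteq> 0 \<and> weight m = d"
    unfolding d_def by (rule LeastI_ex) (use h_nz in blast)
  have below: "coeff h m = 0" if "weight m < d" for m
    using not_less_Least[OF that[unfolded d_def]] by blast
  from ex obtain m0 where m0: "coeff h m0 \<noteq> 0" "weight m0 = d" by blast
  have "coeff h 0 = 0" using fg by (simp add: h_def)
  then have "m0 \<noteq> 0" using m0 by auto
  define h\<^sub>d where "h\<^sub>d = Abs_tseries (\<lambda>m. if weight m = d then coeff h m else 0)"
  have bounded: "weight_bounded d h\<^sub>d" by (auto simp: weight_bounded_def h\<^sub>d_def)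
  have "fermion (- int k) h\<^sub>d = 0" if k: "0 < k" for k
  proof (rule tseries_eqI)
    fix m
    show "coeff (fermion (- int k) h\<^sub>d) m = coeff 0 m"
    proof (cases "weight m + k = d")
      case False
      have "eq_at (int (weight m) - - int k) h\<^sub>d 0" using False by (auto simp: eq_at_def h\<^sub>d_def)
      from coeff_fermion_cong[OF this] show ?thesis by simp
    next
      case True
      have vec: "coeff (fermion_vec (w k) u) m = complex_of_real (sqrt 2) * w k (Neg 0) * coeff (fermion 0 u) m +
          (\<Sum>\<alpha>\<in>{- int k..int (weight m)} - {0}. w k (index_of \<alpha>) * coeff (fermion \<alpha> u) m)" for u
        by (rule coeff_fermion_vec) (use zero k in auto)
      have "eq_at (int (weight m) - - int k) h\<^sub>d h" using True by (auto simp: eq_at_def h\<^sub>d_def)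
      then have "coeff (fermion (- int k) h\<^sub>d) m = coeff (fermion (- int k) h) m" by (rule coeff_fermion_cong)
      also have "\<dots> = complex_of_real (sqrt 2) * w k (Neg 0) * coeff (fermion 0 h) m +
          (\<Sum>\<alpha>\<in>{- int k..int (weight m)} - {0}. w k (index_of \<alpha>) * coeff (fermion \<alpha> h) m)"
      proof -
        \<comment> \<open>Modes above -k would have to start from a part of h of degree below
          d.\<close>
        have above: "coeff (fermion \<alpha> h) m = 0" if "- int k < \<alpha>" for \<alpha>
        proof -
          have "eq_at (int (weight m) - \<alpha>) h 0" using that True below by (auto simp: eq_at_def)
          from coeff_fermion_cong[OF this] show ?thesis by simp
        qed
        have "(\<Sum>\<alpha>\<in>{- int k..int (weight m)} - {0}. w k (index_of \<alpha>) * coeff (fermion \<alpha> h) m) =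
            (\<Sum>\<alpha>\<in>{- int k}. w k (index_of \<alpha>) * coeff (fermion \<alpha> h) m)"
          by (rule sum.mono_neutral_right) (use k above in auto)
        then show ?thesis using above[of 0] k one by (simp add: index_of_def)
      qed
      also have "\<dots> = coeff (fermion_vec (w k) f) m + (-1) * coeff (fermion_vec (w k) g) m"
        unfolding vec h_def
          fermion_add fermion_tconst_mult coeff_add coeff_tconst_mult
        by (simp add: algebra_simps sum.distrib sum_negf sum_subtractf)
      finally show ?thesis using f g k by simp
    qed
  qed
  then have "coeff h\<^sub>d m0 = 0" by (rule vacuum_constant[OF bounded]) (use \<open>m0 \<noteq> 0\<close> in auto)
  then show False using m0 by (simp add: h\<^sub>d_def)
qed

section \<open>The fermions on Schur \<open>Q\<close>-functions\<close>

lemma rank_sign_tconst: "rank_sign k T = tconst (rank_sign k T)"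
  by (simp add: rank_sign_def tconst_minus_one_power)

lemma subset_pf_tconst:
  assumes "finite S"
  shows "subset_pf (\<lambda>i j. tconst (A i j)) S = tconst (subset_pf A S)"
  using assms
proof (induction rule: finite_max_induct)
  case (insert m T)
  have "subset_pf (\<lambda>i j. tconst (A i j)) (insert m T) =
      (\<Sum>j\<in>T. rank_sign j T * tconst (A m j) * subset_pf (\<lambda>i j. tconst (A i j)) (T - {j}))"
    by (rule subset_pf_insert_max) (use insert in auto)
  also have "\<dots> = (\<Sum>j\<in>T. tconst (rank_sign j T * A m j * subset_pf A (T - {j})))"
  proof (rule sum.cong)
    fix j assume "j \<in> T"
    have "subset_pf (\<lambda>i j. tconst (A i j)) (T - {j}) = tconst (subset_pf A (T - {j}))"
      by (rule insert(3)) (use insert(1) in \<open>auto intro!: card_mono\<close>)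
    then show "rank_sign j T * tconst (A m j) * subset_pf (\<lambda>i j. tconst (A i j)) (T - {j}) =
        tconst (rank_sign j T * A m j * subset_pf A (T - {j}))"
      by (simp add: rank_sign_tconst[of j T] tconst_mult)
  qed simp
  also have "\<dots> = tconst (subset_pf A (insert m T))"
    using subset_pf_insert_max[of T m A] insert by (simp add: tconst_sum)
  finally show ?case .
qed simp

lemma homogeneous_Q_gt: "homogeneous (a + b) (Q_gt a b)"
proof (cases "b = 0")
  case False
  have "homogeneous (a + b) (tconst (1 / 2) * (q_poly a * q_poly b))"
    by (intro homogeneous_tconst_mult homogeneous_mult homogeneous_q_poly)
  moreover have "homogeneous (a + b) ((-1) ^ k * q_poly (a + k) * q_poly (b - k))" if "k \<in> {1..b}" for k
  proof -
    have "homogeneous (a + k + (b - k)) (tconst ((-1) ^ k) * (q_poly (a + k) * q_poly (b - k)))"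
      by (intro homogeneous_tconst_mult homogeneous_mult homogeneous_q_poly)
    then show ?thesis using that by (simp add: tconst_minus_one_power mult.assoc)
  qed
  then have "homogeneous (a + b) (\<Sum>k = 1..b. (-1) ^ k * q_poly (a + k) * q_poly (b - k))"
    by (rule homogeneous_sum)
  ultimately show ?thesis using False unfolding Q_gt_def homogeneous_def mult.assoc[symmetric] by force
qed (simp add: Q_gt_def homogeneous_tconst_mult homogeneous_q_poly)

lemma homogeneous_Q2: "homogeneous (a + b) (Q2 a b)"
  using homogeneous_Q_gt[of a b] homogeneous_Q_gt[of b a] by (simp add: Q2_def add.commute)

lemma homogeneous_subset_pf_Q2:
  assumes "finite S"
  shows "homogeneous (\<Sum>S) (subset_pf Q2 S)"
  using assms
proof (induction rule: finite_max_induct)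
  case (insert m T)
  have mT: "m \<notin> T" using insert(2) by auto
  have "homogeneous (\<Sum>(insert m T)) (rank_sign j T * Q2 m j * subset_pf Q2 (T - {j}))" if j: "j \<in> T" for j
  proof -
    have "homogeneous (\<Sum>(T - {j})) (subset_pf Q2 (T - {j}))"
      by (rule insert(3)) (use insert(1) in \<open>auto intro!: card_mono\<close>)
    then have "homogeneous (m + j + \<Sum>(T - {j})) (tconst (rank_sign j T) * (Q2 m j * subset_pf Q2 (T - {j})))"
      by (intro homogeneous_tconst_mult homogeneous_mult homogeneous_Q2)
    moreover have "m + j + \<Sum>(T - {j}) = \<Sum>(insert m T)"
      using sum.remove[OF insert(1) j, of "\<lambda>x. x"] insert(1) mT by simp
    ultimately show ?thesis by (simp add: rank_sign_tconst[of j T] mult.assoc)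
  qed
  then have "homogeneous (\<Sum>(insert m T)) (\<Sum>j\<in>T. rank_sign j T * Q2 m j * subset_pf Q2 (T - {j}))"
    by (rule homogeneous_sum)
  then show ?case using subset_pf_insert_max[of T m Q2] insert by simp
qed simp

abbreviation Q_set :: "nat set \<Rightarrow> tseries" where
  "Q_set \<equiv> aug_pf Q2"

lemma homogeneous_Q_set:
  assumes "finite T" "0 \<notin> T"
  shows "homogeneous (\<Sum>T) (Q_set T)"
  using homogeneous_subset_pf_Q2[of T] homogeneous_subset_pf_Q2[of "insert 0 T"] assms by (simp add: aug_pf_def)

text \<open>These rules are isolated for one T because they imply the creation rule for T, which in
  turn yields the rules for T with a larger part adjoined.\<close>

definition annihilates :: "nat set \<Rightarrow> bool" where
  "annihilates T \<longleftrightarrow>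
    (\<forall>k>0. fermion (- int k) (Q_set T) = (if k \<in> T then tconst ((-1) ^ k * rank_sign k T) * Q_set (T - {k}) else 0)) \<and>
    fermion 0 (Q_set T) = tconst ((-1) ^ card T / complex_of_real (sqrt 2)) * Q_set T"

text \<open>By \<open>fermion_expand\<close> the operator \<open>X_a\<close> is a combination of
  operators known on \<open>Q_set T\<close>. By \<open>q_conv_eq_Q2\<close> the terms with k in T
  form the row expansion with its rank one correction, and the term k = 0 is the corner term of
  \<open>aug_pf_row\<close>.\<close>

lemma creates_if_annihilates:
  assumes T: "finite T" "0 \<notin> T" and ann: "annihilates T" and a: "0 < a"
  shows "fermion (int a) (Q_set T) = (if a \<in> T then 0 else tconst (rank_sign a T) * Q_set (insert a T))"
proof -
  define D where "D = \<Sum>T"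
  have TD: "T \<subseteq> {..D}" unfolding D_def using T(1) by (auto intro: member_le_sum)
  have "fermion (int a) (Q_set T) = (\<Sum>k\<le>D. q_conv a k * fermion (- int k) (Q_set T))"
    unfolding D_def by (rule fermion_expand[OF weight_bounded_homogeneous[OF homogeneous_Q_set[OF T]] order_refl])
  also have "\<dots> = (\<Sum>k\<in>insert 0 T. q_conv a k * fermion (- int k) (Q_set T))"
    by (rule sum.mono_neutral_right) (use TD ann in \<open>auto simp: annihilates_def\<close>)
  also have "\<dots> = q_poly a * fermion 0 (Q_set T) + (\<Sum>k\<in>T. q_conv a k * fermion (- int k) (Q_set T))"
    using T by simp
  also have "(\<Sum>k\<in>T. q_conv a k * fermion (- int k) (Q_set T)) =
      (\<Sum>k\<in>T. rank_sign k T * (Q2 a k + Q2 a 0 * Q2 k 0) * Q_set (T - {k}))"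
  proof (rule sum.cong)
    fix k assume k: "k \<in> T"
    then have "0 < k" using T by (metis neq0_conv)
    have "q_conv a k * fermion (- int k) (Q_set T) =
        q_conv a k * (tconst ((-1) ^ k * rank_sign k T) * Q_set (T - {k}))"
      using ann k \<open>0 < k\<close> by (simp add: annihilates_def)
    also have "\<dots> = rank_sign k T * (tconst ((-1) ^ k) * q_conv a k) * Q_set (T - {k})"
      unfolding rank_sign_tconst[of k T] tconst_mult by (simp only: mult_ac)
    finally show "q_conv a k * fermion (- int k) (Q_set T) =
        rank_sign k T * (Q2 a k + Q2 a 0 * Q2 k 0) * Q_set (T - {k})"
      unfolding q_conv_eq_Q2[OF a \<open>0 < k\<close>] .
  qed simp
  also have "q_poly a * fermion 0 (Q_set T) = (-1) ^ card T * Q2 a 0 * Q_set T"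
  proof -
    have "fermion 0 (Q_set T) = tconst ((-1) ^ card T * (1 / complex_of_real (sqrt 2))) * Q_set T"
      using ann by (simp add: annihilates_def)
    then show ?thesis
      unfolding Q2_0[OF a] tconst_mult tconst_minus_one_power by (simp only: mult_ac)
  qed
  also have "(-1) ^ card T * Q2 a 0 * Q_set T + (\<Sum>k\<in>T. rank_sign k T * (Q2 a k + Q2 a 0 * Q2 k 0) * Q_set (T - {k})) =
      (if a \<in> T then 0 else rank_sign a T * Q_set (insert a T))"
    using aug_pf_row[where A = Q2 and k = a and T = T, OF Q2_skew T a] by (simp add: add.commute)
  finally show ?thesis by (simp add: rank_sign_tconst[of a T])
qed

text \<open>With m the largest part, the series for \<open>insert m T\<close> is \<open>X_m\<close>
  applied to that for T, and the Clifford relation moves \<open>X_{-k}\<close> past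
  \<open>X_m\<close>. The rules are needed for \<open>T - {k}\<close> as well, since m is then
  adjoined to that set.\<close>

lemma annihilates:
  assumes "finite T" "0 \<notin> T"
  shows "annihilates T"
  using assms
proof (induction rule: finite_max_induct)
  case empty
  show ?case using fermion_vacuum by (simp add: annihilates_def) (metis fermion_vacuum of_nat_0 minus_zero)
next
  case (insert m T)
  have mT: "m \<notin> T" using insert(2) by auto
  have T: "finite T" "0 \<notin> T" and m: "0 < m" using insert by auto
  have annT: "annihilates T" by (rule insert(3)) (use T in auto)
  let ?f = "Q_set T"
  have create: "fermion (int m) (Q_set U) = Q_set (insert m U)" if "U \<subseteq> T" "annihilates U" for U
  proof -
    have "rank_sign m U = (1 :: complex)" by (rule rank_sign_above) (use that insert(2) in force)
    moreover have "finite U" "0 \<notin> U" "m \<notin> U" using that T mT finite_subset[OF that(1) T(1)] by auto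
    ultimately show ?thesis using creates_if_annihilates[of U m] that(2) m by simp
  qed
  have anti: "fermion (- int k) (Q_set (insert m T)) =
      (if k = m then tconst ((-1) ^ k) * ?f else 0) - fermion (int m) (fermion (- int k) ?f)" for k
  proof -
    have "fermion (- int k) (fermion (int m) ?f) + fermion (int m) (fermion (- int k) ?f) =
        (if k = m then tconst ((-1) ^ k) * ?f else 0)"
      using fermion_anticommute[OF homogeneous_Q_set[OF T], of "- int k" "int m"]
      by (auto simp: parity_sign_def minus_one_power_iff)
    then show ?thesis unfolding create[OF order_refl annT] by (simp add: algebra_simps)
  qed
  show ?case
    unfolding annihilates_def
  proof (intro conjI allI impI)
    fix k :: nat assume k: "0 < k"
    consider "k = m" | "k \<in> T" "k \<noteq> m" | "k \<notin> T" "k \<noteq> m" by blast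
    then show "fermion (- int k) (Q_set (insert m T)) = (if k \<in> insert m T
        then tconst ((-1) ^ k * rank_sign k (insert m T)) * Q_set (insert m T - {k}) else 0)"
    proof cases
      case 1
      then have "fermion (- int k) ?f = 0" using annT k mT by (simp add: annihilates_def)
      moreover have "rank_sign m (insert m T) = (1 :: complex)"
        by (rule rank_sign_above) (use insert(2) in force)
      ultimately show ?thesis using anti[of k] 1 mT by simp
    next
      case 2
      have ann: "annihilates (T - {k})"
        by (rule insert(3)) (use T in \<open>auto intro!: card_mono\<close>)
      have "fermion (- int k) ?f = tconst ((-1) ^ k * rank_sign k T) * Q_set (T - {k})"
        using annT k 2 by (simp add: annihilates_def)
      then have "fermion (int m) (fermion (- int k) ?f) = tconst ((-1) ^ k * rank_sign k T) * Q_set (insert m (T - {k}))"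
        using create[OF _ ann] by (simp add: fermion_tconst_mult)
      moreover have "insert m T - {k} = insert m (T - {k})" using 2 by auto
      moreover have "rank_sign k (insert m T) = - (rank_sign k T :: complex)"
        using rank_sign_insert[OF T(1) mT, of k, where 'a = complex] insert(2) 2 by simp
      ultimately show ?thesis using anti[of k] 2 by (simp add: tconst_minus)
    next
      case 3
      then have "fermion (- int k) ?f = 0" using annT k by (simp add: annihilates_def)
      then show ?thesis using anti[of k] 3 by simp
    qed
  next
    have "fermion 0 (Q_set (insert m T)) = - fermion (int m) (fermion 0 ?f)"
      using anti[of 0] m by simp
    also have "\<dots> = tconst ((-1) ^ card (insert m T) / complex_of_real (sqrt 2)) * Q_set (insert m T)"
      using annT create[OF order_refl annT] T mT by (simp add: annihilates_def fermion_tconst_mult tconst_minus)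
    finally show "fermion 0 (Q_set (insert m T)) =
        tconst ((-1) ^ card (insert m T) / complex_of_real (sqrt 2)) * Q_set (insert m T)" .
  qed
qed

lemma fermion_neg_Q_set:
  assumes "finite T" "0 \<notin> T" "0 < k"
  shows "fermion (- int k) (Q_set T) = (if k \<in> T then tconst ((-1) ^ k * rank_sign k T) * Q_set (T - {k}) else 0)"
  using annihilates[OF assms(1,2)] assms(3) by (auto simp: annihilates_def)

lemma fermion_0_Q_set:
  assumes "finite T" "0 \<notin> T"
  shows "fermion 0 (Q_set T) = tconst ((-1) ^ card T / complex_of_real (sqrt 2)) * Q_set T"
  using annihilates[OF assms] by (simp add: annihilates_def)

lemma fermion_pos_Q_set:
  assumes "finite T" "0 \<notin> T" "0 < k"
  shows "fermion (int k) (Q_set T) = (if k \<in> T then 0 else tconst (rank_sign k T) * Q_set (insert k T))"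
  by (rule creates_if_annihilates[OF assms(1,2) annihilates[OF assms(1,2)] assms(3)])

section \<open>The infinite Pfaffian as a sum over strict partitions\<close>

lemma skewD:
  assumes "skew r"
  shows "r i j = - r j i" "r i i = 0"
proof -
  show "r i j = - r j i" using assms unfolding skew_def by blast
  have "r i i = - r i i" using assms unfolding skew_def by blast
  then show "r i i = 0" by simp
qed

text \<open>The involution f reverses the row numbers, because \<open>subset_pf\<close> lists rows
  decreasingly. The block Q has entries \<open>- Q2\<close>; their sign cancels the one from the
  reversed labels of R.\<close>

lemma truncated_pf_eq:
  assumes "skew r"
  shows "truncated_pf r n = (\<Sum>T\<in>Pow {1..n}. tconst (aug_pf r T) * Q_set T)"
proof -
  note r = skewD[OF assms]
  define f where "f i = (if i \<le> 2 * n + 1 then 2 * n + 1 - i else i)" for i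
  have ff: "f (f i) = i" for i by (simp add: f_def)
  let ?M = "\<lambda>x y. block_matrix r n (f x) (f y)"
  let ?R = "\<lambda>i j. tconst (r i j)"
  have "truncated_pf r n = pfaffian (n + 1) (\<lambda>i j. ?M (f i) (f j))"
    by (simp add: truncated_pf_def ff)
  also have "\<dots> = subset_pf ?M (f ` {..<2 * (n + 1)})"
    by (rule pfaffian_eq_subset_pf) (auto simp: f_def)
  also have "f ` {..<2 * (n + 1)} = {..<2 * n + 2}"
  proof (intro equalityI subsetI)
    fix x assume "x \<in> {..<2 * n + 2}"
    then have "f x \<in> {..<2 * (n + 1)}" "x = f (f x)" by (auto simp: f_def)
    then show "x \<in> f ` {..<2 * (n + 1)}" by (rule rev_image_eqI)
  qed (auto simp: f_def)
  also have "subset_pf ?M {..<2 * n + 2} =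
      (\<Sum>S\<in>Pow {..n}. subset_pf (\<lambda>i j. - Q2 i j) S * ((-1) ^ (card S div 2) * subset_pf ?R S))"
  proof (rule subset_pf_block)
    show "- Q2 i j = - (- Q2 j i)" "- Q2 i i = 0" for i j using Q2_skew(1)[of i j] Q2_skew(2)[of i] by auto
    show "?R i j = - ?R j i" "?R i i = 0" for i j
      using arg_cong[OF r(1)[of i j], of tconst] r(2)[of i] by (simp_all add: tconst_minus)
  next
    fix x y assume xy: "y < x" "x < 2 * n + 2"
    then have f: "f x = 2 * n + 1 - x" "f y = 2 * n + 1 - y" by (auto simp: f_def)
    consider "n < y" | "x \<le> n" | "y \<le> n" "n < x" by linarith
    then show "block_matrix r n (f x) (f y) =
        (if n < y then - Q2 (x - (n + 1)) (y - (n + 1)) else if x \<le> n then ?R (n - x) (n - y)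
         else if x + y = 2 * n + 1 then 1 else 0)"
    proof cases
      case 1
      then have "f x \<le> n" "f y \<le> n" "n - f x = x - (n + 1)" "n - f y = y - (n + 1)" using xy f by auto
      moreover have "y - (n + 1) < x - (n + 1)" using 1 xy by auto
      ultimately show ?thesis using 1 by (simp add: block_matrix_def Q_entry_def)
    next
      case 2
      then have "\<not> f x \<le> n" "\<not> f y \<le> n" "f x - (n + 1) = n - x" "f y - (n + 1) = n - y" using xy f by auto
      then show ?thesis using 2 xy by (simp add: block_matrix_def)
    next
      case 3
      then have "f x \<le> n" "\<not> f y \<le> n" "f x + (f y - (n + 1)) = n \<longleftrightarrow> x + y = 2 * n + 1" using xy f by auto
      then show ?thesis using 3 by (simp add: block_matrix_def anti_diag_def)
    qed
  qed
  also have "\<dots> = (\<Sum>S\<in>Pow {..n}. tconst (subset_pf r S) * subset_pf Q2 S)"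
  proof (rule sum.cong)
    fix S assume "S \<in> Pow {..n}"
    then have fin: "finite S" by (auto intro: finite_subset)
    have "subset_pf (\<lambda>i j. - Q2 i j) S * ((-1) ^ (card S div 2) * subset_pf ?R S) =
        ((-1) ^ (card S div 2) * (-1) ^ (card S div 2)) * (tconst (subset_pf r S) * subset_pf Q2 S)"
      unfolding subset_pf_uminus[OF fin] subset_pf_tconst[OF fin] by (simp only: mult_ac)
    then show "subset_pf (\<lambda>i j. - Q2 i j) S * ((-1) ^ (card S div 2) * subset_pf ?R S) =
        tconst (subset_pf r S) * subset_pf Q2 S" by (simp flip: power_add mult_2)
  qed simp
  also have "\<dots> = (\<Sum>T\<in>Pow {1..n}. if even (card T) then tconst (subset_pf r T) * subset_pf Q2 T
      else tconst (subset_pf r (insert 0 T)) * subset_pf Q2 (insert 0 T))"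
    by (rule sum_Pow_aug_pf) (simp add: subset_pf_odd finite_subset[OF _ finite_atMost])
  also have "\<dots> = (\<Sum>T\<in>Pow {1..n}. tconst (aug_pf r T) * Q_set T)"
    by (rule sum.cong) (auto simp: aug_pf_def)
  finally show ?thesis .
qed

text \<open>The term of T is homogeneous of degree the sum of T, so parts exceeding the weight of m
  contribute nothing to this coefficient, and the limit has finite coefficient formulas.\<close>

definition tau_series :: "(nat \<Rightarrow> nat \<Rightarrow> complex) \<Rightarrow> tseries" where
  "tau_series r = Abs_tseries (\<lambda>m. \<Sum>T\<in>Pow {1..weight m}. aug_pf r T * coeff (Q_set T) m)"

lemma coeff_tau_series:
  assumes "weight m \<le> n"
  shows "coeff (tau_series r) m = coeff (\<Sum>T\<in>Pow {1..n}. tconst (aug_pf r T) * Q_set T) m"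
proof -
  have "aug_pf r T * coeff (Q_set T) m = 0" if "T \<in> Pow {1..n} - Pow {1..weight m}" for T
  proof -
    have T: "finite T" "0 \<notin> T" using that by (auto intro: finite_subset)
    have "\<not> T \<subseteq> {1..weight m}" using that by blast
    then obtain x where x: "x \<in> T" "x \<notin> {1..weight m}" by blast
    then have "weight m < x" using T by (metis atLeastAtMost_iff neq0_conv not_less Suc_leI One_nat_def)
    also have "x \<le> \<Sum>T" using x T by (auto intro: member_le_sum)
    finally have "coeff (Q_set T) m = 0" using homogeneous_Q_set[OF T] by (auto simp: homogeneous_def)
    then show ?thesis by simp
  qed
  then have "(\<Sum>T\<in>Pow {1..n}. aug_pf r T * coeff (Q_set T) m) = (\<Sum>T\<in>Pow {1..weight m}. aug_pf r T * coeff (Q_set T) m)"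
    by (intro sum.mono_neutral_right) (use assms in auto)
  then show ?thesis by (simp add: tau_series_def)
qed

lemma truncated_pf_tendsto:
  assumes "skew r"
  shows "truncated_pf r \<longlonglongrightarrow> tau_series r"
  unfolding tendsto_tseries_iff
proof
  fix N
  have "agree_below N (tau_series r) (truncated_pf r n)" if "N \<le> n" for n
    using that coeff_tau_series by (auto simp: agree_below_def truncated_pf_eq[OF assms])
  then show "eventually (\<lambda>n. agree_below N (tau_series r) (truncated_pf r n)) sequentially"
    unfolding eventually_sequentially by blast
qed

lemma infinite_pf_eq: "skew r \<Longrightarrow> infinite_pf r = tau_series r"
  unfolding infinite_pf_def by (rule limI) (rule truncated_pf_tendsto)

lemma inj_on_set_DP: "inj_on set DP"
proof (rule inj_onI)
  fix x y :: "nat list" assume "x \<in> DP" "y \<in> DP" "set x = set y"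
  then have "sorted_wrt (<) (rev x)" "sorted_wrt (<) (rev y)" "set (rev x) = set (rev y)"
    by (auto simp: DP_def sorted_wrt_rev)
  then have "rev x = rev y" using strict_sorted_equal by blast
  then show "x = y" by simp
qed

lemma set_image_DP:
  assumes "finite T" "0 \<notin> T"
  shows "T \<in> set ` DP"
proof
  show "T = set (rev (sorted_list_of_set T))" using assms by simp
  show "rev (sorted_list_of_set T) \<in> DP" using assms by (simp add: DP_def sorted_wrt_rev)
qed

lemma has_sum_tau_series:
  "((\<lambda>\<nu>. tconst (pf_at r \<nu>) * schur_Q \<nu>) has_sum tau_series r) DP"
proof (rule has_sum_tseriesI)
  let ?F = "\<lambda>\<nu>. tconst (pf_at r \<nu>) * schur_Q \<nu>"
  have F: "?F \<nu> = tconst (aug_pf r (set \<nu>)) * Q_set (set \<nu>)" if "\<nu> \<in> DP" for \<nu>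
    using that by (simp add: schur_Q_def pf_at_eq_aug_pf)
  have sub: "set \<nu> \<in> Pow {1..weight m}" if \<nu>: "\<nu> \<in> DP" and nz: "coeff (?F \<nu>) m \<noteq> 0" for \<nu> m
  proof -
    have T: "finite (set \<nu>)" "0 \<notin> set \<nu>" using \<nu> by (auto simp: DP_def)
    have "coeff (Q_set (set \<nu>)) m \<noteq> 0" using nz F[OF \<nu>] by auto
    then have w: "weight m = \<Sum>(set \<nu>)" using homogeneous_Q_set[OF T] by (auto simp: homogeneous_def)
    have "x \<le> weight m" if "x \<in> set \<nu>" for x unfolding w using that by (auto intro: member_le_sum)
    then show ?thesis using T(2) by (auto simp: Suc_le_eq intro!: Nat.gr0I)
  qed
  show "finite {\<nu> \<in> DP. \<exists>m. weight m < n \<and> coeff (?F \<nu>) m \<noteq> 0}" for n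
  proof (rule finite_imageD)
    show "finite (set ` {\<nu> \<in> DP. \<exists>m. weight m < n \<and> coeff (?F \<nu>) m \<noteq> 0})"
    proof (rule finite_subset)
      show "set ` {\<nu> \<in> DP. \<exists>m. weight m < n \<and> coeff (?F \<nu>) m \<noteq> 0} \<subseteq> Pow {..n}"
        using sub by fastforce
    qed simp
    show "inj_on set {\<nu> \<in> DP. \<exists>m. weight m < n \<and> coeff (?F \<nu>) m \<noteq> 0}"
      by (rule inj_on_subset[OF inj_on_set_DP]) auto
  qed
  fix m
  let ?N = "{\<nu> \<in> DP. coeff (?F \<nu>) m \<noteq> 0}"
  have "(\<Sum>\<nu>\<in>?N. coeff (?F \<nu>) m) = (\<Sum>\<nu>\<in>?N. aug_pf r (set \<nu>) * coeff (Q_set (set \<nu>)) m)"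
    by (rule sum.cong) (use F in auto)
  also have "\<dots> = (\<Sum>T\<in>set ` ?N. aug_pf r T * coeff (Q_set T) m)"
  proof -
    have "inj_on set ?N" by (rule inj_on_subset[OF inj_on_set_DP]) auto
    then show ?thesis by (simp only: sum.reindex o_def)
  qed
  also have "\<dots> = (\<Sum>T\<in>Pow {1..weight m}. aug_pf r T * coeff (Q_set T) m)"
  proof (rule sum.mono_neutral_left)
    show "set ` ?N \<subseteq> Pow {1..weight m}" using sub by blast
    show "\<forall>T\<in>Pow {1..weight m} - set ` ?N. aug_pf r T * coeff (Q_set T) m = 0"
    proof
      fix T assume T: "T \<in> Pow {1..weight m} - set ` ?N"
      then have "T \<in> set ` DP" by (intro set_image_DP) (auto intro: finite_subset)
      then obtain \<nu> where \<nu>: "\<nu> \<in> DP" "T = set \<nu>" by auto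
      then have "coeff (?F \<nu>) m = 0" using T by auto
      then show "aug_pf r T * coeff (Q_set T) m = 0" unfolding F[OF \<nu>(1)] \<nu>(2) by simp
    qed
  qed simp
  finally show "coeff (tau_series r) m = (\<Sum>\<nu>\<in>?N. coeff (?F \<nu>) m)" by (simp add: tau_series_def)
qed

lemma coeff_tau_series_0: "coeff (tau_series r) 0 = 1"
  by (simp add: tau_series_def coeff_one)

text \<open>The reduced basis vectors of \<open>{x \<in> U. x\<^sub>-\<^sub>0 = x\<^sub>+\<^sub>0}\<close> are the \<open>cell_vec r k\<close> with \<open>k > 0\<close>.\<close>

definition cell_coeff :: "(nat \<Rightarrow> nat \<Rightarrow> complex) \<Rightarrow> nat \<Rightarrow> nat \<Rightarrow> complex" where
  "cell_coeff r k j = - ((-1) ^ k * (if j = 0 then r k 0 else r k j + r k 0 * r j 0))"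

definition cell_vec :: "(nat \<Rightarrow> nat \<Rightarrow> complex) \<Rightarrow> nat \<Rightarrow> vec" where
  "cell_vec r k \<alpha> = (case \<alpha> of Pos j \<Rightarrow> cell_coeff r k j
     | Neg j \<Rightarrow> if j = 0 then cell_coeff r k 0 else if j = k then 1 else 0)"

text \<open>Compare the coefficients of \<open>Q_set T\<close>: annihilation contributes the
  Pfaffian of T with k adjoined, creation those of T with one part removed, and \<open>X_0\<close>
  the corner term of \<open>aug_pf_row\<close> for R. As k and all j are at most n, no set outside
  the truncation enters.\<close>

lemma truncated_tau_annihilated:
  assumes "skew r" and k: "0 < k" "k \<le> n"
  defines "\<tau> \<equiv> \<Sum>T\<in>Pow {1..n}. tconst (aug_pf r T) * Q_set T"
  shows "fermion (- int k) \<tau> + tconst (complex_of_real (sqrt 2) * cell_coeff r k 0) * fermion 0 \<tau> +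
    (\<Sum>j = 1..n. tconst (cell_coeff r k j) * fermion (int j) \<tau>) = 0"
proof -
  note r = skewD[OF assms(1)]
  let ?g = "aug_pf r" and ?P = "Pow {1..n}"
  have fin: "finite T" "0 \<notin> T" if "T \<in> ?P" for T using that by (auto intro: finite_subset)
  have kn: "insert k ({1..n} - {k}) = {1..n}" using k by auto
  have neg: "fermion (- int k) \<tau> = (\<Sum>T\<in>?P. tconst (if k \<in> T then 0 else (-1) ^ k * rank_sign k T * ?g (insert k T)) * Q_set T)"
  proof -
    have "fermion (- int k) \<tau> = (\<Sum>T\<in>?P. if k \<in> T then tconst (?g T * ((-1) ^ k * rank_sign k T)) * Q_set (T - {k}) else 0)"
      unfolding \<tau>_def fermion_sum fermion_tconst_mult
      by (rule sum.cong) (auto simp: fermion_neg_Q_set fin k)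
    also have "\<dots> = (\<Sum>T\<in>{T\<in>?P. k \<in> T}. tconst (?g T * ((-1) ^ k * rank_sign k T)) * Q_set (T - {k}))"
      by (rule sum.mono_neutral_cong_right) auto
    also have "\<dots> = (\<Sum>T\<in>{T\<in>?P. k \<notin> T}. tconst ((-1) ^ k * rank_sign k T * ?g (insert k T)) * Q_set T)"
      by (rule sum.reindex_bij_witness[where i = "insert k" and j = "\<lambda>T. T - {k}"])
         (use k in \<open>auto simp: insert_absorb mult_ac\<close>)
    also have "\<dots> = (\<Sum>T\<in>?P. tconst (if k \<in> T then 0 else (-1) ^ k * rank_sign k T * ?g (insert k T)) * Q_set T)"
      by (rule sum.mono_neutral_cong_left) auto
    finally show ?thesis .
  qed
  have zero: "tconst (complex_of_real (sqrt 2) * cell_coeff r k 0) * fermion 0 \<tau> =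
      (\<Sum>T\<in>?P. tconst (cell_coeff r k 0 * (-1) ^ card T * ?g T) * Q_set T)"
    unfolding \<tau>_def fermion_sum fermion_tconst_mult sum_distrib_left
  proof (rule sum.cong)
    fix T assume T: "T \<in> ?P"
    \<comment> \<open>The factor sqrt 2 in the definition of X(x) cancels the 1/sqrt 2 in the action
      of \<open>X_0\<close>.\<close>
    have e: "complex_of_real (sqrt 2) * c * (g * (s / complex_of_real (sqrt 2))) = c * s * g" for c g s :: complex
      by simp
    show "tconst (complex_of_real (sqrt 2) * cell_coeff r k 0) * (tconst (?g T) * fermion 0 (Q_set T)) =
        tconst (cell_coeff r k 0 * (-1) ^ card T * ?g T) * Q_set T"
      unfolding fermion_0_Q_set[OF fin[OF T]] tconst_mult_tconst e ..
  qed simp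
  have pos: "(\<Sum>j = 1..n. tconst (cell_coeff r k j) * fermion (int j) \<tau>) =
      (\<Sum>T\<in>?P. tconst (\<Sum>j\<in>T. cell_coeff r k j * rank_sign j T * ?g (T - {j})) * Q_set T)"
  proof -
    have "(\<Sum>j = 1..n. tconst (cell_coeff r k j) * fermion (int j) \<tau>) =
        (\<Sum>j = 1..n. \<Sum>T\<in>Pow ({1..n} - {j}). tconst (cell_coeff r k j * rank_sign j T * ?g T) * Q_set (insert j T))"
    proof (rule sum.cong)
      fix j assume j: "j \<in> {1..n}"
      have "tconst (cell_coeff r k j) * fermion (int j) \<tau> =
          (\<Sum>T\<in>?P. if j \<in> T then 0 else tconst (cell_coeff r k j * rank_sign j T * ?g T) * Q_set (insert j T))"
        unfolding \<tau>_def fermion_sum fermion_tconst_mult sum_distrib_left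
        by (rule sum.cong)
           (use j in \<open>auto simp: fermion_pos_Q_set fin tconst_mult mult_ac simp del: tconst_mult_tconst\<close>)
      also have "\<dots> = (\<Sum>T\<in>Pow ({1..n} - {j}). tconst (cell_coeff r k j * rank_sign j T * ?g T) * Q_set (insert j T))"
        by (rule sum.mono_neutral_cong_right) auto
      finally show "tconst (cell_coeff r k j) * fermion (int j) \<tau> = \<dots>" .
    qed simp
    also have "\<dots> = (\<Sum>T\<in>?P. \<Sum>j\<in>T. tconst (cell_coeff r k j * rank_sign j (T - {j}) * ?g (T - {j})) * Q_set (insert j (T - {j})))"
      by (rule sum_Pow_member[symmetric]) simp
    also have "\<dots> = (\<Sum>T\<in>?P. tconst (\<Sum>j\<in>T. cell_coeff r k j * rank_sign j T * ?g (T - {j})) * Q_set T)"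
      by (intro sum.cong refl) (simp add: tconst_sum sum_distrib_right insert_absorb)
    finally show ?thesis .
  qed
  have coeff0: "(if k \<in> T then 0 else (-1) ^ k * rank_sign k T * ?g (insert k T)) + cell_coeff r k 0 * (-1) ^ card T * ?g T +
      (\<Sum>j\<in>T. cell_coeff r k j * rank_sign j T * ?g (T - {j})) = 0" if T: "T \<in> ?P" for T
  proof -
    have sum1: "(\<Sum>j\<in>T. cell_coeff r k j * rank_sign j T * ?g (T - {j})) =
        - ((-1) ^ k * (\<Sum>j\<in>T. rank_sign j T * (r k j + r k 0 * r j 0) * ?g (T - {j})))"
      unfolding sum_distrib_left sum_negf[symmetric]
      by (rule sum.cong) (use fin[OF T] in \<open>auto simp: cell_coeff_def mult_ac\<close>)
    have sum2: "(\<Sum>j\<in>T. rank_sign j T * (r k j + r k 0 * r j 0) * ?g (T - {j})) =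
        (if k \<in> T then 0 else rank_sign k T * ?g (insert k T)) - (-1) ^ card T * r k 0 * ?g T"
      using aug_pf_row[where A = r and k = k and T = T, OF r fin[OF T] k(1)]
      by (simp only: eq_diff_eq)
    have "(if k \<in> T then 0 else (-1) ^ k * rank_sign k T * ?g (insert k T)) =
        (-1) ^ k * (if k \<in> T then 0 else rank_sign k T * ?g (insert k T))" by simp
    then show ?thesis unfolding sum1 sum2
      by (simp only: cell_coeff_def if_True refl) (simp add: right_diff_distrib mult.assoc)
  qed
  show ?thesis
    unfolding neg zero pos sum.distrib[symmetric] distrib_right[symmetric] tconst_add[symmetric]
    by (rule sum.neutral) (use coeff0 in simp)
qed

lemma tau_series_annihilated:
  assumes "skew r" "0 < k"
  shows "fermion_vec (cell_vec r k) (tau_series r) = 0"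
proof (rule tseries_eqI)
  fix m
  \<comment> \<open>The mode \<open>X_{-k}\<close> uses the part of degree
    \<open>weight m + k\<close>, the highest degree that enters.\<close>
  define n where "n = weight m + k"
  define \<tau> where "\<tau> = (\<Sum>T\<in>Pow {1..n}. tconst (aug_pf r T) * Q_set T)"
  have cong: "coeff (fermion \<alpha> (tau_series r)) m = coeff (fermion \<alpha> \<tau>) m" if "- int k \<le> \<alpha>" for \<alpha>
  proof (rule coeff_fermion_cong)
    show "eq_at (int (weight m) - \<alpha>) (tau_series r) \<tau>"
      unfolding eq_at_def \<tau>_def using that by (intro allI impI coeff_tau_series) (simp add: n_def)
  qed
  let ?h = "\<lambda>\<alpha>. cell_vec r k (index_of \<alpha>) * coeff (fermion \<alpha> \<tau>) m"
  have "coeff (fermion_vec (cell_vec r k) (tau_series r)) m =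
      complex_of_real (sqrt 2) * cell_coeff r k 0 * coeff (fermion 0 (tau_series r)) m +
      (\<Sum>\<alpha>\<in>{- int k..int n} - {0}. cell_vec r k (index_of \<alpha>) * coeff (fermion \<alpha> (tau_series r)) m)"
    by (subst coeff_fermion_vec[of k _ m n]) (auto simp: cell_vec_def n_def)
  also have "\<dots> = complex_of_real (sqrt 2) * cell_coeff r k 0 * coeff (fermion 0 \<tau>) m + sum ?h ({- int k..int n} - {0})"
    using cong by (auto intro!: sum.cong)
  also have "sum ?h ({- int k..int n} - {0}) = sum ?h (insert (- int k) (int ` {1..n}))"
  proof (rule sum.mono_neutral_right)
    show "\<forall>\<alpha>\<in>{- int k..int n} - {0} - insert (- int k) (int ` {1..n}). ?h \<alpha> = 0"
    proof
      fix \<alpha> assume a: "\<alpha> \<in> {- int k..int n} - {0} - insert (- int k) (int ` {1..n})"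
      have "\<not> 0 < \<alpha>"
      proof
        assume "0 < \<alpha>"
        then have "\<alpha> = int (nat \<alpha>)" "nat \<alpha> \<in> {1..n}" using a by auto
        then have "\<alpha> \<in> int ` {1..n}" by (rule image_eqI)
        then show False using a by blast
      qed
      then show "?h \<alpha> = 0" using a by (auto simp: index_of_def cell_vec_def)
    qed
  qed (use assms(2) in \<open>auto simp: n_def\<close>)
  also have "\<dots> = coeff (fermion (- int k) \<tau>) m + (\<Sum>j = 1..n. cell_coeff r k j * coeff (fermion (int j) \<tau>) m)"
  proof -
    have "- int k \<notin> int ` {1..n}" by auto
    moreover have "?h (- int k) = coeff (fermion (- int k) \<tau>) m"
      using assms(2) by (simp add: index_of_def cell_vec_def)
    moreover have "sum ?h (int ` {1..n}) = (\<Sum>j = 1..n. cell_coeff r k j * coeff (fermion (int j) \<tau>) m)"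
      by (subst sum.reindex) (auto simp: index_of_def cell_vec_def intro!: sum.cong)
    ultimately show ?thesis by simp
  qed
  also have "complex_of_real (sqrt 2) * cell_coeff r k 0 * coeff (fermion 0 \<tau>) m + \<dots> =
      coeff (fermion (- int k) \<tau> + tconst (complex_of_real (sqrt 2) * cell_coeff r k 0) * fermion 0 \<tau> +
        (\<Sum>j = 1..n. tconst (cell_coeff r k j) * fermion (int j) \<tau>)) m"
    by simp
  also have "\<dots> = coeff 0 m"
    unfolding \<tau>_def by (subst truncated_tau_annihilated[OF assms]) (simp_all add: n_def)
  finally show "coeff (fermion_vec (cell_vec r k) (tau_series r)) m = coeff 0 m" .
qed

section \<open>The big Schubert cell\<close>

lemma Neg_less_iff: "\<alpha> < Neg k \<longleftrightarrow> (\<exists>j>k. \<alpha> = Neg j)"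
  by (cases \<alpha>) (auto simp: less_Aindex_def)

lemma less_Pos_0_iff: "\<alpha> < Pos 0 \<longleftrightarrow> (\<exists>j. \<alpha> = Neg j)"
  by (cases \<alpha>) (auto simp: less_Aindex_def)

lemma Vhat_iff: "x \<in> Vhat \<longleftrightarrow> (\<exists>K. \<forall>j\<ge>K. x (Neg j) = 0)"
proof
  assume "x \<in> Vhat"
  then obtain \<alpha> where \<alpha>: "\<And>\<beta>. \<beta> < \<alpha> \<Longrightarrow> x \<beta> = 0" by (auto simp: Vhat_def)
  show "\<exists>K. \<forall>j\<ge>K. x (Neg j) = 0"
  proof (cases \<alpha>)
    case (Neg k)
    then show ?thesis using \<alpha> by (auto simp: Neg_less_iff intro!: exI[of _ "Suc k"])
  next
    case (Pos k)
    then have "Neg j < \<alpha>" for j by (simp add: less_Aindex_def)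
    then show ?thesis using \<alpha> by blast
  qed
next
  assume "\<exists>K. \<forall>j\<ge>K. x (Neg j) = 0"
  then obtain K where "\<forall>j\<ge>K. x (Neg j) = 0" by blast
  then show "x \<in> Vhat" by (auto simp: Vhat_def Neg_less_iff intro!: exI[of _ "Neg K"])
qed

lemma quad_form_eq:
  assumes "finite J" "\<And>j. j \<notin> J \<Longrightarrow> x (Neg j) = 0"
  shows "quad_form x = (\<Sum>j\<in>J. (-1) ^ j * x (Pos j) * x (Neg j))"
  unfolding quad_form_def by (rule Sum_any.expand_superset) (use assms in auto)

lemma mat_act_eq:
  assumes "finite B" "\<And>\<beta>. \<beta> \<notin> B \<Longrightarrow> N \<alpha> \<beta> * x \<beta> = 0"
  shows "mat_act N x \<alpha> = (\<Sum>\<beta>\<in>B. N \<alpha> \<beta> * x \<beta>)"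
  unfolding mat_act_def by (rule Sum_any.expand_superset) (use assms in auto)

lemma mat_act_span:
  "mat_act N (\<lambda>\<alpha>. \<Sum>k<n. c k * basis_vec (Neg k) \<alpha>) = (\<lambda>\<alpha>. \<Sum>k<n. c k * N \<alpha> (Neg k))"
proof
  fix \<alpha>
  let ?y = "\<lambda>\<alpha>. \<Sum>k<n. c k * basis_vec (Neg k) \<alpha>"
  have y: "?y (Neg k) = c k" if "k < n" for k
  proof -
    have "?y (Neg k) = (\<Sum>i<n. if i = k then c k else 0)" by (rule sum.cong) (auto simp: basis_vec_def)
    then show ?thesis using that by simp
  qed
  have "mat_act N ?y \<alpha> = (\<Sum>\<beta>\<in>Neg ` {..<n}. N \<alpha> \<beta> * ?y \<beta>)"
    by (rule mat_act_eq) (auto simp: basis_vec_def intro!: sum.neutral)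
  also have "\<dots> = (\<Sum>k<n. N \<alpha> (Neg k) * ?y (Neg k))"
    by (subst sum.reindex) (auto simp: inj_on_def)
  also have "\<dots> = (\<Sum>k<n. c k * N \<alpha> (Neg k))"
    by (rule sum.cong) (use y in auto)
  finally show "mat_act N ?y \<alpha> = (\<Sum>k<n. c k * N \<alpha> (Neg k))" .
qed

lemma image_span_nonpos: "mat_act N ` span_nonpos = {\<lambda>\<alpha>. \<Sum>k<n. c k * N \<alpha> (Neg k) | (c :: nat \<Rightarrow> complex) n. True}"
proof -
  have "mat_act N ` span_nonpos = {mat_act N (\<lambda>\<alpha>. \<Sum>k<n. c k * basis_vec (Neg k) \<alpha>) | (c :: nat \<Rightarrow> complex) n. True}"
    unfolding span_nonpos_def by blast
  then show ?thesis unfolding mat_act_span .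
qed

lemma fermion_vec_sum:
  assumes "finite J" and x: "\<And>i j. i \<in> J \<Longrightarrow> K < j \<Longrightarrow> x i (Neg j) = 0"
  shows "fermion_vec (\<lambda>\<alpha>. \<Sum>i\<in>J. c i * x i \<alpha>) f = (\<Sum>i\<in>J. tconst (c i) * fermion_vec (x i) f)"
proof (rule tseries_eqI)
  fix m
  let ?s = "complex_of_real (sqrt 2)" and ?I = "{- int K..int (weight m)} - {0}"
  have "coeff (fermion_vec (\<lambda>\<alpha>. \<Sum>i\<in>J. c i * x i \<alpha>) f) m =
      ?s * (\<Sum>i\<in>J. c i * x i (Neg 0)) * coeff (fermion 0 f) m +
      (\<Sum>\<alpha>\<in>?I. (\<Sum>i\<in>J. c i * x i (index_of \<alpha>)) * coeff (fermion \<alpha> f) m)"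
    by (rule coeff_fermion_vec) (use x in \<open>auto intro!: sum.neutral\<close>)
  also have "(\<Sum>\<alpha>\<in>?I. (\<Sum>i\<in>J. c i * x i (index_of \<alpha>)) * coeff (fermion \<alpha> f) m) =
      (\<Sum>i\<in>J. \<Sum>\<alpha>\<in>?I. c i * x i (index_of \<alpha>) * coeff (fermion \<alpha> f) m)"
    unfolding sum_distrib_right by (rule sum.swap)
  also have "?s * (\<Sum>i\<in>J. c i * x i (Neg 0)) * coeff (fermion 0 f) m + \<dots> =
      (\<Sum>i\<in>J. c i * (?s * x i (Neg 0) * coeff (fermion 0 f) m + (\<Sum>\<alpha>\<in>?I. x i (index_of \<alpha>) * coeff (fermion \<alpha> f) m)))"
    unfolding sum_distrib_left sum_distrib_right sum.distrib[symmetric]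
    by (rule sum.cong) (simp_all add: distrib_left sum_distrib_left mult_ac)
  also have "\<dots> = (\<Sum>i\<in>J. c i * coeff (fermion_vec (x i) f) m)"
    by (intro sum.cong refl arg_cong2[of _ _ _ _ "(*)"] coeff_fermion_vec[symmetric]) (use x in auto)
  finally show "coeff (fermion_vec (\<lambda>\<alpha>. \<Sum>i\<in>J. c i * x i \<alpha>) f) m =
      coeff (\<Sum>i\<in>J. tconst (c i) * fermion_vec (x i) f) m" by simp
qed

text \<open>For k > 0 the columns at -k are the reduced basis vectors. The columns -0 and +0 share
  the entries \<open>r j 0\<close>, which keeps their difference equal to
  \<open>e_{-0} - e_{+0}\<close> and makes both orthogonal to every \<open>cell_vec r k\<close> with
  k > 0.\<close>

definition cell_matrix :: "(nat \<Rightarrow> nat \<Rightarrow> complex) \<Rightarrow> Aindex \<Rightarrow> Aindex \<Rightarrow> complex" where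
  "cell_matrix r \<alpha> \<beta> = (case \<beta> of
     Neg k \<Rightarrow> if k = 0 then (case \<alpha> of Neg j \<Rightarrow> of_bool (j = 0) | Pos j \<Rightarrow> if j = 0 then 0 else r j 0) else cell_vec r k \<alpha>
   | Pos k \<Rightarrow> if k = 0 then (case \<alpha> of Neg j \<Rightarrow> 0 | Pos j \<Rightarrow> if j = 0 then 1 else r j 0) else of_bool (\<alpha> = \<beta>))"

lemma lower_unitriangular_cell_matrix: "lower_unitriangular (cell_matrix r)"
  unfolding lower_unitriangular_def
proof (intro conjI allI impI)
  show "cell_matrix r \<alpha> \<alpha> = 1" for \<alpha>
    by (cases \<alpha>) (auto simp: cell_matrix_def cell_vec_def)
  fix \<alpha> \<beta> :: Aindex assume less: "\<alpha> < \<beta>"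
  show "cell_matrix r \<alpha> \<beta> = 0"
  proof (cases \<beta>)
    case (Neg k)
    then show ?thesis using less by (auto simp: Neg_less_iff cell_matrix_def cell_vec_def)
  next
    case (Pos k)
    then show ?thesis using less less_Pos_0_iff[of \<alpha>] by (auto simp: cell_matrix_def)
  qed
qed

lemma mat_act_cell_matrix:
  assumes x: "\<And>j. j \<ge> K \<Longrightarrow> x (Neg j) = 0" and K: "0 < K"
  shows "0 < j \<Longrightarrow> mat_act (cell_matrix r) x (Neg j) = x (Neg j)"
    and "mat_act (cell_matrix r) x (Neg 0) = x (Neg 0) + (\<Sum>k\<in>{1..<K}. cell_coeff r k 0 * x (Neg k))"
    and "mat_act (cell_matrix r) x (Pos 0) = x (Pos 0) + (\<Sum>k\<in>{1..<K}. cell_coeff r k 0 * x (Neg k))"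
    and "0 < j \<Longrightarrow> mat_act (cell_matrix r) x (Pos j) = x (Pos j) + r j 0 * (x (Neg 0) + x (Pos 0)) +
      (\<Sum>k\<in>{1..<K}. cell_coeff r k j * x (Neg k))"
proof -
  have split: "(\<Sum>\<beta>\<in>insert (Neg 0) (Neg ` {1..<K}) \<union> B. g \<beta>) = g (Neg 0) + (\<Sum>k\<in>{1..<K}. g (Neg k)) + sum g B"
    if "finite B" "B \<subseteq> range Pos" for g :: "Aindex \<Rightarrow> complex" and B
  proof -
    have "(\<Sum>\<beta>\<in>insert (Neg 0) (Neg ` {1..<K}) \<union> B. g \<beta>) = sum g (insert (Neg 0) (Neg ` {1..<K})) + sum g B"
      by (rule sum.union_disjoint) (use that in auto)
    also have "sum g (insert (Neg 0) (Neg ` {1..<K})) = g (Neg 0) + sum g (Neg ` {1..<K})"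
      by (rule sum.insert) auto
    also have "sum g (Neg ` {1..<K}) = (\<Sum>k\<in>{1..<K}. g (Neg k))"
      by (subst sum.reindex) (auto simp: inj_on_def)
    finally show ?thesis .
  qed
  have out: "x (Neg k) = 0" if "Neg k \<notin> insert (Neg 0) (Neg ` {1..<K})" for k
  proof -
    have "k \<notin> {1..<K}" "k \<noteq> 0" using that by auto
    then show ?thesis by (intro x) auto
  qed
  have act: "mat_act (cell_matrix r) x \<alpha> = cell_matrix r \<alpha> (Neg 0) * x (Neg 0) +
      (\<Sum>k\<in>{1..<K}. cell_matrix r \<alpha> (Neg k) * x (Neg k)) + (\<Sum>\<beta>\<in>B. cell_matrix r \<alpha> \<beta> * x \<beta>)"
    if B: "finite B" "B \<subseteq> range Pos" "\<And>k. Pos k \<notin> B \<Longrightarrow> cell_matrix r \<alpha> (Pos k) = 0" for \<alpha> B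
  proof -
    have "mat_act (cell_matrix r) x \<alpha> = (\<Sum>\<beta>\<in>insert (Neg 0) (Neg ` {1..<K}) \<union> B. cell_matrix r \<alpha> \<beta> * x \<beta>)"
    proof (rule mat_act_eq)
      fix \<beta> assume \<beta>: "\<beta> \<notin> insert (Neg 0) (Neg ` {1..<K}) \<union> B"
      show "cell_matrix r \<alpha> \<beta> * x \<beta> = 0"
        using \<beta> B(3) out by (cases \<beta>) auto
    qed (use B in auto)
    then show ?thesis unfolding split[OF B(1,2)] .
  qed
  show "mat_act (cell_matrix r) x (Neg j) = x (Neg j)" if j: "0 < j"
  proof -
    have "mat_act (cell_matrix r) x (Neg j) = (\<Sum>k\<in>{1..<K}. cell_matrix r (Neg j) (Neg k) * x (Neg k))"
      by (subst act[of "{}"]) (use j in \<open>auto simp: cell_matrix_def\<close>)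
    also have "\<dots> = (\<Sum>k\<in>{1..<K}. if k = j then x (Neg j) else 0)"
      by (rule sum.cong) (use j in \<open>auto simp: cell_matrix_def cell_vec_def\<close>)
    also have "\<dots> = x (Neg j)" using x[of j] j by auto
    finally show ?thesis .
  qed
  show "mat_act (cell_matrix r) x (Neg 0) = x (Neg 0) + (\<Sum>k\<in>{1..<K}. cell_coeff r k 0 * x (Neg k))"
    by (subst act[of "{}"]) (auto simp: cell_matrix_def cell_vec_def intro!: sum.cong)
  show "mat_act (cell_matrix r) x (Pos 0) = x (Pos 0) + (\<Sum>k\<in>{1..<K}. cell_coeff r k 0 * x (Neg k))"
    by (subst act[of "{Pos 0}"]) (auto simp: cell_matrix_def cell_vec_def intro!: sum.cong)
  show "mat_act (cell_matrix r) x (Pos j) = x (Pos j) + r j 0 * (x (Neg 0) + x (Pos 0)) +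
      (\<Sum>k\<in>{1..<K}. cell_coeff r k j * x (Neg k))" if j: "0 < j"
    by (subst act[of "{Pos 0, Pos j}"])
       (use j in \<open>auto simp: cell_matrix_def cell_vec_def distrib_left intro!: sum.cong\<close>)
qed

text \<open>Let s be the amount by which both zero coordinates change. The terms linear in s cancel
  against those with the entries \<open>r j 0\<close>, the skew part of \<open>cell_coeff\<close>
  drops out, and its rank one part contributes -s^2 against the s^2 from the zero
  coordinates.\<close>

lemma quad_form_cell_matrix:
  assumes r: "skew r" and "x \<in> Vhat"
  shows "quad_form (mat_act (cell_matrix r) x) = quad_form x"
proof -
  obtain K' where "\<forall>j\<ge>K'. x (Neg j) = 0" using assms(2) Vhat_iff by blast
  then obtain K where x: "\<And>j. j \<ge> K \<Longrightarrow> x (Neg j) = 0" and K: "0 < K"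
    by (metis Suc_leD zero_less_Suc)
  note act = mat_act_cell_matrix[of K x, OF x K]
  let ?J = "{1..<K}"
  have split: "{..<K} = insert 0 ?J" using K by auto
  define s where "s = (\<Sum>k\<in>?J. cell_coeff r k 0 * x (Neg k))"
  define a where "a j = (-1) ^ j * x (Neg j)" for j
  have s: "(\<Sum>j\<in>?J. a j * r j 0) = - s"
    unfolding s_def a_def sum_negf[symmetric] by (rule sum.cong) (auto simp: cell_coeff_def)
  have skew0: "(\<Sum>j\<in>?J. \<Sum>k\<in>?J. a j * a k * r k j) = 0"
  proof -
    have "(\<Sum>j\<in>?J. \<Sum>k\<in>?J. a j * a k * r k j) = (\<Sum>k\<in>?J. \<Sum>j\<in>?J. a j * a k * r k j)"
      by (rule sum.swap)
    also have "\<dots> = - (\<Sum>k\<in>?J. \<Sum>j\<in>?J. a k * a j * r j k)"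
      unfolding sum_negf[symmetric]
      by (intro sum.cong refl) (subst skewD(1)[OF r], simp add: mult_ac)
    finally show ?thesis by simp
  qed
  have double: "(\<Sum>j\<in>?J. a j * (\<Sum>k\<in>?J. cell_coeff r k j * x (Neg k))) = - (s * s)"
  proof -
    have "(\<Sum>j\<in>?J. a j * (\<Sum>k\<in>?J. cell_coeff r k j * x (Neg k))) =
        (\<Sum>j\<in>?J. \<Sum>k\<in>?J. - (a j * a k * r k j) - (a j * r j 0) * (a k * r k 0))"
      unfolding sum_distrib_left
      by (intro sum.cong refl) (auto simp: cell_coeff_def a_def algebra_simps)
    also have "\<dots> = - (\<Sum>j\<in>?J. \<Sum>k\<in>?J. a j * a k * r k j) - (\<Sum>j\<in>?J. a j * r j 0) * (\<Sum>k\<in>?J. a k * r k 0)"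
      by (simp add: sum_subtractf sum_negf sum_product)
    finally show ?thesis unfolding skew0 s by simp
  qed
  have "quad_form (mat_act (cell_matrix r) x) =
      (\<Sum>j<K. (-1) ^ j * mat_act (cell_matrix r) x (Pos j) * mat_act (cell_matrix r) x (Neg j))"
    by (rule quad_form_eq) (use act(1) x K in auto)
  also have "\<dots> = (x (Pos 0) + s) * (x (Neg 0) + s) +
      (\<Sum>j\<in>?J. (-1) ^ j * mat_act (cell_matrix r) x (Pos j) * mat_act (cell_matrix r) x (Neg j))"
    unfolding split by (subst sum.insert) (auto simp: act(2,3) s_def)
  also have "(\<Sum>j\<in>?J. (-1) ^ j * mat_act (cell_matrix r) x (Pos j) * mat_act (cell_matrix r) x (Neg j)) =
      (\<Sum>j\<in>?J. (-1) ^ j * x (Pos j) * x (Neg j) + (x (Neg 0) + x (Pos 0)) * (a j * r j 0) +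
        a j * (\<Sum>k\<in>?J. cell_coeff r k j * x (Neg k)))"
    by (rule sum.cong) (auto simp: act(1,4) a_def algebra_simps simp del: sum_distrib_left)
  also have "\<dots> = (\<Sum>j\<in>?J. (-1) ^ j * x (Pos j) * x (Neg j)) - (x (Neg 0) + x (Pos 0)) * s - s * s"
    unfolding sum.distrib double sum_distrib_left[symmetric] s by (simp add: algebra_simps)
  also have "(x (Pos 0) + s) * (x (Neg 0) + s) + \<dots> =
      x (Pos 0) * x (Neg 0) + (\<Sum>j\<in>?J. (-1) ^ j * x (Pos j) * x (Neg j))"
    by (simp add: algebra_simps)
  also have "\<dots> = (\<Sum>j<K. (-1) ^ j * x (Pos j) * x (Neg j))"
    unfolding split by (subst sum.insert) auto
  also have "\<dots> = quad_form x"
    by (rule quad_form_eq[symmetric]) (use x in auto)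
  finally show ?thesis .
qed

lemma mat_act_basis_difference:
  "mat_act N (\<lambda>\<alpha>. basis_vec (Neg 0) \<alpha> - basis_vec (Pos 0) \<alpha>) = (\<lambda>\<alpha>. N \<alpha> (Neg 0) - N \<alpha> (Pos 0))"
proof
  fix \<alpha>
  show "mat_act N (\<lambda>\<alpha>. basis_vec (Neg 0) \<alpha> - basis_vec (Pos 0) \<alpha>) \<alpha> = N \<alpha> (Neg 0) - N \<alpha> (Pos 0)"
    by (subst mat_act_eq[of "{Neg 0, Pos 0}"]) (auto simp: basis_vec_def)
qed

lemma cell_matrix_in_N_minus: "skew r \<Longrightarrow> cell_matrix r \<in> N_minus"
  unfolding N_minus_def Let_def mat_act_basis_difference
proof (intro CollectI conjI ballI lower_unitriangular_cell_matrix quad_form_cell_matrix ext)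
  fix \<alpha>
  show "cell_matrix r \<alpha> (Neg 0) - cell_matrix r \<alpha> (Pos 0) = basis_vec (Neg 0) \<alpha> - basis_vec (Pos 0) \<alpha>"
    by (cases \<alpha>) (auto simp: cell_matrix_def basis_vec_def)
qed

lemma tau_series_in_BKP_big_cell:
  assumes r: "skew r"
  shows "tau_series r \<in> BKP_big_cell"
proof -
  let ?U = "mat_act (cell_matrix r) ` span_nonpos"
  have "fermion_vec x (tau_series r) = 0" if xU: "x \<in> ?U" and x0: "x (Neg 0) = x (Pos 0)" for x
  proof -
    obtain c :: "nat \<Rightarrow> complex" and n where x: "x = (\<lambda>\<alpha>. \<Sum>k<n. c k * cell_matrix r \<alpha> (Neg k))"
      using xU unfolding image_span_nonpos by blast
    have "x = (\<lambda>\<alpha>. \<Sum>k\<in>{1..<n}. c k * cell_vec r k \<alpha>)"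
    proof (cases "n = 0")
      case False
      then have n: "{..<n} = insert 0 {1..<n}" by auto
      have split: "x \<alpha> = c 0 * cell_matrix r \<alpha> (Neg 0) + (\<Sum>k\<in>{1..<n}. c k * cell_vec r k \<alpha>)" for \<alpha>
        unfolding x n by (subst sum.insert) (auto simp: cell_matrix_def intro!: sum.cong)
      \<comment> \<open>The columns at -k with k > 0 have equal entries at -0 and +0, while the
        column -0 has 1 and 0 there; so the hyperplane condition removes this column.\<close>
      have "(\<Sum>k\<in>{1..<n}. c k * cell_vec r k (Neg 0)) = (\<Sum>k\<in>{1..<n}. c k * cell_vec r k (Pos 0))"
        by (simp add: cell_vec_def)
      then have "c 0 = 0" using x0 unfolding split by (simp add: cell_matrix_def)
      then show ?thesis using split by auto
    qed (simp add: x)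
    then have "fermion_vec x (tau_series r) = (\<Sum>k\<in>{1..<n}. tconst (c k) * fermion_vec (cell_vec r k) (tau_series r))"
      by (simp only:) (rule fermion_vec_sum[of _ n], auto simp: cell_vec_def)
    then show ?thesis using tau_series_annihilated[OF r] by simp
  qed
  moreover have "tau_series r \<noteq> 0" using coeff_tau_series_0[of r] by auto
  ultimately have "is_tau ?U (tau_series r)" by (simp add: is_tau_def)
  moreover have "?U \<in> big_cell" unfolding big_cell_def using cell_matrix_in_N_minus[OF r] by blast
  ultimately show ?thesis unfolding BKP_big_cell_def by blast
qed

section \<open>Reading off R from a subspace of the big cell\<close>

context
  fixes N :: "Aindex \<Rightarrow> Aindex \<Rightarrow> complex" and U :: "vec set"
  assumes N: "N \<in> N_minus"
  defines "U \<equiv> mat_act N ` span_nonpos"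
begin

lemma U_I: "(\<lambda>\<alpha>. \<Sum>k<n. c k * N \<alpha> (Neg k)) \<in> U"
  unfolding U_def image_span_nonpos by blast

lemma U_column: "(\<lambda>\<alpha>. N \<alpha> (Neg k)) \<in> U"
proof -
  have eq: "(\<lambda>\<alpha>. N \<alpha> (Neg k)) = (\<lambda>\<alpha>. \<Sum>i<Suc k. of_bool (i = k) * N \<alpha> (Neg i))"
    by (rule ext) (simp add: lessThan_Suc)
  show ?thesis unfolding eq by (rule U_I)
qed

lemma U_linear: "x \<in> U \<Longrightarrow> y \<in> U \<Longrightarrow> (\<lambda>\<alpha>. x \<alpha> + a * y \<alpha>) \<in> U"
proof -
  assume "x \<in> U" "y \<in> U"
  then obtain c d :: "nat \<Rightarrow> complex" and m n where
    x: "x = (\<lambda>\<alpha>. \<Sum>k<m. c k * N \<alpha> (Neg k))" and y: "y = (\<lambda>\<alpha>. \<Sum>k<n. d k * N \<alpha> (Neg k))"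
    unfolding U_def image_span_nonpos by blast
  have extend: "(\<Sum>k<m. c k * N \<alpha> (Neg k)) = (\<Sum>k<max m n. (if k < m then c k else 0) * N \<alpha> (Neg k))" for m n c \<alpha>
    by (rule sum.mono_neutral_cong_left) auto
  have eq: "(\<lambda>\<alpha>. x \<alpha> + a * y \<alpha>) =
      (\<lambda>\<alpha>. \<Sum>k<max m n. ((if k < m then c k else 0) + a * (if k < n then d k else 0)) * N \<alpha> (Neg k))"
    unfolding x y extend[where m = m and n = n] extend[where m = n and n = m] max.commute[of n m]
    by (simp add: sum_distrib_left distrib_right sum.distrib mult.assoc)
  show ?thesis unfolding eq by (rule U_I)
qed

lemma U_sum:
  assumes "finite J" "x \<in> U" "\<And>j. j \<in> J \<Longrightarrow> y j \<in> U"
  shows "(\<lambda>\<alpha>. x \<alpha> + (\<Sum>j\<in>J. a j * y j \<alpha>)) \<in> U"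
  using assms
proof (induction rule: finite_induct)
  case (insert j J)
  have "(\<lambda>\<alpha>. (x \<alpha> + (\<Sum>j\<in>J. a j * y j \<alpha>)) + a j * y j \<alpha>) \<in> U"
    by (rule U_linear) (use insert in auto)
  then show ?case using insert by (simp add: algebra_simps)
qed simp

lemma N_Neg: "k < j \<Longrightarrow> N (Neg j) (Neg k) = 0" "N (Neg k) (Neg k) = 1"
  using N by (auto simp: N_minus_def lower_unitriangular_def Neg_less_iff)

lemma quad_form_U: "x \<in> U \<Longrightarrow> quad_form x = 0"
proof -
  assume "x \<in> U"
  then obtain c :: "nat \<Rightarrow> complex" and n where x: "x = mat_act N (\<lambda>\<alpha>. \<Sum>k<n. c k * basis_vec (Neg k) \<alpha>)"
    unfolding U_def span_nonpos_def by blast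
  let ?y = "\<lambda>\<alpha>. \<Sum>k<n. c k * basis_vec (Neg k) \<alpha>"
  have "?y \<in> Vhat" unfolding Vhat_iff by (intro exI[of _ n]) (auto simp: basis_vec_def intro!: sum.neutral)
  then have "quad_form x = quad_form ?y" using N unfolding x N_minus_def by blast
  also have "\<dots> = 0" unfolding quad_form_def by (simp add: basis_vec_def)
  finally show ?thesis .
qed

text \<open>The group fixes \<open>e\<^sub>-\<^sub>0 - e\<^sub>+\<^sub>0\<close>, hence preserves its orthogonal complement.\<close>

lemma N_hyperplane:
  assumes "0 < k"
  shows "N (Neg 0) (Neg k) = N (Pos 0) (Neg k)"
proof -
  let ?v = "\<lambda>\<alpha>. basis_vec (Neg 0) \<alpha> - basis_vec (Pos 0) \<alpha>"
  \<comment> \<open>The form takes the value -1 on \<open>e_{-k} + v\<close>, as it does on v; since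
    N fixes v, comparing values isolates the pairing of the column -k of N with v.\<close>
  let ?y = "\<lambda>\<alpha>. basis_vec (Neg k) \<alpha> + ?v \<alpha>" and ?u = "\<lambda>\<alpha>. N \<alpha> (Neg k)"
  have fix_v: "(\<lambda>\<alpha>. N \<alpha> (Neg 0) - N \<alpha> (Pos 0)) = ?v"
    using N unfolding N_minus_def Let_def mat_act_basis_difference by blast
  have act: "mat_act N ?y = (\<lambda>\<alpha>. ?u \<alpha> + ?v \<alpha>)"
  proof
    fix \<alpha>
    have "mat_act N ?y \<alpha> = (\<Sum>\<beta>\<in>{Neg k, Neg 0, Pos 0}. N \<alpha> \<beta> * ?y \<beta>)"
      by (rule mat_act_eq) (auto simp: basis_vec_def)
    also have "\<dots> = ?u \<alpha> + (N \<alpha> (Neg 0) - N \<alpha> (Pos 0))" using assms by (simp add: basis_vec_def)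
    finally show "mat_act N ?y \<alpha> = ?u \<alpha> + ?v \<alpha>" using fun_cong[OF fix_v, of \<alpha>] by simp
  qed
  have "?y \<in> Vhat" unfolding Vhat_iff by (intro exI[of _ "Suc k"]) (auto simp: basis_vec_def)
  then have "quad_form (mat_act N ?y) = quad_form ?y" using N unfolding N_minus_def by blast
  moreover have "quad_form ?y = -1"
    by (subst quad_form_eq[of "{0, k}"]) (use assms in \<open>auto simp: basis_vec_def\<close>)
  moreover have "quad_form (\<lambda>\<alpha>. ?u \<alpha> + ?v \<alpha>) = quad_form ?u + ?u (Pos 0) - ?u (Neg 0) - 1"
  proof -
    have "quad_form (\<lambda>\<alpha>. ?u \<alpha> + ?v \<alpha>) = (\<Sum>j\<le>k. (-1) ^ j * (?u (Pos j) + ?v (Pos j)) * (?u (Neg j) + ?v (Neg j)))"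
      by (rule quad_form_eq) (auto simp: N_Neg basis_vec_def)
    also have "\<dots> = (\<Sum>j\<le>k. (-1) ^ j * ?u (Pos j) * ?u (Neg j) + (if j = 0 then ?u (Pos 0) - ?u (Neg 0) - 1 else 0))"
      by (rule sum.cong) (auto simp: basis_vec_def algebra_simps)
    also have "\<dots> = (\<Sum>j\<le>k. (-1) ^ j * ?u (Pos j) * ?u (Neg j)) + (?u (Pos 0) - ?u (Neg 0) - 1)"
      by (simp add: sum.distrib)
    also have "(\<Sum>j\<le>k. (-1) ^ j * ?u (Pos j) * ?u (Neg j)) = quad_form ?u"
      by (rule quad_form_eq[symmetric]) (auto simp: N_Neg)
    finally show ?thesis by simp
  qed
  ultimately show ?thesis using quad_form_U[OF U_column[of k]] unfolding act by simp
qed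

definition reduced :: "nat \<Rightarrow> vec \<Rightarrow> bool" where
  "reduced k w \<longleftrightarrow> w \<in> U \<and> w (Neg 0) = w (Pos 0) \<and> (\<forall>j>0. w (Neg j) = of_bool (j = k))"

text \<open>Gaussian elimination on the columns of N: unitriangularity supplies the pivot 1 at -k,
  and the entries at -j with 0 < j < k are cleared by earlier reduced vectors. The entries at -0 and
  +0 are not cleared; they stay equal by \<open>N_hyperplane\<close>.\<close>

lemma reduced_exists: "0 < k \<Longrightarrow> \<exists>w. reduced k w"
proof (induction k rule: less_induct)
  case (less k)
  let ?J = "{1..<k}"
  have "\<forall>j\<in>?J. \<exists>w. reduced j w" using less by auto
  then obtain y where y: "\<And>j. j \<in> ?J \<Longrightarrow> reduced j (y j)" by (metis bchoice)
  define w where "w = (\<lambda>\<alpha>. N \<alpha> (Neg k) + (\<Sum>j\<in>?J. - N (Neg j) (Neg k) * y j \<alpha>))"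
  have "w \<in> U" unfolding w_def by (rule U_sum) (use y U_column in \<open>auto simp: reduced_def\<close>)
  moreover have "w (Neg 0) = w (Pos 0)"
    unfolding w_def using N_hyperplane[OF less.prems] y by (auto simp: reduced_def intro!: sum.cong)
  moreover have "w (Neg i) = of_bool (i = k)" if i: "0 < i" for i
  proof -
    have "(\<Sum>j\<in>?J. - N (Neg j) (Neg k) * y j (Neg i)) = (\<Sum>j\<in>?J. if j = i then - N (Neg i) (Neg k) else 0)"
      by (rule sum.cong) (use y i in \<open>auto simp: reduced_def\<close>)
    then have "w (Neg i) = N (Neg i) (Neg k) + (if i \<in> ?J then - N (Neg i) (Neg k) else 0)"
      by (simp add: w_def)
    then show ?thesis using i N_Neg(1)[of k i] N_Neg(2)[of k] by (cases i k rule: linorder_cases) auto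
  qed
  ultimately show ?case unfolding reduced_def by blast
qed

text \<open>Polarization: x, y and x + y are all isotropic. The product term arises because the
  entries at -0 and +0 agree. The case k = l is included; then \<open>{k, l}\<close> is a
  singleton.\<close>

lemma reduced_isotropic:
  assumes x: "reduced k x" and y: "reduced l y" and kl: "0 < k" "0 < l"
  shows "(-1) ^ k * y (Pos k) + (-1) ^ l * x (Pos l) + 2 * x (Pos 0) * y (Pos 0) = 0"
proof -
  let ?z = "\<lambda>\<alpha>. x \<alpha> + 1 * y \<alpha>"
  have quad: "quad_form u = u (Pos 0) * u (Neg 0) + (\<Sum>j\<in>{k, l}. (-1) ^ j * u (Pos j) * u (Neg j))"
    if "\<And>j. 0 < j \<Longrightarrow> j \<noteq> k \<Longrightarrow> j \<noteq> l \<Longrightarrow> u (Neg j) = 0" for u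
  proof -
    have "quad_form u = (\<Sum>j\<in>insert 0 {k, l}. (-1) ^ j * u (Pos j) * u (Neg j))"
      by (rule quad_form_eq) (use that in auto)
    then show ?thesis using kl by simp
  qed
  have zero: "quad_form x = 0" "quad_form y = 0" "quad_form ?z = 0"
    using x y U_linear[of x y 1] by (auto simp: reduced_def intro!: quad_form_U)
  have qx: "quad_form x = x (Pos 0) * x (Pos 0) + (-1) ^ k * x (Pos k)"
    by (subst quad) (use x kl in \<open>auto simp: reduced_def sum.insert_if\<close>)
  have qy: "quad_form y = y (Pos 0) * y (Pos 0) + (-1) ^ l * y (Pos l)"
    by (subst quad) (use y kl in \<open>auto simp: reduced_def sum.insert_if\<close>)
  have qz: "quad_form ?z = (x (Pos 0) + y (Pos 0)) * (x (Pos 0) + y (Pos 0)) +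
      (-1) ^ k * (x (Pos k) + y (Pos k)) + (-1) ^ l * (x (Pos l) + y (Pos l))"
    by (subst quad) (use x y kl in \<open>auto simp: reduced_def sum.insert_if\<close>)
  have "(-1) ^ k * y (Pos k) + (-1) ^ l * x (Pos l) + 2 * x (Pos 0) * y (Pos 0) =
      quad_form ?z - quad_form x - quad_form y"
    unfolding qx qy qz by (simp add: algebra_simps)
  then show ?thesis unfolding zero by simp
qed

text \<open>Solve \<open>cell_vec r k = w k\<close> for r: the entries at +0 give the column 0 of R,
  and the other entries give the rest once the rank one term is removed.\<close>

lemma big_cell_coordinates: "\<exists>r. skew r \<and> (\<forall>k>0. cell_vec r k \<in> U)"
proof -
  obtain w where w: "\<And>k. 0 < k \<Longrightarrow> reduced k (w k)" using reduced_exists by metis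
  define b where "b k = - ((-1) ^ k * w k (Pos 0))" for k
  define r where "r i j = (if i = 0 then (if j = 0 then 0 else - b j) else if j = 0 then b i
    else - ((-1) ^ i * w i (Pos j)) - b i * b j)" for i j
  have "r i j = - r j i" for i j
  proof (cases "i = 0 \<or> j = 0")
    case False
    then have ij: "0 < i" "0 < j" by auto
    have b: "b i * b j = (-1) ^ i * (-1) ^ j * (w i (Pos 0) * w j (Pos 0))" by (simp add: b_def)
    \<comment> \<open>Multiplied by the signs of i and j, the isotropy relation becomes the skewness
      of r; the case i = j gives the zero diagonal.\<close>
    have "(-1) ^ i * (-1) ^ j * ((-1) ^ i * w j (Pos i) + (-1) ^ j * w i (Pos j) + 2 * w i (Pos 0) * w j (Pos 0)) = 0"
      using reduced_isotropic[OF w[OF ij(1)] w[OF ij(2)] ij] by simp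
    then have zero: "(-1) ^ i * w i (Pos j) + (-1) ^ j * w j (Pos i) + 2 * (b i * b j) = 0"
      unfolding b by (simp add: minus_one_power_iff algebra_simps split: if_splits)
    have "r i j + r j i = - ((-1) ^ i * w i (Pos j) + (-1) ^ j * w j (Pos i) + 2 * (b i * b j))"
      using ij by (simp add: r_def)
    then have "r i j + r j i = 0" unfolding zero by simp
    then show ?thesis by (simp only: eq_neg_iff_add_eq_0)
  qed (auto simp: r_def)
  then have "skew r" unfolding skew_def by blast
  moreover have "cell_vec r k = w k" if k: "0 < k" for k
  proof
    fix \<alpha>
    have "cell_coeff r k j = w k (Pos j)" for j
      using k by (auto simp: cell_coeff_def r_def b_def simp flip: power_add mult_2 mult.assoc)
    then show "cell_vec r k \<alpha> = w k \<alpha>"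
      using w[OF k] by (cases \<alpha>) (auto simp: cell_vec_def reduced_def)
  qed
  moreover have "w k \<in> U" if "0 < k" for k using w[OF that] by (simp add: reduced_def)
  ultimately show ?thesis by metis
qed

end

lemma BKP_big_cell_tau_series:
  assumes \<tau>: "\<tau> \<in> BKP_big_cell" and \<tau>0: "coeff \<tau> 0 = 1"
  shows "\<exists>r. skew r \<and> \<tau> = tau_series r"
proof -
  obtain N where N: "N \<in> N_minus" and tau: "is_tau (mat_act N ` span_nonpos) \<tau>"
    using \<tau> unfolding BKP_big_cell_def big_cell_def by blast
  obtain r where r: "skew r" and U: "\<And>k. 0 < k \<Longrightarrow> cell_vec r k \<in> mat_act N ` span_nonpos"
    using big_cell_coordinates[OF N] by blast
  have "\<tau> = tau_series r"
  proof (rule fermion_vec_solution_unique[of "cell_vec r"])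
    show "fermion_vec (cell_vec r k) \<tau> = 0" if "0 < k" for k
    proof -
      have "cell_vec r k (Neg 0) = cell_vec r k (Pos 0)" by (simp add: cell_vec_def)
      then show ?thesis using tau U[OF that] unfolding is_tau_def by blast
    qed
    show "fermion_vec (cell_vec r k) (tau_series r) = 0" if "0 < k" for k
      by (rule tau_series_annihilated[OF r that])
    show "coeff \<tau> 0 = coeff (tau_series r) 0" by (simp add: \<tau>0 coeff_tau_series_0)
  qed (auto simp: cell_vec_def)
  then show ?thesis using r by blast
qed

theorem theorem1p1:
  shows "{\<tau> \<in> BKP_big_cell. coeff \<tau> 0 = 1} = {infinite_pf r | r. skew r} \<and>
         (\<forall>r. skew r \<longrightarrow>
            convergent (truncated_pf r) \<and>
            ((\<lambda>\<nu>. tconst (pf_at r \<nu>) * schur_Q \<nu>) has_sum infinite_pf r) DP)"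
proof (intro conjI allI impI)
  show "{\<tau> \<in> BKP_big_cell. coeff \<tau> 0 = 1} = {infinite_pf r | r. skew r}"
  proof (intro equalityI subsetI)
    fix \<tau> assume "\<tau> \<in> {\<tau> \<in> BKP_big_cell. coeff \<tau> 0 = 1}"
    then obtain r where r: "skew r" "\<tau> = tau_series r" using BKP_big_cell_tau_series by blast
    then have "\<tau> = infinite_pf r" by (simp add: infinite_pf_eq)
    then show "\<tau> \<in> {infinite_pf r | r. skew r}" using r(1) by blast
  next
    fix \<tau> assume "\<tau> \<in> {infinite_pf r | r. skew r}"
    then obtain r where "skew r" "\<tau> = tau_series r" by (auto simp: infinite_pf_eq)
    then show "\<tau> \<in> {\<tau> \<in> BKP_big_cell. coeff \<tau> 0 = 1}"
      using tau_series_in_BKP_big_cell coeff_tau_series_0 by blast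
  qed
  fix r assume "skew r"
  then show "convergent (truncated_pf r)" using truncated_pf_tendsto by (auto simp: convergent_def)
  show "((\<lambda>\<nu>. tconst (pf_at r \<nu>) * schur_Q \<nu>) has_sum infinite_pf r) DP"
    unfolding infinite_pf_eq[OF \<open>skew r\<close>] by (rule has_sum_tau_series)
qed

end
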